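(* Let $r\in\mathbb N$, $p\in[1,\infty)$, $V\in\mathfrak Q_p$ and $U\in\mathcal U_{2r}$. Let $\mathfrak a$ be the spectral data of the operator $S_{V,U}$ and $\mu:=\mu^{\mathfrak a}$ its spectral measure, and let $\nu$ be the spectral measure of the operator $S_{V,I}$, $I=I_{2r}$. Then for every $f\in\mathcal S^{2r}$ such that $\operatorname{supp}f\subset(-1,1)$, $$(H_\mu,f)=(H_\nu,f).$$
   Context: Notation. $\mathcal M_k$ is the algebra of complex $k\times k$ matrices, $\mathcal U_k$ its unitary elements, $I:=I_{2r}$, $\mathfrak Q_p:=L_p((0,1),\mathcal M_{2r})$. $W_1^1$ denotes absolutely continuous functions (with integrable derivative). $\mathcal S^{2r}$ is the space of $\mathbb C^{2r}$-valued Schwartz functions on $\mathbb R$. Operators $S_{V,U}$. For $V\in\mathfrak Q_p$ put $\boldsymbol J:=\frac1i\begin{pmatrix}I&0\\0&-I\end{pmatrix}$, $\boldsymbol V:=\begin{pmatrix}0&V\\ V^*&0\end{pmatrix}$ ($4r\times4r$ matrices). For $U\in\mathcal U_{2r}$ the operator $S_{V,U}$ in $\mathbb H:=L_2((0,1),\mathbb C^{4r})$ acts by $S_{V,U}f=\boldsymbol Jf'+\boldsymbol Vf$ on the domain of all $f=(f_1,f_2)^\top$ with $f_1,f_2\in W_1^1((0,1),\mathbb C^{2r})$, $\boldsymbol Jf'+\boldsymbol Vf\in\mathbb H$, $f_1(0)=f_2(0)$, $f_1(1)=Uf_2(1)$. It is self-adjoint, and its spectrum consists of countably many isolated real eigenvalues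 of finite multiplicity accumulating only at $\pm\infty$; let $\zeta_j(V,U)$, $j\in\mathbb Z$, be the pairwise distinct eigenvalues in increasing order with $\zeta_0<0\le\zeta_1$. Spectral data and spectral measure of $S_{V,U}$. Let $a:=\frac1{\sqrt2}(I,\,-I)$ ($2r\times4r$) and let $\varphi_V(\cdot,\zeta),\psi_V(\cdot,\zeta)$ be the $4r\times2r$ matrix solutions of $\boldsymbol Jy'+\boldsymbol Vy=\zeta y$ with $\varphi_V(0,\zeta)=\boldsymbol Ja^*$, $\psi_V(0,\zeta)=a^*$. Let $b_U:=\frac1{\sqrt2}(U^{-1/2},\,-U^{1/2})$, where if $e^{2i\gamma_k}$, $\gamma_k\in[0,\pi)$, are the distinct eigenvalues of $U$, then $U^{1/2}$ is the square root acting as $e^{i\gamma_k}$ on $\ker(U-e^{2i\gamma_k}I)$. The Weyl–Titchmarsh function is $M_{V,U}(\zeta):=-(b_U\varphi_V(1,\zeta))^{-1}\,b_U\psi_V(1,\zeta)$, a meromorphic matrix function whose set of poles is $\{\zeta_j(V,U)\}$. The norming matrices are $C_j(V,U):=-\operatorname{res}_{\zeta=\zeta_j(V,U)}M_{V,U}(\zeta)$; the spectral data is $\mathfrak b_{V,U}:=((\zeta_j(V,U),C_j(V,U)))_{j\in\mathbb Z}$, and the spectral measure is $\mu_{V,U}:=\sum_{j\in\mathbb Z}C_j(V,U)\delta_{\zeta_j(V,U)}$ ($\delta_\lambda$ is the Dirac measure at $\lambda$). For a sequence $\mathfrak a=((\lambda_j,A_j))_{j\in\mathbb Z}$ one writes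 $\mu^{\mathfrak a}:=\sum_jA_j\delta_{\lambda_j}$, so $\mu^{\mathfrak b_{V,U}}=\mu_{V,U}$. The distribution $H_\mu$. For a matrix measure $\mu=\mu^{\mathfrak a}$, $(\mu,f):=\int_{\mathbb R}f\,d\mu=\sum_jA_jf(\lambda_j)$ and $(\widehat\mu,f):=(\mu,\widehat f)$ with $\widehat f(\lambda):=\int_{-\infty}^\infty e^{2i\lambda t}f(t)\,dt$, $f\in\mathcal S^{2r}$. For the spectral measure $\mu=\mu_{V,U}$ of $S_{V,U}$, $H_\mu$ is the restriction of $\widehat\mu-\widehat{\mu_0}$ to $(-1,1)$, i.e. $(H_\mu,f):=(\widehat\mu-\widehat{\mu_0},f)$ for $f\in\mathcal S^{2r}$, $\operatorname{supp}f\subset(-1,1)$, where $\mu_0:=\mu_{0,U}$ is the spectral measure of the free operator $S_{0,U}$ with the same $U$. Explicitly, if $U=\sum_{k=1}^se^{2i\gamma_k}P_k^0$ with $\gamma_1<\dots<\gamma_s$ in $[0,\pi)$, $e^{2i\gamma_k}$ the distinct eigenvalues and $P_k^0$ the corresponding orthogonal spectral projectors, then $\mu_{0,U}=\sum_{k=1}^s\sum_{n\in\mathbb Z}P_k^0\delta_{\gamma_k+\pi n}$. In particular $H_\nu$ is formed with $\mu_{0,I}$. *)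

theory Defs
  imports "HOL-Complex_Analysis.Complex_Analysis"
begin

text \<open>The type variable \<open>'n\<close> indexes \<open>\<complex>\<^sup>2\<^sup>r\<close>, so \<open>CARD('n) = 2 r\<close>, and \<open>'n + 'n\<close> indexes \<open>\<complex>\<^sup>4\<^sup>r\<close>.\<close>

definition ctranspose :: "complex^'n^'m \<Rightarrow> complex^'m^'n" where
  "ctranspose A = map_matrix cnj (transpose A)"

definition cscale :: "complex \<Rightarrow> complex^'n^'m \<Rightarrow> complex^'n^'m" where
  "cscale c A = map_matrix ((*) c) A"

definition unitary_matrices :: "(complex^'n^'n) set" where
  "unitary_matrices = {U. ctranspose U ** U = mat 1 \<and> U ** ctranspose U = mat 1}"

definition block_row :: "complex^'n^'m \<Rightarrow> complex^'n^'m \<Rightarrow> complex^('n + 'n)^'m" where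
  "block_row A B = (\<chi> i j. case j of Inl k \<Rightarrow> A $ i $ k | Inr k \<Rightarrow> B $ i $ k)"

definition block_matrix ::
  "complex^'n^'n \<Rightarrow> complex^'n^'n \<Rightarrow> complex^'n^'n \<Rightarrow> complex^'n^'n \<Rightarrow> complex^('n + 'n)^('n + 'n)" where
  "block_matrix A B C D =
     (\<chi> i. case i of Inl k \<Rightarrow> block_row A B $ k | Inr k \<Rightarrow> block_row C D $ k)"

definition upper :: "complex^('n + 'n) \<Rightarrow> complex^'n" where
  "upper v = (\<chi> i. v $ Inl i)"

definition lower :: "complex^('n + 'n) \<Rightarrow> complex^'n" where
  "lower v = (\<chi> i. v $ Inr i)"

text \<open>A unitary \<open>U\<close> is diagonalisable with eigenvalues on the unit circle, each of which is
  \<open>cis (2 \<gamma>)\<close> for exactly one \<open>\<gamma> \<in> [0, \<pi>)\<close>; hence exactly one matrix satisfies the condition.\<close>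

definition unitary_sqrt :: "complex^'n^'n \<Rightarrow> complex^'n^'n" where
  "unitary_sqrt U = (THE W. \<forall>\<gamma>\<in>{0..<pi}. \<forall>v. U *v v = cis (2 * \<gamma>) *s v \<longrightarrow> W *v v = cis \<gamma> *s v)"

definition Lp01 :: "real \<Rightarrow> (real \<Rightarrow> 'a::euclidean_space) set" where
  "Lp01 p = {f. f \<in> borel_measurable (lebesgue_on {0<..<1}) \<and>
                integrable (lebesgue_on {0<..<1}) (\<lambda>x. norm (f x) powr p)}"

definition absolutely_continuous01 :: "(real \<Rightarrow> 'a::euclidean_space) \<Rightarrow> bool" where
  "absolutely_continuous01 f \<longleftrightarrow>
     (\<forall>\<epsilon>>0. \<exists>\<delta>>0. \<forall>D T. D division_of T \<and> T \<subseteq> {0..1} \<and> (\<Sum>K\<in>D. Sup K - Inf K) < \<delta> \<longrightarrow>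
        (\<Sum>K\<in>D. norm (f (Sup K) - f (Inf K))) < \<epsilon>)"

text \<open>Elements of \<open>W\<^sub>1\<^sup>1(0,1)\<close> are represented by their continuous extensions to \<open>[0,1]\<close>; values
  outside \<open>[0,1]\<close> are irrelevant. The last two conditions follow from absolute continuity.\<close>

definition W11 :: "(real \<Rightarrow> 'a::euclidean_space) set" where
  "W11 = {f. absolutely_continuous01 f \<and>
             (AE x in lebesgue_on {0<..<1}. f differentiable (at x)) \<and>
             (\<lambda>x. vector_derivative f (at x)) \<in> Lp01 1}"

definition J_mat :: "complex^('n::finite + 'n)^('n + 'n)" where
  "J_mat = cscale (1 / \<i>) (block_matrix (mat 1) 0 0 (- mat 1))"

definition V_mat :: "complex^'n^'n \<Rightarrow> complex^('n + 'n)^('n + 'n)" where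
  "V_mat A = block_matrix 0 A (ctranspose A) 0"

definition S_op ::
  "(real \<Rightarrow> complex^'n^'n) \<Rightarrow> (real \<Rightarrow> complex^('n + 'n)) \<Rightarrow> real \<Rightarrow> complex^('n + 'n)" where
  "S_op V f x = J_mat *v vector_derivative f (at x) + V_mat (V x) *v f x"

definition S_dom ::
  "(real \<Rightarrow> complex^'n^'n) \<Rightarrow> complex^'n^'n \<Rightarrow> (real \<Rightarrow> complex^('n + 'n)) set" where
  "S_dom V U = {f. (\<lambda>x. upper (f x)) \<in> W11 \<and> (\<lambda>x. lower (f x)) \<in> W11 \<and> S_op V f \<in> Lp01 2 \<and>
                   upper (f 0) = lower (f 0) \<and> upper (f 1) = U *v lower (f 1)}"

definition eigenvalues :: "(real \<Rightarrow> complex^'n^'n) \<Rightarrow> complex^'n^'n \<Rightarrow> complex set" where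
  "eigenvalues V U =
     {\<zeta>. \<exists>f\<in>S_dom V U. \<not> (AE x in lebesgue_on {0<..<1}. f x = 0) \<and>
                       (AE x in lebesgue_on {0<..<1}. S_op V f x = \<zeta> *s f x)}"

definition eigenvalue_seq :: "(real \<Rightarrow> complex^'n^'n) \<Rightarrow> complex^'n^'n \<Rightarrow> int \<Rightarrow> real" where
  "eigenvalue_seq V U =
     (THE \<zeta>. strict_mono \<zeta> \<and> range (\<lambda>j. complex_of_real (\<zeta> j)) = eigenvalues V U \<and>
             \<zeta> 0 < 0 \<and> 0 \<le> \<zeta> 1)"

definition a_mat :: "complex^('n + 'n)^'n" where
  "a_mat = cscale (1 / sqrt 2) (block_row (mat 1) (- mat 1))"

definition b_mat :: "complex^'n^'n \<Rightarrow> complex^('n + 'n)^'n" where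
  "b_mat U = cscale (1 / sqrt 2) (block_row (matrix_inv (unitary_sqrt U)) (- unitary_sqrt U))"

definition is_solution ::
  "(real \<Rightarrow> complex^'n^'n) \<Rightarrow> complex \<Rightarrow> (real \<Rightarrow> complex^'n^('n + 'n)) \<Rightarrow> bool" where
  "is_solution V \<zeta> y \<longleftrightarrow> y \<in> W11 \<and>
     (AE x in lebesgue_on {0<..<1}.
        J_mat ** vector_derivative y (at x) + V_mat (V x) ** y x = cscale \<zeta> (y x))"

text \<open>A solution is unique on \<open>[0,1]\<close> only, so the definite description selects its value at a
  point (used for \<open>x \<in> [0,1]\<close>) rather than the function on the whole line.\<close>

definition cauchy_solution ::
  "(real \<Rightarrow> complex^'n^'n) \<Rightarrow> complex^'n^('n + 'n) \<Rightarrow> real \<Rightarrow> complex \<Rightarrow> complex^'n^('n + 'n)" where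
  "cauchy_solution V Y0 x \<zeta> = (THE Y. \<exists>y. is_solution V \<zeta> y \<and> y 0 = Y0 \<and> y x = Y)"

definition phi :: "(real \<Rightarrow> complex^'n^'n) \<Rightarrow> real \<Rightarrow> complex \<Rightarrow> complex^'n^('n + 'n)" where
  "phi V = cauchy_solution V (J_mat ** ctranspose a_mat)"

definition psi :: "(real \<Rightarrow> complex^'n^'n) \<Rightarrow> real \<Rightarrow> complex \<Rightarrow> complex^'n^('n + 'n)" where
  "psi V = cauchy_solution V (ctranspose a_mat)"

definition weyl_function ::
  "(real \<Rightarrow> complex^'n^'n) \<Rightarrow> complex^'n^'n \<Rightarrow> complex \<Rightarrow> complex^'n^'n" where
  "weyl_function V U \<zeta> =
     - (matrix_inv (b_mat U ** phi V 1 \<zeta>) ** (b_mat U ** psi V 1 \<zeta>))"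

definition matrix_residue :: "(complex \<Rightarrow> complex^'n^'m) \<Rightarrow> complex \<Rightarrow> complex^'n^'m" where
  "matrix_residue M \<zeta> = (\<chi> i j. residue (\<lambda>z. M z $ i $ j) \<zeta>)"

definition norming_matrix ::
  "(real \<Rightarrow> complex^'n^'n) \<Rightarrow> complex^'n^'n \<Rightarrow> int \<Rightarrow> complex^'n^'n" where
  "norming_matrix V U j =
     - matrix_residue (weyl_function V U) (complex_of_real (eigenvalue_seq V U j))"

definition spectral_data ::
  "(real \<Rightarrow> complex^'n^'n) \<Rightarrow> complex^'n^'n \<Rightarrow> int \<Rightarrow> real \<times> (complex^'n^'n)" where
  "spectral_data V U j = (eigenvalue_seq V U j, norming_matrix V U j)"

text \<open>A discrete matrix measure \<open>\<Sum>\<^sub>j A\<^sub>j \<delta>\<^bsub>\<lambda>\<^sub>j\<^esub>\<close> is represented by the functional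
  \<open>f \<mapsto> (\<mu>, f) = \<integral> f d\<mu> = \<Sum>\<^sub>j A\<^sub>j f(\<lambda>\<^sub>j)\<close>; its total mass is in general infinite, so it is not
  a (finite) vector measure on the Borel sets.\<close>

type_synonym 'n functional = "(real \<Rightarrow> complex^'n) \<Rightarrow> complex^'n"

definition measure_of_data :: "(int \<Rightarrow> real \<times> (complex^'n^'n)) \<Rightarrow> 'n functional" where
  "measure_of_data \<aa> f = (\<Sum>\<^sub>\<infinity>j\<in>UNIV. snd (\<aa> j) *v f (fst (\<aa> j)))"

definition spectral_measure ::
  "(real \<Rightarrow> complex^'n^'n) \<Rightarrow> complex^'n^'n \<Rightarrow> 'n functional" where
  "spectral_measure V U = measure_of_data (spectral_data V U)"

definition schwartz :: "(real \<Rightarrow> complex^'n) set" where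
  "schwartz = {f. \<forall>m. (\<forall>x. ((\<lambda>g x. vector_derivative g (at x)) ^^ m) f differentiable (at x)) \<and>
     (\<forall>k. bounded (range (\<lambda>x. x ^ k *\<^sub>R ((\<lambda>g x. vector_derivative g (at x)) ^^ m) f x)))}"

definition fourier :: "(real \<Rightarrow> complex^'n) \<Rightarrow> real \<Rightarrow> complex^'n" where
  "fourier f s = (LINT t|lborel. cis (2 * s * t) *s f t)"

definition hat_functional :: "'n::finite functional \<Rightarrow> 'n functional" where
  "hat_functional \<mu> f = \<mu> (fourier f)"

text \<open>For \<open>\<mu>\<close> the spectral measure of \<open>S\<^sub>V\<^sub>,\<^sub>U\<close>; to be applied to Schwartz functions \<open>f\<close> with
  support in \<open>(-1,1)\<close>. The matrix \<open>U\<close> enters through the free operator \<open>S\<^sub>0\<^sub>,\<^sub>U\<close>.\<close>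

definition H_dist :: "complex^'n^'n \<Rightarrow> 'n functional \<Rightarrow> 'n functional" where
  "H_dist U \<mu> f = hat_functional \<mu> f - hat_functional (spectral_measure (\<lambda>_. 0) U) f"

end

theory Submission
  imports Defs
begin

text \<open>Subtracting the free functional is harmless: the functional \<open>f \<mapsto> \<Sum>\<^sub>j C\<^sub>j f\<^sup>^(\<zeta>\<^sub>j)\<close>, on test functions \<open>f\<close>
supported in \<open>(-1,1)\<close>, does not depend on the unitary matrix \<open>U\<close> in the boundary condition at all, and
this is applied once to \<open>V\<close> and once to the zero potential
(\<open>spectral_measure_independent_of_boundary_condition\<close>).

Let \<open>M\<^sub>U\<close> be the Weyl function. The norming matrices are its residues up to sign, and the Fourier
transform of \<open>f\<close> extends to an entire function \<open>F\<close> with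
\<open>\<bar>F(z)\<bar> \<le> C e\<^bsup>2b\<bar>Im z\<bar>\<^esup> / (1 + \<bar>z\<bar>\<^sup>2)\<close> for some \<open>b < 1\<close> (\<open>fourier_extension\<close>). So the part of the sum
that belongs to the eigenvalues in a window is a contour integral of \<open>M\<^sub>U F\<close> around a rectangle, and it
is enough that the integral of \<open>(M\<^sub>U - M\<^sub>U\<^sub>') F\<close> tends to zero as the rectangle grows. It does because
\<open>M\<^sub>U - M\<^sub>U\<^sub>' = O(e\<^bsup>-2\<bar>Im z\<bar>\<^esup>)\<close>: the Weyl solutions \<open>\<psi> + \<phi> M\<^sub>U\<close> and \<open>\<psi> + \<phi> M\<^sub>U\<^sub>'\<close> have size
\<open>e\<^bsup>-\<bar>Im z\<bar>\<^esup>\<close> at the endpoint \<open>1\<close>, while their difference is \<open>\<phi> (M\<^sub>U - M\<^sub>U\<^sub>')\<close> and \<open>\<phi>\<close> grows like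
\<open>e\<^bsup>\<bar>Im z\<bar>\<^esup>\<close> (\<open>weyl_function_difference_decay\<close>).

For a potential that is merely integrable the growth of solutions is read off from two quantities:
the energy \<open>\<bar>y\<^sub>1\<bar>\<^sup>2 + \<bar>y\<^sub>2\<bar>\<^sup>2\<close> changes at most at the relative rate \<open>2(\<bar>V\<bar> + \<bar>Im z\<bar>)\<close>, and the flux
\<open>\<bar>y\<^sub>2\<bar>\<^sup>2 - \<bar>y\<^sub>1\<bar>\<^sup>2\<close> has derivative \<open>2 Im z\<close> times the energy. The flux makes the eigenvalues real, the Weyl
function Herglotz, its poles simple and minus its residues positive semidefinite.

Three further points make the argument work. The vertical sides of the rectangles must stay away from
the poles; a normal family argument finds such sides in every unit interval, with bounds that are
uniform (\<open>good_vertical_segments\<close>, \<open>weyl_bounded_on_verticals\<close>). The series over the eigenvalues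
converges absolutely: by positivity of the residues, contour integrals around boxes of bounded size
bound the mass of the spectral measure on unit intervals (\<open>residue_weight_local_bound\<close>). Finally the
numbering of the eigenvalues by the integers exists: they are locally finite as zeros of an entire
function, and they are unbounded in both directions because on a spectral gap a diagonal entry \<open>m\<close> of
the Weyl function satisfies \<open>m' \<ge> k (1 + m\<^sup>2)\<close>, which is impossible on an interval longer than \<open>\<pi> / k\<close>
(\<open>spectrum_gap\<close>).\<close>

section \<open>Absolutely continuous functions on the unit interval\<close>

hide_const (open) Polynomial.content

lemma AE_lebesgue_on_01_iff:
  "(AE x in lebesgue_on {0<..<1::real}. P x) \<longleftrightarrow> negligible {x\<in>{0<..<1}. \<not> P x}"
proof -
  have "(AE x in lebesgue_on {0<..<1::real}. P x) \<longleftrightarrow> (AE x in lebesgue. x \<in> {0<..<1} \<longrightarrow> P x)"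
    by (intro AE_restrict_space_iff) auto
  also have "\<dots> \<longleftrightarrow> {x. \<not> (x \<in> {0<..<1} \<longrightarrow> P x)} \<in> null_sets lebesgue"
    by (simp add: completion.AE_iff_null_sets)
  also have "{x. \<not> (x \<in> {0<..<1} \<longrightarrow> P x)} = {x\<in>{0<..<1}. \<not> P x}" by auto
  finally show ?thesis by (simp add: negligible_iff_null_sets)
qed

lemma division_of_interval_endpoints:
  fixes T :: "real set"
  assumes "D division_of T" "K \<in> D"
  shows "Inf K \<le> Sup K" "K = {Inf K..Sup K}" "Inf K \<in> T" "Sup K \<in> T"
proof -
  obtain a b where K: "K = cbox a b" "K \<noteq> {}" "K \<subseteq> T"
    using assms by blast
  then have "a \<le> b" by auto
  then show "Inf K \<le> Sup K" "K = {Inf K..Sup K}" "Inf K \<in> T" "Sup K \<in> T"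
    using K by auto
qed

text \<open>Linear images, sums, products and exponentials of absolutely continuous functions all have increments
dominated in this way.\<close>

lemma absolutely_continuous01_dominated:
  assumes F: "absolutely_continuous01 F" and G: "absolutely_continuous01 G"
    and H: "\<And>u v. u \<in> {0..1} \<Longrightarrow> v \<in> {0..1} \<Longrightarrow>
      norm (H v - H u) \<le> C * (norm (F v - F u) + norm (G v - G u))"
  shows "absolutely_continuous01 H"
  unfolding absolutely_continuous01_def
proof (intro allI impI)
  fix e :: real assume "e > 0"
  define e' where "e' = e / (2 * (\<bar>C\<bar> + 1))"
  have "e' > 0" using \<open>e > 0\<close> by (auto simp: e'_def)
  obtain d1 where d1: "d1 > 0" "\<And>D T. D division_of T \<Longrightarrow> T \<subseteq> {0..1} \<Longrightarrow> (\<Sum>K\<in>D. Sup K - Inf K) < d1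
     \<Longrightarrow> (\<Sum>K\<in>D. norm (F (Sup K) - F (Inf K))) < e'"
    using F \<open>e' > 0\<close> unfolding absolutely_continuous01_def by meson
  obtain d2 where d2: "d2 > 0" "\<And>D T. D division_of T \<Longrightarrow> T \<subseteq> {0..1} \<Longrightarrow> (\<Sum>K\<in>D. Sup K - Inf K) < d2
     \<Longrightarrow> (\<Sum>K\<in>D. norm (G (Sup K) - G (Inf K))) < e'"
    using G \<open>e' > 0\<close> unfolding absolutely_continuous01_def by meson
  show "\<exists>d>0. \<forall>D T. D division_of T \<and> T \<subseteq> {0..1} \<and> (\<Sum>K\<in>D. Sup K - Inf K) < d \<longrightarrow>
        (\<Sum>K\<in>D. norm (H (Sup K) - H (Inf K))) < e"
  proof (intro exI[of _ "min d1 d2"] conjI allI impI; (elim conjE)?)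
    show "0 < min d1 d2" using d1 d2 by auto
    fix D T assume D: "D division_of T" "T \<subseteq> {0..1}" "(\<Sum>K\<in>D. Sup K - Inf K) < min d1 d2"
    have "(\<Sum>K\<in>D. norm (H (Sup K) - H (Inf K))) \<le>
      (\<Sum>K\<in>D. (\<bar>C\<bar> + 1) * (norm (F (Sup K) - F (Inf K)) + norm (G (Sup K) - G (Inf K))))"
    proof (rule sum_mono)
      fix K assume "K \<in> D"
      then have "Inf K \<in> {0..1}" "Sup K \<in> {0..1}"
        using division_of_interval_endpoints[OF D(1) \<open>K \<in> D\<close>] D(2) by (meson subsetD)+
      then have "norm (H (Sup K) - H (Inf K)) \<le>
        C * (norm (F (Sup K) - F (Inf K)) + norm (G (Sup K) - G (Inf K)))" by (rule H)
      also have "\<dots> \<le> (\<bar>C\<bar> + 1) * (norm (F (Sup K) - F (Inf K)) + norm (G (Sup K) - G (Inf K)))"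
        by (intro mult_right_mono) auto
      finally show "norm (H (Sup K) - H (Inf K)) \<le> \<dots>" .
    qed
    also have "\<dots> = (\<bar>C\<bar> + 1) * ((\<Sum>K\<in>D. norm (F (Sup K) - F (Inf K))) + (\<Sum>K\<in>D. norm (G (Sup K) - G (Inf K))))"
      by (simp only: sum_distrib_left[symmetric] sum.distrib)
    also have "\<dots> < (\<bar>C\<bar> + 1) * (e' + e')"
      using d1(2)[OF D(1,2)] d2(2)[OF D(1,2)] D(3) by (intro mult_strict_left_mono add_strict_mono) auto
    also have "\<dots> = e"
    proof -
      define B where "B = \<bar>C\<bar> + 1"
      have "B > 0" by (simp add: B_def add_nonneg_pos)
      then show ?thesis unfolding e'_def B_def[symmetric] by (simp add: field_simps)
    qed
    finally show "(\<Sum>K\<in>D. norm (H (Sup K) - H (Inf K))) < e" .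
  qed
qed

lemma absolutely_continuous01_imp_continuous_on:
  assumes F: "absolutely_continuous01 F"
  shows "continuous_on {0..1} F"
proof -
  have *: "\<exists>d>0. \<forall>x\<in>{0..1}. \<forall>y\<in>{0..1}. x \<le> y \<and> y - x < d \<longrightarrow> norm (F y - F x) < e" if "e > 0" for e
  proof -
    obtain d where d: "d > 0" "\<And>D T. D division_of T \<Longrightarrow> T \<subseteq> {0..1} \<Longrightarrow> (\<Sum>K\<in>D. Sup K - Inf K) < d
     \<Longrightarrow> (\<Sum>K\<in>D. norm (F (Sup K) - F (Inf K))) < e"
      using F \<open>e > 0\<close> unfolding absolutely_continuous01_def by meson
    have "norm (F y - F x) < e" if "x \<in> {0..1}" "y \<in> {0..1}" "x \<le> y" "y - x < d" for x y
      using d(2)[of "{{x..y}}" "{x..y}"] division_of_self[of x y] that by auto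
    with \<open>d > 0\<close> show ?thesis by blast
  qed
  show ?thesis
    unfolding continuous_on_iff dist_norm
  proof (intro ballI allI impI)
    fix x e :: real assume x: "x \<in> {0..1}" "e > 0"
    obtain d where d: "d > 0" "\<forall>x\<in>{0..1}. \<forall>y\<in>{0..1}. x \<le> y \<and> y - x < d \<longrightarrow> norm (F y - F x) < e"
      using *[OF \<open>e > 0\<close>] by blast
    have "norm (F y - F x) < e" if "y \<in> {0..1}" "norm (y - x) < d" for y
      using d(2)[rule_format, of x y] d(2)[rule_format, of y x] that x
      by (cases "x \<le> y") (auto simp: norm_minus_commute)
    then show "\<exists>d>0. \<forall>x'\<in>{0..1}. norm (x' - x) < d \<longrightarrow> norm (F x' - F x) < e"
      using \<open>d > 0\<close> by blast
  qed
qed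

lemma straddle_estimate:
  fixes F :: "real \<Rightarrow> 'a::real_normed_vector"
  assumes "u \<le> x" "x \<le> v"
    and "norm (F v - F x - (v - x) *\<^sub>R g) \<le> e * \<bar>v - x\<bar>"
    and "norm (F u - F x - (u - x) *\<^sub>R g) \<le> e * \<bar>u - x\<bar>"
  shows "norm ((v - u) *\<^sub>R g - (F v - F u)) \<le> e * (v - u)"
proof -
  have "(v - u) *\<^sub>R g - (F v - F u) = (F u - F x - (u - x) *\<^sub>R g) - (F v - F x - (v - x) *\<^sub>R g)"
    by (simp add: algebra_simps)
  also have "norm \<dots> \<le> e * \<bar>u - x\<bar> + e * \<bar>v - x\<bar>"
    using assms(3,4) norm_triangle_ineq4[of "F u - F x - (u - x) *\<^sub>R g" "F v - F x - (v - x) *\<^sub>R g"] by linarith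
  also have "\<dots> = e * (v - u)" using assms(1,2) by (simp add: algebra_simps)
  finally show ?thesis .
qed

text \<open>The fundamental theorem of calculus for absolutely continuous functions. At a point of
differentiability the gauge makes Riemann sums agree with increments. The exceptional null set lies in
an open set of small measure; intervals tagged there stay inside that open set, so absolute continuity
makes the sum of their increments small.\<close>

theorem absolutely_continuous01_has_integral:
  fixes F :: "real \<Rightarrow> 'a::euclidean_space"
  assumes F: "absolutely_continuous01 F"
    and N: "negligible {x\<in>{0<..<1}. \<not> (F has_vector_derivative f x) (at x)}"
    and st: "0 \<le> s" "s \<le> t" "t \<le> 1"
  shows "(f has_integral (F t - F s)) {s..t}"
proof -
  define N where "N = {x\<in>{0<..<1}. \<not> (F has_vector_derivative f x) (at x)} \<union> {0,1}"
  have neg: "negligible N" unfolding N_def using assms(2) by (intro negligible_Un) auto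
  define g where "g = (\<lambda>x. if x \<in> N then 0 else f x)"
  have der: "(F has_vector_derivative g x) (at x)" if "x \<in> {s..t}" "x \<notin> N" for x
    using that st unfolding N_def g_def by auto
  have "(g has_integral (F t - F s)) {s..t}"
    unfolding has_integral_real
  proof (intro allI impI)
    fix e :: real assume "e > 0"
    obtain d where d: "d > 0" "\<And>D T. D division_of T \<Longrightarrow> T \<subseteq> {0..1} \<Longrightarrow> (\<Sum>K\<in>D. Sup K - Inf K) < d
     \<Longrightarrow> (\<Sum>K\<in>D. norm (F (Sup K) - F (Inf K))) < e / 2"
      using F half_gt_zero[OF \<open>e > 0\<close>] unfolding absolutely_continuous01_def by meson
    have "N \<in> sets lebesgue" using neg by (simp add: negligible_imp_sets)
    then obtain W where W: "open W" "N \<subseteq> W" "W - N \<in> lmeasurable" "emeasure lebesgue (W - N) < ennreal d"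
      using sets_lebesgue_outer_open d(1) by metis
    have Wl: "W \<in> lmeasurable"
    proof -
      have "N \<in> lmeasurable" using neg by (rule negligible_imp_measurable)
      then have "N \<union> (W - N) \<in> lmeasurable" using W(3) by (rule fmeasurable.Un)
      moreover have "N \<union> (W - N) = W" using W(2) by auto
      ultimately show ?thesis by simp
    qed
    have Wd: "measure lebesgue W < d"
    proof -
      have "measure lebesgue W = measure lebesgue (W - N)"
        by (rule measure_negligible_symdiff[symmetric, OF _ ])
           (use W Wl neg in \<open>auto intro: negligible_subset\<close>)
      also have "\<dots> < d" using W(3,4) d(1)
        by (metis emeasure_eq_ennreal_measure ennreal_less_iff fmeasurableD2 measure_nonneg)
      finally show ?thesis .
    qed
    define e' where "e' = e / (2 * (t - s + 1))"
    have "e' > 0" using \<open>e > 0\<close> st unfolding e'_def by auto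
    have "\<exists>r>0. \<forall>y. \<bar>y - x\<bar> < r \<longrightarrow> norm (F y - F x - (y - x) *\<^sub>R g x) \<le> e' * \<bar>y - x\<bar>"
      if "x \<in> {s..t}" "x \<notin> N" for x
      using der[OF that] \<open>e' > 0\<close> unfolding has_vector_derivative_def has_derivative_at_alt
      by (metis real_norm_def)
    then obtain r where r: "\<And>x. x \<in> {s..t} \<Longrightarrow> x \<notin> N \<Longrightarrow> r x > 0"
      "\<And>x y. x \<in> {s..t} \<Longrightarrow> x \<notin> N \<Longrightarrow> \<bar>y - x\<bar> < r x \<Longrightarrow> norm (F y - F x - (y - x) *\<^sub>R g x) \<le> e' * \<bar>y - x\<bar>"
      by metis
    define \<gamma> where "\<gamma> = (\<lambda>x. if x \<in> N then W else if x \<in> {s..t} then ball x (r x) else UNIV)"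
    have "gauge \<gamma>"
      unfolding gauge_def \<gamma>_def using W r(1) by auto
    have fine_estimate: "norm ((\<Sum>(x,k)\<in>p. content k *\<^sub>R g x) - (F t - F s)) < e"
      if p: "p tagged_division_of {s..t}" "\<gamma> fine p" for p
    proof -
      have finp: "finite p" using p(1) by (rule tagged_division_of_finite)
      let ?h = "\<lambda>(x,K). content K *\<^sub>R g x - (F (Sup K) - F (Inf K))"
      define q where "q = {z\<in>p. fst z \<in> N}"
      have K: "\<exists>u v. K = {u..v} \<and> u \<le> x \<and> x \<le> v \<and> s \<le> u \<and> v \<le> t" if xK: "(x,K) \<in> p" for x K
      proof -
        obtain u v where "K = cbox u v" "x \<in> K" "K \<subseteq> {s..t}"
          using tagged_division_ofD(2,3,4)[OF p(1) xK] by blast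
        then show ?thesis by (intro exI[of _ u] exI[of _ v]) auto
      qed
      have eq: "(\<Sum>(x,k)\<in>p. content k *\<^sub>R g x) - (F t - F s) = sum ?h p"
      proof -
        have "sum ?h p = (\<Sum>(x,k)\<in>p. content k *\<^sub>R g x) - (\<Sum>(x,K)\<in>p. F (Sup K) - F (Inf K))"
          by (simp add: sum_subtractf split_def)
        then show ?thesis using additive_tagged_division_1[OF st(2) p(1), of F] by simp
      qed
      have split: "sum ?h p = sum ?h (p - q) + sum ?h q"
        using finp by (intro sum.subset_diff) (auto simp: q_def)
      have A1: "norm (sum ?h (p - q)) \<le> e' * (t - s)"
      proof -
        have "norm (sum ?h (p - q)) \<le> (\<Sum>(x,K)\<in>p - q. e' * content K)"
        proof (rule sum_norm_le, clarify)
          fix x K assume xK: "(x,K) \<in> p" "(x,K) \<notin> q"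
          obtain u v where uv: "K = {u..v}" "u \<le> x" "x \<le> v" "s \<le> u" "v \<le> t" using K[OF xK(1)] by blast
          have x: "x \<in> {s..t}" "x \<notin> N" using xK uv by (auto simp: q_def)
          have "K \<subseteq> ball x (r x)" using p(2) xK(1) x unfolding fine_def \<gamma>_def by fastforce
          moreover have "u \<in> K" "v \<in> K" using uv by auto
          ultimately have "u \<in> ball x (r x)" "v \<in> ball x (r x)" by blast+
          then have "\<bar>u - x\<bar> < r x" "\<bar>v - x\<bar> < r x" by (simp_all add: dist_real_def)
          then have "norm ((v - u) *\<^sub>R g x - (F v - F u)) \<le> e' * (v - u)"
            using \<open>\<bar>u - x\<bar> < r x\<close> \<open>\<bar>v - x\<bar> < r x\<close> by (intro straddle_estimate[OF uv(2,3)] r(2)[OF x])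
          then show "norm (content K *\<^sub>R g x - (F (Sup K) - F (Inf K))) \<le> e' * content K"
            using uv by auto
        qed
        also have "\<dots> \<le> (\<Sum>(x,K)\<in>p. e' * content K)"
          using finp \<open>e' > 0\<close> by (intro sum_mono2) auto
        also have "\<dots> = e' * (\<Sum>(x,K)\<in>p. content K)" by (simp add: sum_distrib_left split_def)
        also have "(\<Sum>(x,K)\<in>p. content K) = t - s"
          using additive_content_tagged_division[of p s t] p(1) st by simp
        finally show ?thesis .
      qed
      have A2: "norm (sum ?h q) < e / 2"
      proof -
        have qp: "q tagged_partial_division_of {s..t}"
        proof (rule tagged_partial_division_subset)
          show "p tagged_partial_division_of {s..t}"
            using p(1) unfolding tagged_division_of_def by (rule conjunct1)
        qed (auto simp: q_def)
        have div: "(snd ` q) division_of \<Union>(snd ` q)"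
          using qp by (rule partial_division_of_tagged_division)
        have sub: "\<Union>(snd ` q) \<subseteq> {0..1}"
        proof -
          have "K \<subseteq> {s..t}" if "K \<in> snd ` q" for K
            using tagged_partial_division_ofD(3)[OF qp] that by (metis imageE prod.collapse)
          then have "\<Union>(snd ` q) \<subseteq> {s..t}" by (rule Sup_least)
          then show ?thesis using st by auto
        qed
        have subW: "\<Union>(snd ` q) \<subseteq> W"
        proof -
          have "K \<subseteq> W" if "(x,K) \<in> q" for x K
          proof -
            have "(x,K) \<in> p" "x \<in> N" using that by (auto simp: q_def)
            then have "K \<subseteq> \<gamma> x" using p(2) unfolding fine_def by blast
            then show ?thesis using \<open>x \<in> N\<close> by (simp add: \<gamma>_def)
          qed
          then show ?thesis by (intro Sup_least) (metis imageE prod.collapse)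
        qed
        have "(\<Sum>K\<in>snd ` q. Sup K - Inf K) = (\<Sum>K\<in>snd ` q. measure lebesgue K)"
        proof (rule sum.cong)
          fix K assume "K \<in> snd ` q"
          note K = division_of_interval_endpoints(1,2)[OF div this]
          have "measure lebesgue {Inf K..Sup K} = Sup K - Inf K" using K(1) by simp
          then show "Sup K - Inf K = measure lebesgue K" using K(2) by simp
        qed auto
        also have "\<dots> = measure lebesgue (\<Union>(snd ` q))"
          using div by (rule content_division)
        also have "\<dots> \<le> measure lebesgue W"
        proof (rule measure_mono_fmeasurable[OF subW _ Wl])
          have "closed K" if "K \<in> snd ` q" for K
            using division_ofD(4)[OF div that] closed_cbox by blast
          then have "closed (\<Union>(snd ` q))"
            using division_ofD(1)[OF div] by (intro closed_Union) auto
          then show "\<Union>(snd ` q) \<in> sets lebesgue" by (simp add: borel_closed)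
        qed
        finally have "(\<Sum>K\<in>snd ` q. Sup K - Inf K) < d" using Wd by linarith
        then have *: "(\<Sum>K\<in>snd ` q. norm (F (Sup K) - F (Inf K))) < e / 2"
          using d(2)[OF div sub] by simp
        have "norm (sum ?h q) \<le> (\<Sum>(x,K)\<in>q. norm (F (Sup K) - F (Inf K)))"
        proof (rule sum_norm_le, clarify)
          fix x K assume "(x,K) \<in> q"
          then have "g x = 0" by (auto simp: q_def g_def)
          then show "norm (content K *\<^sub>R g x - (F (Sup K) - F (Inf K))) \<le> norm (F (Sup K) - F (Inf K))"
            by (simp add: norm_minus_commute)
        qed
        also have "\<dots> = (\<Sum>K\<in>snd ` q. norm (F (Sup K) - F (Inf K)))"
        proof -
          let ?d = "\<lambda>K. if K = {} then 0 else norm (F (Sup K) - F (Inf K))"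
          have ne: "K \<noteq> {}" if "(x,K) \<in> q" for x K
            using tagged_partial_division_ofD(2)[OF qp that] by auto
          have "(\<Sum>(x,K)\<in>q. norm (F (Sup K) - F (Inf K))) = (\<Sum>(x,K)\<in>q. ?d K)"
            using ne by (intro sum.cong) auto
          also have "\<dots> = (\<Sum>K\<in>snd ` q. ?d K)"
          proof (rule sum.over_tagged_division_lemma[OF tagged_partial_division_of_Union_self[OF qp]])
            fix u v :: real assume "box u v = {}"
            then show "?d (cbox u v) = 0" by (cases "u = v") auto
          qed
          also have "\<dots> = (\<Sum>K\<in>snd ` q. norm (F (Sup K) - F (Inf K)))"
            using ne by (intro sum.cong) auto
          finally show ?thesis .
        qed
        finally show ?thesis using * by linarith
      qed
      have "e' * (t - s) \<le> e / 2"
        using \<open>e > 0\<close> st unfolding e'_def by (simp add: field_simps)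
      then have "norm (sum ?h (p - q)) \<le> e / 2" using A1 by (rule order_trans[rotated])
      then have "norm (sum ?h (p - q)) + norm (sum ?h q) < e" using A2 by simp
      then show ?thesis
        unfolding eq split by (rule le_less_trans[OF norm_triangle_ineq])
    qed
    show "\<exists>\<gamma>. gauge \<gamma> \<and> (\<forall>\<D>. \<D> tagged_division_of {s..t} \<and> \<gamma> fine \<D> \<longrightarrow>
        norm ((\<Sum>(x,k)\<in>\<D>. content k *\<^sub>R g x) - (F t - F s)) < e)"
    proof (intro exI[of _ \<gamma>] conjI allI impI)
      show "gauge \<gamma>" by fact
    next
      fix p assume "p tagged_division_of {s..t} \<and> \<gamma> fine p"
      then show "norm ((\<Sum>(x,k)\<in>p. content k *\<^sub>R g x) - (F t - F s)) < e"
        by (intro fine_estimate) (elim conjE; assumption)+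
    qed
  qed
  then show ?thesis
    by (rule has_integral_spike[OF neg, rotated]) (auto simp: g_def)
qed

section \<open>Lebesgue's differentiation theorem\<close>

text \<open>Truncate \<open>\<bar>g\<bar>\<close> at a height \<open>n\<close>. The excess has small integral by dominated convergence, and the truncated
part contributes at most \<open>n\<close> times the total length of the intervals.\<close>

lemma absolutely_continuous01_integral:
  fixes g :: "real \<Rightarrow> 'a::euclidean_space"
  assumes g: "g absolutely_integrable_on {0..1}"
  shows "absolutely_continuous01 (\<lambda>x. integral {0..x} g)"
  unfolding absolutely_continuous01_def
proof (intro allI impI)
  fix e :: real assume "e > 0"
  define h where "h = (\<lambda>x. norm (g x))"
  define hn where "hn = (\<lambda>(n::nat) x. min (h x) (real n))"
  have habs: "h absolutely_integrable_on {0..1}"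
    unfolding h_def using g by (rule absolutely_integrable_norm[unfolded o_def])
  have hint: "h integrable_on {0..1}"
    using habs by (rule set_lebesgue_integral_eq_integral)
  have hnint: "hn n integrable_on {0..1}" for n
  proof -
    have "(\<lambda>x::real. real n) absolutely_integrable_on {0..1}"
      by (intro absolutely_integrable_continuous_real) auto
    from absolutely_integrable_min[OF habs this] show ?thesis
      unfolding hn_def by (intro set_lebesgue_integral_eq_integral(1)) simp
  qed
  have lim: "(\<lambda>n. integral {0..1} (hn n)) \<longlonglongrightarrow> integral {0..1} h"
  proof (rule dominated_convergence(2)[OF hnint hint])
    show "norm (hn n x) \<le> h x" for n x by (auto simp: hn_def h_def min_def)
    show "(\<lambda>n. hn n x) \<longlonglongrightarrow> h x" for x
    proof (rule tendsto_eventually)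
      obtain N where "h x \<le> real N" using real_arch_simple by blast
      then show "\<forall>\<^sub>F n in sequentially. hn n x = h x"
        unfolding hn_def by (intro eventually_sequentiallyI[of N]) (auto simp: min_def)
    qed
  qed
  from lim \<open>e > 0\<close> obtain n where n: "norm (integral {0..1} (hn n) - integral {0..1} h) < e / 2"
    by (metis LIMSEQ_iff half_gt_zero order_refl)
  define M where "M = real n + 1"
  show "\<exists>\<delta>>0. \<forall>D T. D division_of T \<and> T \<subseteq> {0..1} \<and> (\<Sum>K\<in>D. Sup K - Inf K) < \<delta> \<longrightarrow>
     (\<Sum>K\<in>D. norm (integral {0..Sup K} g - integral {0..Inf K} g)) < e"
  proof (intro exI[of _ "e / (2 * M)"] conjI allI impI; (elim conjE)?)
    show "0 < e / (2 * M)" using \<open>e > 0\<close> by (auto simp: M_def)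
    fix D T assume D: "D division_of T" "T \<subseteq> {0..1::real}" "(\<Sum>K\<in>D. Sup K - Inf K) < e / (2 * M)"
    let ?d = "\<lambda>x. h x - hn n x"
    have dint: "?d integrable_on {0..1}" using hint hnint by (rule integrable_diff)
    have "(\<Sum>K\<in>D. norm (integral {0..Sup K} g - integral {0..Inf K} g)) \<le>
      (\<Sum>K\<in>D. integral K ?d + M * (Sup K - Inf K))"
    proof (rule sum_mono)
      fix K assume "K \<in> D"
      define u v where "u = Inf K" and "v = Sup K"
      have uv: "K = {u..v}" "u \<le> v" "0 \<le> u" "v \<le> 1"
        using division_of_interval_endpoints[OF D(1) \<open>K \<in> D\<close>] D(2) unfolding u_def v_def by auto
      have sub: "{u..v} \<subseteq> {0..1}" using uv by auto
      have i: "g integrable_on {u..v}" "h integrable_on {u..v}" "hn n integrable_on {u..v}" "?d integrable_on {u..v}"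
        using integrable_on_subinterval[OF _ sub] hint hnint dint
          set_lebesgue_integral_eq_integral(1)[OF g] by blast+
      have "integral {0..u} g + integral {u..v} g = integral {0..v} g"
        using uv by (intro Henstock_Kurzweil_Integration.integral_combine integrable_on_subinterval[OF set_lebesgue_integral_eq_integral(1)[OF g]]) auto
      then have "norm (integral {0..v} g - integral {0..u} g) = norm (integral {u..v} g)"
        by (metis add_diff_cancel_left')
      also have "\<dots> \<le> integral {u..v} h"
        using i by (intro Henstock_Kurzweil_Integration.integral_norm_bound_integral) (auto simp: h_def)
      also have "\<dots> = integral {u..v} ?d + integral {u..v} (hn n)"
        using i by (simp add: integral_diff)
      also have "integral {u..v} (hn n) \<le> integral {u..v} (\<lambda>_. M)"
        using i by (intro integral_le) (auto simp: hn_def M_def)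
      also have "\<dots> = M * (v - u)" using uv by simp
      finally show "norm (integral {0..Sup K} g - integral {0..Inf K} g) \<le> integral K ?d + M * (Sup K - Inf K)"
        by (simp add: uv u_def[symmetric] v_def[symmetric])
    qed
    also have "\<dots> = (\<Sum>K\<in>D. integral K ?d) + M * (\<Sum>K\<in>D. Sup K - Inf K)"
      by (simp only: sum_distrib_left[symmetric] sum.distrib)
    also have "(\<Sum>K\<in>D. integral K ?d) \<le> integral {0..1} ?d"
    proof -
      have "(?d has_integral (\<Sum>K\<in>D. integral K ?d)) T"
        by (rule has_integral_combine_division_topdown[OF dint D(1,2)])
      moreover have "(?d has_integral (integral {0..1} ?d)) {0..1}" using dint by (rule integrable_integral)
      ultimately show ?thesis
        by (rule has_integral_subset_le[OF D(2)]) (auto simp: hn_def)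
    qed
    also have "integral {0..1} ?d < e / 2"
    proof -
      have "integral {0..1} ?d = integral {0..1} h - integral {0..1} (hn n)"
        using hint hnint by (rule integral_diff)
      also have "\<dots> < e / 2" using n unfolding real_norm_def by linarith
      finally show ?thesis .
    qed
    also have "M * (\<Sum>K\<in>D. Sup K - Inf K) \<le> e / 2"
    proof -
      have "M > 0" by (simp add: M_def)
      then show ?thesis using D(3) by (simp add: field_simps)
    qed
    finally show "(\<Sum>K\<in>D. norm (integral {0..Sup K} g - integral {0..Inf K} g)) < e" by simp
  qed
qed

text \<open>Let \<open>E\<^sub>k\<close> be the set of points with arbitrarily short one-sided intervals on which the difference
quotient misses \<open>g x\<close> by more than \<open>1 / (k + 1)\<close>. By Vitali's theorem disjoint intervals of this kind cover
\<open>E\<^sub>k\<close> up to a null set. They can be chosen so short that Henstock's lemma bounds the sum of the errors,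
and hence their total length, by an arbitrarily small number.\<close>

theorem Lebesgue_differentiation_01:
  fixes g :: "real \<Rightarrow> 'a::euclidean_space"
  assumes g: "g integrable_on {0..1}"
  shows "negligible {x\<in>{0<..<1}. \<not> ((\<lambda>x. integral {0..x} g) has_vector_derivative g x) (at x)}"
proof -
  define G where "G = (\<lambda>x. integral {0..x} g)"
  define P where "P = (\<lambda>k x u v. u \<le> x \<and> x \<le> v \<and> (u = x \<or> v = x) \<and> 0 \<le> u \<and> u < v \<and> v \<le> 1 \<and>
    (v - u) < real (Suc k) * norm ((v - u) *\<^sub>R g x - (G v - G u)))"
  define E where "E = (\<lambda>k. {x\<in>{0<..<1::real}. \<forall>d>0. \<exists>u v. P k x u v \<and> v - u < d})"
  have Gdiff: "G v - G u = integral {u..v} g" if "0 \<le> u" "u \<le> v" "v \<le> 1" for u v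
  proof -
    have "integral {0..u} g + integral {u..v} g = integral {0..v} g"
      using that by (intro Henstock_Kurzweil_Integration.integral_combine integrable_on_subinterval[OF g]) auto
    then show ?thesis by (simp add: G_def algebra_simps)
  qed
  have neg: "negligible (E k)" for k
    unfolding negligible_outer_le
  proof (intro allI impI)
    fix e :: real assume "e > 0"
    define e' where "e' = e / Suc k"
    have "e' > 0" using \<open>e > 0\<close> by (auto simp: e'_def)
    obtain \<gamma> where \<gamma>: "gauge \<gamma>"
      "\<And>p. p tagged_partial_division_of (cbox 0 1) \<Longrightarrow> \<gamma> fine p \<Longrightarrow>
         (\<Sum>(x,K)\<in>p. norm (content K *\<^sub>R g x - integral K g)) < e'"
      using Henstock_lemma[of g 0 1 e'] g \<open>e' > 0\<close> by auto
    define I where "I = {(x,u,v). x \<in> E k \<and> P k x u v \<and> {u..v} \<subseteq> \<gamma> x}"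
    define c where "c = (\<lambda>(x::real,u,v). (u + v) / (2::real))"
    define r where "r = (\<lambda>(x::real,u,v). (v - u) / (2::real))"
    have cb: "cball (c (x,u,v)) (r (x,u,v)) = {u..v}" for x u v
      by (auto simp: cball_eq_atLeastAtMost c_def r_def field_simps)
    have cover: "\<exists>i. i \<in> I \<and> x \<in> cball (c i) (r i) \<and> r i < d" if xd: "x \<in> E k" "d > 0" for x d
    proof -
      obtain s where s: "s > 0" "ball x s \<subseteq> \<gamma> x"
        using \<gamma>(1) unfolding gauge_def by (meson openE)
      obtain u v where uv: "P k x u v" "v - u < min s d"
      proof -
        have "0 < min s d" using xd s(1) by simp
        then show ?thesis using xd(1) that unfolding E_def by blast
      qed
      have "{u..v} \<subseteq> ball x s" using uv unfolding P_def by (auto simp: dist_real_def)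
      then have "(x,u,v) \<in> I" using xd uv s by (auto simp: I_def)
      moreover have "x \<in> cball (c (x,u,v)) (r (x,u,v))" unfolding cb using uv by (auto simp: P_def)
      moreover have "r (x,u,v) < d" using uv by (auto simp: r_def P_def)
      ultimately show ?thesis by blast
    qed
    obtain C where C: "countable C" "C \<subseteq> I"
      "pairwise (\<lambda>i j. disjnt (cball (c i) (r i)) (cball (c j) (r j))) C"
      "negligible (E k - (\<Union>i\<in>C. cball (c i) (r i)))"
    proof (rule Vitali_covering_theorem_cballs[of I r "E k" c])
      show "0 < r i" if "i \<in> I" for i using that by (auto simp: I_def P_def r_def)
    qed (use cover that in auto)
    have fin: "measure lebesgue (\<Union>i\<in>C'. cball (c i) (r i)) \<le> e" if "C' \<subseteq> C" "finite C'" for C'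
    proof -
      define p where "p = (\<lambda>(x,u,v). (x, {u..v::real})) ` C'"
      have CP: "P k x u v" "{u..v} \<subseteq> \<gamma> x" if "(x,u,v) \<in> C'" for x u v
        using that \<open>C' \<subseteq> C\<close> C(2) by (auto simp: I_def)
      have disj: "{u..v} \<inter> {u'..v'} = {}" if "(x,u,v) \<in> C'" "(x',u',v') \<in> C'" "(x,u,v) \<noteq> (x',u',v')" for x u v x' u' v'
      proof -
        have "disjnt (cball (c (x,u,v)) (r (x,u,v))) (cball (c (x',u',v')) (r (x',u',v')))"
          using that \<open>C' \<subseteq> C\<close> by (intro pairwiseD[OF C(3)]) auto
        then show ?thesis unfolding cb disjnt_def .
      qed
      have inj: "inj_on (\<lambda>(x,u,v). (x, {u..v::real})) C'"
      proof (rule inj_onI)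
        fix i j assume *: "i \<in> C'" "j \<in> C'"
          "(case i of (x, u, v) \<Rightarrow> (x, {u..v})) = (case j of (x, u, v) \<Rightarrow> (x, {u..v}))"
        obtain x u v x' u' v' where ij: "i = (x,u,v)" "j = (x',u',v')" by (metis prod.exhaust)
        have "x \<in> {u..v} \<inter> {u'..v'}" using CP(1)[of x u v] * ij by (auto simp: P_def)
        then show "i = j" using disj[of x u v x' u' v'] * ij by blast
      qed
      have "p tagged_partial_division_of cbox 0 1"
        unfolding tagged_partial_division_of_def
      proof (intro conjI allI impI; (elim conjE)?)
        show "finite p" using \<open>finite C'\<close> by (simp add: p_def)
      next
        fix x K assume "(x,K) \<in> p"
        then obtain u v where uv: "(x,u,v) \<in> C'" "K = {u..v}" by (auto simp: p_def)
        have "u \<le> x" "x \<le> v" "0 \<le> u" "v \<le> 1" using CP(1)[OF uv(1)] by (auto simp: P_def)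
        then show "x \<in> K" "K \<subseteq> cbox 0 1" using uv(2) by auto
        show "\<exists>a b. K = cbox a b" using uv(2) by (metis box_real(2))
      next
        fix x K x' K' assume *: "(x,K) \<in> p" "(x',K') \<in> p" "(x,K) \<noteq> (x',K')"
        obtain u v where uv: "(x,u,v) \<in> C'" "K = {u..v}" using *(1) by (auto simp: p_def)
        obtain u' v' where uv': "(x',u',v') \<in> C'" "K' = {u'..v'}" using *(2) by (auto simp: p_def)
        have "K \<inter> K' = {}" using disj[OF uv(1) uv'(1)] uv(2) uv'(2) *(3) by auto
        then show "interior K \<inter> interior K' = {}" using interior_subset by blast
      qed
      moreover have "\<gamma> fine p" unfolding fine_def p_def using CP(2) by fastforce
      ultimately have less: "(\<Sum>(x,K)\<in>p. norm (content K *\<^sub>R g x - integral K g)) < e'" by (rule \<gamma>(2))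
      have "measure lebesgue (\<Union>i\<in>C'. cball (c i) (r i)) \<le> (\<Sum>i\<in>C'. measure lebesgue (cball (c i) (r i)))"
        using \<open>finite C'\<close> by (intro measure_UNION_le) auto
      also have "\<dots> \<le> (\<Sum>(x,u,v)\<in>C'. real (Suc k) * norm (content {u..v} *\<^sub>R g x - integral {u..v} g))"
      proof (rule sum_mono, clarify)
        fix x u v assume "(x,u,v) \<in> C'"
        from CP(1)[OF this] have *: "0 \<le> u" "u \<le> v" "v \<le> 1" "(v - u) < real (Suc k) * norm ((v - u) *\<^sub>R g x - (G v - G u))"
          by (auto simp: P_def)
        then show "measure lebesgue (cball (c (x,u,v)) (r (x,u,v))) \<le> real (Suc k) * norm (content {u..v} *\<^sub>R g x - integral {u..v} g)"
          unfolding cb Gdiff[OF *(1-3), symmetric] by simp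
      qed
      also have "\<dots> = real (Suc k) * (\<Sum>(x,K)\<in>p. norm (content K *\<^sub>R g x - integral K g))"
        unfolding p_def sum.reindex[OF inj] by (simp add: sum_distrib_left split_def o_def)
      also have "\<dots> \<le> real (Suc k) * e'" using less by (intro mult_left_mono) auto
      also have "\<dots> = e" by (simp add: e'_def)
      finally show ?thesis .
    qed
    let ?U = "\<Union>i\<in>C. cball (c i) (r i)"
    have U: "?U \<in> lmeasurable" "measure lebesgue ?U \<le> e"
      using fin by (intro fmeasurable_UN_bound[OF C(1)] measure_UN_bound[OF C(1)]; auto)+
    have nl: "E k - ?U \<in> lmeasurable" "measure lebesgue (E k - ?U) = 0"
      using C(4) by (auto intro: negligible_imp_measurable negligible_imp_measure0)
    show "\<exists>T. E k \<subseteq> T \<and> T \<in> lmeasurable \<and> measure lebesgue T \<le> e"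
    proof (intro exI[of _ "?U \<union> (E k - ?U)"] conjI)
      show "?U \<union> (E k - ?U) \<in> lmeasurable" using U nl by (intro fmeasurable.Un)
      have "measure lebesgue (?U \<union> (E k - ?U)) \<le> measure lebesgue ?U + measure lebesgue (E k - ?U)"
        using U nl by (intro measure_Un_le) auto
      then show "measure lebesgue (?U \<union> (E k - ?U)) \<le> e" using U nl by linarith
    qed auto
  qed
  have "(G has_vector_derivative g x) (at x)" if x: "x \<in> {0<..<1}" "x \<notin> (\<Union>k. E k)" for x
    unfolding has_vector_derivative_def has_derivative_at_alt
  proof (intro conjI allI impI)
    show "bounded_linear (\<lambda>h. h *\<^sub>R g x)" by (rule bounded_linear_scaleR_left)
    fix e :: real assume "e > 0"
    obtain k where k: "1 / real (Suc k) < e" using \<open>e > 0\<close> nat_approx_posE by blast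
    have "x \<notin> E k" using x(2) by blast
    with x(1) have "\<exists>d>0. \<forall>u v. P k x u v \<longrightarrow> \<not> v - u < d" unfolding E_def by simp
    then obtain d where d: "d > 0" "\<And>u v. P k x u v \<Longrightarrow> \<not> v - u < d" by blast
    define d' where "d' = min d (min x (1 - x))"
    have "d' > 0" using d x by (auto simp: d'_def)
    have key: "norm ((v - u) *\<^sub>R g x - (G v - G u)) \<le> e * (v - u)"
      if "u < v" "u = x \<or> v = x" "v - u < d'" for u v
    proof -
      have "\<not> P k x u v" using d(2)[of u v] that by (auto simp: d'_def)
      then have "\<not> (v - u) < real (Suc k) * norm ((v - u) *\<^sub>R g x - (G v - G u))"
        using that x unfolding P_def d'_def by auto
      then have "norm ((v - u) *\<^sub>R g x - (G v - G u)) \<le> (1 / real (Suc k)) * (v - u)"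
        by (simp add: field_simps)
      also have "\<dots> \<le> e * (v - u)" using k that by (intro mult_right_mono) auto
      finally show ?thesis .
    qed
    show "\<exists>d>0. \<forall>y. norm (y - x) < d \<longrightarrow> norm (G y - G x - (y - x) *\<^sub>R g x) \<le> e * norm (y - x)"
    proof (intro exI[of _ d'] conjI allI impI)
      fix y assume y: "norm (y - x) < d'"
      consider "y = x" | "x < y" | "y < x" by linarith
      then show "norm (G y - G x - (y - x) *\<^sub>R g x) \<le> e * norm (y - x)"
      proof cases
        case 2
        then show ?thesis using key[of x y] y by (simp add: norm_minus_commute)
      next
        case 3
        have eq: "G y - G x - (y - x) *\<^sub>R g x = (x - y) *\<^sub>R g x - (G x - G y)" by (simp add: algebra_simps)
        show ?thesis unfolding eq using key[of y x] y 3 by simp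
      qed auto
    qed fact
  qed
  then have "{x\<in>{0<..<1}. \<not> (G has_vector_derivative g x) (at x)} \<subseteq> (\<Union>k. E k)" by blast
  moreover have "negligible (\<Union>k. E k)" using neg by (intro negligible_countable_Union) auto
  ultimately show ?thesis unfolding G_def by (rule negligible_subset[rotated])
qed

section \<open>Calculus of almost everywhere derivatives\<close>

text \<open>A derivative almost everywhere is determined only up to null sets. The function \<open>f\<close> is a chosen
representative, so that the right-hand side of a differential equation can be used pointwise.\<close>

definition ac_deriv :: "(real \<Rightarrow> 'a::euclidean_space) \<Rightarrow> (real \<Rightarrow> 'a) \<Rightarrow> bool" where
  "ac_deriv F f \<longleftrightarrow> absolutely_continuous01 F \<and>
     negligible {x\<in>{0<..<1}. \<not> (F has_vector_derivative f x) (at x)}"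

lemma ac_deriv_continuous_on: "ac_deriv F f \<Longrightarrow> continuous_on {0..1} F"
  unfolding ac_deriv_def by (blast intro: absolutely_continuous01_imp_continuous_on)

lemma ac_deriv_has_integral:
  assumes "ac_deriv F f" "0 \<le> s" "s \<le> t" "t \<le> 1"
  shows "(f has_integral (F t - F s)) {s..t}"
  using assms absolutely_continuous01_has_integral unfolding ac_deriv_def by blast

lemma ac_deriv_combine:
  assumes F: "ac_deriv F f" and G: "ac_deriv G g"
    and H: "\<And>u v. u \<in> {0..1} \<Longrightarrow> v \<in> {0..1} \<Longrightarrow>
      norm (H v - H u) \<le> C * (norm (F v - F u) + norm (G v - G u))"
    and h: "\<And>x. x \<in> {0<..<1} \<Longrightarrow> (F has_vector_derivative f x) (at x) \<Longrightarrow>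
      (G has_vector_derivative g x) (at x) \<Longrightarrow> (H has_vector_derivative h x) (at x)"
  shows "ac_deriv H h"
  unfolding ac_deriv_def
proof
  show "absolutely_continuous01 H"
    using F G H unfolding ac_deriv_def by (blast intro: absolutely_continuous01_dominated)
  have "negligible ({x\<in>{0<..<1}. \<not> (F has_vector_derivative f x) (at x)} \<union>
    {x\<in>{0<..<1}. \<not> (G has_vector_derivative g x) (at x)})"
    using F G unfolding ac_deriv_def by (blast intro: negligible_Un)
  then show "negligible {x\<in>{0<..<1}. \<not> (H has_vector_derivative h x) (at x)}"
    by (rule negligible_subset) (use h in blast)
qed

lemma ac_deriv_integral:
  fixes g :: "real \<Rightarrow> 'a::euclidean_space"
  assumes "g absolutely_integrable_on {0..1}"
  shows "ac_deriv (\<lambda>x. integral {0..x} g) g"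
  using assms absolutely_continuous01_integral Lebesgue_differentiation_01
    set_lebesgue_integral_eq_integral(1) unfolding ac_deriv_def by blast

lemma ac_deriv_ident: "ac_deriv (\<lambda>x. x) (\<lambda>x::real. 1)"
  unfolding ac_deriv_def
proof
  show "absolutely_continuous01 (\<lambda>x::real. x)"
    unfolding absolutely_continuous01_def
  proof (intro allI impI)
    fix e :: real assume "e > 0"
    have "(\<Sum>K\<in>D. norm (Sup K - Inf K)) = (\<Sum>K\<in>D. Sup K - Inf K)" if "D division_of T" for D and T :: "real set"
      using division_of_interval_endpoints(1)[OF that] by (intro sum.cong) auto
    then show "\<exists>d>0. \<forall>D T. D division_of T \<and> T \<subseteq> {0..1} \<and> (\<Sum>K\<in>D. Sup K - Inf K) < d \<longrightarrow>
       (\<Sum>K\<in>D. norm (Sup K - Inf (K :: real set))) < e"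
      using \<open>e > 0\<close> by (intro exI[of _ e]) auto
  qed
qed auto

lemma ac_deriv_bounded_linear:
  assumes "bounded_linear L" "ac_deriv F f"
  shows "ac_deriv (\<lambda>x. L (F x)) (\<lambda>x. L (f x))"
proof -
  interpret bounded_linear L by fact
  obtain K where K: "\<And>x. norm (L x) \<le> norm x * K" using bounded by blast
  show ?thesis
  proof (rule ac_deriv_combine[OF assms(2,2), where C = "\<bar>K\<bar>"])
    fix u v
    have "norm (L (F v) - L (F u)) \<le> norm (F v - F u) * K" using K[of "F v - F u"] by (simp add: diff)
    also have "\<dots> \<le> \<bar>K\<bar> * (norm (F v - F u) + norm (F v - F u))"
      by (subst mult.commute) (intro mult_mono, auto)
    finally show "norm (L (F v) - L (F u)) \<le> \<dots>" .
  qed (use has_vector_derivative in blast)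
qed

lemma ac_deriv_add:
  assumes "ac_deriv F f" "ac_deriv G g"
  shows "ac_deriv (\<lambda>x. F x + G x) (\<lambda>x. f x + g x)"
proof (rule ac_deriv_combine[OF assms, where C = 1])
  fix u v show "norm (F v + G v - (F u + G u)) \<le> 1 * (norm (F v - F u) + norm (G v - G u))"
    using norm_triangle_ineq[of "F v - F u" "G v - G u"] by (simp add: algebra_simps)
qed (rule has_vector_derivative_add)

lemma ac_deriv_minus: "ac_deriv F f \<Longrightarrow> ac_deriv (\<lambda>x. - F x) (\<lambda>x. - f x)"
  by (rule ac_deriv_bounded_linear[OF bounded_linear_minus[OF bounded_linear_ident]])

lemma ac_deriv_diff:
  "ac_deriv F f \<Longrightarrow> ac_deriv G g \<Longrightarrow> ac_deriv (\<lambda>x. F x - G x) (\<lambda>x. f x - g x)"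
  using ac_deriv_add[OF _ ac_deriv_minus, of F f G g] by simp

lemma ac_deriv_const: "ac_deriv (\<lambda>_. c) (\<lambda>_. 0)"
  using ac_deriv_combine[OF ac_deriv_ident ac_deriv_ident, of "\<lambda>_. c" 0 "\<lambda>_. 0"] by simp

lemma ac_deriv_sum:
  assumes "\<And>i. i \<in> I \<Longrightarrow> ac_deriv (F i) (f i)"
  shows "ac_deriv (\<lambda>x. \<Sum>i\<in>I. F i x) (\<lambda>x. \<Sum>i\<in>I. f i x)"
  using assms by (induction I rule: infinite_finite_induct) (auto intro: ac_deriv_const ac_deriv_add)

lemma ac_deriv_bounded_image:
  assumes "ac_deriv F f"
  obtains B where "B > 0" "\<And>x. x \<in> {0..1} \<Longrightarrow> norm (F x) \<le> B"
proof -
  have "bounded (F ` {0..1})"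
    using ac_deriv_continuous_on[OF assms] by (intro compact_imp_bounded compact_continuous_image) auto
  then show ?thesis using that unfolding bounded_pos by auto
qed

lemma ac_deriv_bilinear:
  assumes "bounded_bilinear p" "ac_deriv F f" "ac_deriv G g"
  shows "ac_deriv (\<lambda>x. p (F x) (G x)) (\<lambda>x. p (F x) (g x) + p (f x) (G x))"
proof -
  interpret bounded_bilinear p by fact
  obtain K where K: "K > 0" "\<And>a b. norm (p a b) \<le> norm a * norm b * K" using pos_bounded by blast
  obtain A where A: "A > 0" "\<And>x. x \<in> {0..1} \<Longrightarrow> norm (F x) \<le> A" using ac_deriv_bounded_image[OF assms(2)] by metis
  obtain B where B: "B > 0" "\<And>x. x \<in> {0..1} \<Longrightarrow> norm (G x) \<le> B" using ac_deriv_bounded_image[OF assms(3)] by metis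
  show ?thesis
  proof (rule ac_deriv_combine[OF assms(2,3), where C = "(A + B) * K"])
    fix u v :: real assume uv: "u \<in> {0..1}" "v \<in> {0..1}"
    have "p (F v) (G v) - p (F u) (G u) = p (F v - F u) (G v) + p (F u) (G v - G u)"
      by (simp add: diff_left diff_right)
    also have "norm \<dots> \<le> norm (F v - F u) * norm (G v) * K + norm (F u) * norm (G v - G u) * K"
      by (intro norm_triangle_le add_mono K)
    also have "\<dots> \<le> norm (F v - F u) * (A + B) * K + (A + B) * norm (G v - G u) * K"
      using A B K uv by (intro add_mono mult_right_mono mult_left_mono) (auto intro: add_increasing add_increasing2)
    also have "\<dots> = (A + B) * K * (norm (F v - F u) + norm (G v - G u))" by (simp add: algebra_simps)
    finally show "norm (p (F v) (G v) - p (F u) (G u)) \<le> \<dots>" .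
  qed (rule has_vector_derivative)
qed

lemma ac_deriv_exp:
  fixes F :: "real \<Rightarrow> real"
  assumes "ac_deriv F f"
  shows "ac_deriv (\<lambda>x. exp (F x)) (\<lambda>x. exp (F x) * f x)"
proof -
  obtain B where B: "\<And>x. x \<in> {0..1} \<Longrightarrow> \<bar>F x\<bar> \<le> B" 
    using ac_deriv_bounded_image[OF assms] by (metis real_norm_def)
  have le: "exp a - exp b \<le> exp B * (a - b)" if "b \<le> a" "a \<le> B" for a b :: real
  proof -
    have "exp a - exp b = exp a * (1 - exp (b - a))" by (simp add: exp_diff algebra_simps)
    also have "\<dots> \<le> exp a * (a - b)"
    proof -
      have "1 - exp (b - a) \<le> a - b" using exp_ge_add_one_self[of "b - a"] by linarith
      then show ?thesis by (intro mult_left_mono) auto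
    qed
    also have "\<dots> \<le> exp B * (a - b)" using that by (intro mult_right_mono) auto
    finally show ?thesis .
  qed
  show ?thesis
  proof (rule ac_deriv_combine[OF assms assms, where C = "exp B"])
    fix u v :: real assume uv: "u \<in> {0..1}" "v \<in> {0..1}"
    have "\<bar>exp (F v) - exp (F u)\<bar> \<le> exp B * \<bar>F v - F u\<bar>"
    proof -
      have "F u \<le> B" "F v \<le> B" using B[OF uv(1)] B[OF uv(2)] by linarith+
      then show ?thesis using le[of "F u" "F v"] le[of "F v" "F u"] by (cases "F u \<le> F v") (auto simp: abs_if)
    qed
    also have "\<dots> \<le> exp B * (\<bar>F v - F u\<bar> + \<bar>F v - F u\<bar>)" by (intro mult_left_mono) auto
    finally show "norm (exp (F v) - exp (F u)) \<le> exp B * (norm (F v - F u) + norm (F v - F u))" by simp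
  next
    fix x assume "(F has_vector_derivative f x) (at x)"
    then have "(F has_real_derivative f x) (at x)" by (simp add: has_real_derivative_iff_has_vector_derivative)
    then have "((\<lambda>x. exp (F x)) has_real_derivative exp (F x) * f x) (at x)"
      by (auto intro!: derivative_eq_intros)
    then show "((\<lambda>x. exp (F x)) has_vector_derivative exp (F x) * f x) (at x)"
      by (simp add: has_real_derivative_iff_has_vector_derivative)
  qed
qed

lemma ac_deriv_mono:
  fixes F :: "real \<Rightarrow> real"
  assumes F: "ac_deriv F f" and f: "\<And>x. x \<in> {0<..<1} \<Longrightarrow> 0 \<le> f x"
    and st: "0 \<le> s" "s \<le> t" "t \<le> 1"
  shows "F s \<le> F t"
proof -
  have "((\<lambda>x. if x \<in> {0<..<1} then f x else 0) has_integral (F t - F s)) {s..t}"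
    by (rule has_integral_spike[OF _ _ ac_deriv_has_integral[OF F st], where S = "{0,1}"]) (use st in auto)
  then have "0 \<le> F t - F s"
    by (rule has_integral_nonneg) (use f in auto)
  then show ?thesis by simp
qed

text \<open>Gronwall's inequality in differential form: \<open>F e\<^sup>K\<close> is increasing.\<close>

lemma ac_deriv_gronwall:
  fixes F :: "real \<Rightarrow> real"
  assumes F: "ac_deriv F f" and K: "ac_deriv K k"
    and le: "\<And>x. x \<in> {0<..<1} \<Longrightarrow> 0 \<le> f x + k x * F x"
    and st: "0 \<le> s" "s \<le> t" "t \<le> 1"
  shows "F s * exp (K s) \<le> F t * exp (K t)"
proof (rule ac_deriv_mono[OF _ _ st])
  show "ac_deriv (\<lambda>x. F x * exp (K x)) (\<lambda>x. F x * (exp (K x) * k x) + f x * exp (K x))"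
    by (rule ac_deriv_bilinear[OF bounded_bilinear_mult F ac_deriv_exp[OF K]])
  fix x :: real assume "x \<in> {0<..<1}"
  from mult_nonneg_nonneg[OF le[OF this], of "exp (K x)"]
  show "0 \<le> F x * (exp (K x) * k x) + f x * exp (K x)" by (simp add: algebra_simps)
qed

lemma ac_deriv_cong:
  assumes "ac_deriv F f" "\<And>x. x \<in> {0<..<1} \<Longrightarrow> f x = g x"
  shows "ac_deriv F g"
  using assms by (intro ac_deriv_combine[OF assms(1,1), where C = 1]) auto

section \<open>Complex vectors and the Dirac system\<close>

lemma norm_smult_vec: "norm (c *s x) = cmod c * norm (x :: complex^'n)"
  by (simp add: norm_vec_def norm_mult L2_set_right_distrib)

lemma bounded_linear_smult: "bounded_linear ((*s) c :: complex^'n \<Rightarrow> complex^'n)"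
  by (rule bounded_linear_intro[where K = "cmod c"])
    (auto simp: norm_smult_vec vec_eq_iff algebra_simps)

lemma norm_matrix_vector_le: "norm (A *v x) \<le> norm A * norm x"
  for A :: "complex^'n^'m"
proof -
  have "norm ((A *v x) $ i) \<le> norm (A $ i) * norm x" for i
  proof -
    have "norm ((A *v x) $ i) \<le> (\<Sum>j\<in>UNIV. norm (A $ i $ j) * norm (x $ j))"
      unfolding matrix_vector_mult_def by (simp add: norm_mult[symmetric] norm_sum)
    also have "\<dots> \<le> L2_set (\<lambda>j. norm (A $ i $ j)) UNIV * L2_set (\<lambda>j. norm (x $ j)) UNIV"
      using L2_set_mult_ineq[of "\<lambda>j. norm (A $ i $ j)" "\<lambda>j. norm (x $ j)" UNIV] by simp
    finally show ?thesis by (simp add: norm_vec_def)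
  qed
  then have "L2_set (\<lambda>i. norm ((A *v x) $ i)) UNIV \<le> L2_set (\<lambda>i. norm (A $ i) * norm x) UNIV"
    by (intro L2_set_mono) auto
  also have "\<dots> = norm A * norm x"
    by (simp add: L2_set_left_distrib[symmetric] norm_vec_def)
  finally show ?thesis by (simp add: norm_vec_def)
qed

lemma ctranspose_nth: "ctranspose A $ i $ j = cnj (A $ j $ i)"
  by (simp add: ctranspose_def map_matrix_def transpose_def)

lemma norm_ctranspose: "norm (ctranspose A) = norm A"
  for A :: "complex^'n^'m"
proof -
  have sq: "(norm (B::complex^'a^'b))\<^sup>2 = (\<Sum>i\<in>UNIV. \<Sum>j\<in>UNIV. (cmod (B $ i $ j))\<^sup>2)" for B
    by (simp add: norm_vec_def L2_set_def sum_nonneg)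
  have "(norm (ctranspose A))\<^sup>2 = (norm A)\<^sup>2"
    unfolding sq by (subst sum.swap) (simp add: ctranspose_nth)
  then show ?thesis by simp
qed

lemma inner_complex_eq: "inner a b = Re (a * cnj b)"
  by (simp add: inner_complex_def)

lemma inner_ctranspose: "inner (ctranspose A *v a) b = inner a (A *v b)"
  for A :: "complex^'n^'m"
proof -
  have "inner a (A *v b) = (\<Sum>i\<in>UNIV. \<Sum>j\<in>UNIV. Re (a $ i * cnj (A $ i $ j * b $ j)))"
    by (simp add: inner_vec_def inner_complex_eq matrix_vector_mult_def sum_distrib_left Re_sum del: complex_cnj_mult)
  also have "\<dots> = (\<Sum>j\<in>UNIV. \<Sum>i\<in>UNIV. Re (a $ i * cnj (A $ i $ j * b $ j)))"
    by (rule sum.swap)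
  also have "\<dots> = inner (ctranspose A *v a) b"
  proof -
    have "inner (ctranspose A *v a) b = (\<Sum>j\<in>UNIV. Re ((\<Sum>i\<in>UNIV. cnj (A $ i $ j) * a $ i) * cnj (b $ j)))"
      by (simp only: inner_vec_def inner_complex_eq matrix_vector_mult_def ctranspose_nth vec_lambda_beta)
    also have "\<dots> = (\<Sum>j\<in>UNIV. \<Sum>i\<in>UNIV. Re (cnj (A $ i $ j) * a $ i * cnj (b $ j)))"
      by (simp only: sum_distrib_right Re_sum)
    also have "\<dots> = (\<Sum>j\<in>UNIV. \<Sum>i\<in>UNIV. Re (a $ i * cnj (A $ i $ j * b $ j)))"
      by (intro sum.cong refl) (simp only: complex_cnj_mult mult_ac)
    finally show ?thesis by simp
  qed
  finally show ?thesis by simp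
qed

lemma inner_smult: "inner (c *s a) b = inner a (cnj c *s b)"
  for a :: "complex^'n"
  unfolding inner_vec_def inner_complex_eq by (intro sum.cong refl) (simp add: algebra_simps)

lemma inner_self_smult: "inner a (c *s a) = Re c * (norm a)\<^sup>2"
  for a :: "complex^'n"
proof -
  have "inner a (c *s a) = (\<Sum>i\<in>UNIV. Re c * (cmod (a $ i))\<^sup>2)"
    unfolding inner_vec_def
    by (intro sum.cong refl) (simp add: inner_complex_def cmod_power2, simp add: algebra_simps power2_eq_square)
  also have "\<dots> = Re c * (norm a)\<^sup>2"
    by (simp add: norm_vec_def L2_set_def sum_nonneg sum_distrib_left)
  finally show ?thesis .
qed

text \<open>The potential contributes adjoint terms to the two components. They therefore cancel in the flux
\<open>\<bar>y\<^sub>2\<bar>\<^sup>2 - \<bar>y\<^sub>1\<bar>\<^sup>2\<close> and in the Wronskian, whatever \<open>V\<close> is.\<close>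

lemma dirac_coupling_symmetric:
  fixes A :: "complex^'n^'n"
  shows "inner a ((-\<i>) *s (A *v b)) = inner b (\<i> *s (ctranspose A *v a))"
proof -
  have "inner b (\<i> *s (ctranspose A *v a)) = inner (\<i> *s (ctranspose A *v a)) b" by (rule inner_commute)
  also have "\<dots> = inner a (A *v ((-\<i>) *s b))" by (simp only: inner_smult inner_ctranspose complex_cnj_i)
  also have "A *v ((-\<i>) *s b) = (-\<i>) *s (A *v b)" by (simp only: vector_scalar_commute)
  finally show ?thesis by simp
qed

text \<open>The system \<open>J y' + V y = \<zeta> y\<close>, written for the two components of \<open>y\<close> and solved for the derivatives.\<close>

definition dirac_solution where
  "dirac_solution (V :: real \<Rightarrow> complex^'n^'n) \<zeta> y1 y2 \<longleftrightarrow>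
     ac_deriv y1 (\<lambda>x. (\<i> * \<zeta>) *s y1 x + (-\<i>) *s (V x *v y2 x)) \<and>
     ac_deriv y2 (\<lambda>x. (- (\<i> * \<zeta>)) *s y2 x + \<i> *s (ctranspose (V x) *v y1 x))"

lemma dirac_solution_norm1:
  assumes "dirac_solution V \<zeta> y1 y2"
  shows "ac_deriv (\<lambda>x. (norm (y1 x))\<^sup>2)
    (\<lambda>x. - 2 * Im \<zeta> * (norm (y1 x))\<^sup>2 + 2 * inner (y1 x) ((-\<i>) *s (V x *v y2 x)))"
proof -
  let ?f = "\<lambda>x. (\<i> * \<zeta>) *s y1 x + (-\<i>) *s (V x *v y2 x)"
  have "ac_deriv y1 ?f" using assms by (simp add: dirac_solution_def)
  from ac_deriv_bilinear[OF bounded_bilinear_inner this this]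
  have "ac_deriv (\<lambda>x. (norm (y1 x))\<^sup>2) (\<lambda>x. inner (y1 x) (?f x) + inner (?f x) (y1 x))"
    by (simp add: power2_norm_eq_inner)
  then show ?thesis
    by (rule ac_deriv_cong)
      (simp only: inner_commute[of "?f _"], simp add: inner_add_right inner_self_smult algebra_simps)
qed

lemma dirac_solution_norm2:
  assumes "dirac_solution V \<zeta> y1 y2"
  shows "ac_deriv (\<lambda>x. (norm (y2 x))\<^sup>2)
    (\<lambda>x. 2 * Im \<zeta> * (norm (y2 x))\<^sup>2 + 2 * inner (y1 x) ((-\<i>) *s (V x *v y2 x)))"
proof -
  let ?f = "\<lambda>x. (- (\<i> * \<zeta>)) *s y2 x + \<i> *s (ctranspose (V x) *v y1 x)"
  have "ac_deriv y2 ?f" using assms by (simp add: dirac_solution_def)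
  from ac_deriv_bilinear[OF bounded_bilinear_inner this this]
  have "ac_deriv (\<lambda>x. (norm (y2 x))\<^sup>2) (\<lambda>x. inner (y2 x) (?f x) + inner (?f x) (y2 x))"
    by (simp add: power2_norm_eq_inner)
  then show ?thesis
    by (rule ac_deriv_cong)
      (simp only: inner_commute[of "?f _"] dirac_coupling_symmetric, simp add: inner_add_right inner_self_smult algebra_simps)
qed

lemma dirac_coupling_bound:
  fixes A :: "complex^'n^'n"
  shows "\<bar>inner a ((-\<i>) *s (A *v b))\<bar> \<le> norm A * (norm a * norm b)"
proof -
  have "\<bar>inner a ((-\<i>) *s (A *v b))\<bar> \<le> norm a * norm ((-\<i>) *s (A *v b))" by (rule Cauchy_Schwarz_ineq2)
  also have "\<dots> = norm a * norm (A *v b)" by (simp only: norm_smult_vec) simp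
  also have "\<dots> \<le> norm a * (norm A * norm b)" by (intro mult_left_mono norm_matrix_vector_le) auto
  finally show ?thesis by (simp add: algebra_simps)
qed

lemma dirac_wronskian_constant:
  assumes y: "dirac_solution V \<zeta> y1 y2" and z: "dirac_solution V (cnj \<zeta>) z1 z2"
  shows "inner (y1 1) (z1 1) - inner (y2 1) (z2 1) = inner (y1 0) (z1 0) - inner (y2 0) (z2 0)"
proof -
  let ?y1 = "\<lambda>x. (\<i> * \<zeta>) *s y1 x + (-\<i>) *s (V x *v y2 x)"
  let ?y2 = "\<lambda>x. (- (\<i> * \<zeta>)) *s y2 x + \<i> *s (ctranspose (V x) *v y1 x)"
  let ?z1 = "\<lambda>x. (\<i> * cnj \<zeta>) *s z1 x + (-\<i>) *s (V x *v z2 x)"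
  let ?z2 = "\<lambda>x. (- (\<i> * cnj \<zeta>)) *s z2 x + \<i> *s (ctranspose (V x) *v z1 x)"
  have "ac_deriv (\<lambda>x. inner (y1 x) (z1 x) - inner (y2 x) (z2 x))
    (\<lambda>x. (inner (y1 x) (?z1 x) + inner (?y1 x) (z1 x)) - (inner (y2 x) (?z2 x) + inner (?y2 x) (z2 x)))"
    using y z unfolding dirac_solution_def
    by (intro ac_deriv_diff ac_deriv_bilinear[OF bounded_bilinear_inner]) auto
  then have d: "ac_deriv (\<lambda>x. inner (y1 x) (z1 x) - inner (y2 x) (z2 x)) (\<lambda>x. 0)"
  proof (rule ac_deriv_cong)
    fix x
    have 1: "inner (?y1 x) (z1 x) = inner (y1 x) ((- (\<i> * cnj \<zeta>)) *s z1 x) + inner (z1 x) ((-\<i>) *s (V x *v y2 x))"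
      unfolding inner_add_left inner_smult[of _ "y1 x"] inner_commute[of "z1 x" "(-\<i>) *s (V x *v y2 x)"] by simp
    have 2: "inner (?y2 x) (z2 x) = inner (y2 x) ((\<i> * cnj \<zeta>) *s z2 x) + inner (z2 x) (\<i> *s (ctranspose (V x) *v y1 x))"
      unfolding inner_add_left inner_smult[of _ "y2 x"] inner_commute[of "z2 x" "\<i> *s (ctranspose (V x) *v y1 x)"] by simp
    have m: "(- c) *s v = - (c *s v)" for c :: complex and v :: "complex^'n" by (simp add: vec_eq_iff)
    note c = dirac_coupling_symmetric[of "z1 x" "V x" "y2 x"] dirac_coupling_symmetric[of "y1 x" "V x" "z2 x"]
    show "(inner (y1 x) (?z1 x) + inner (?y1 x) (z1 x)) - (inner (y2 x) (?z2 x) + inner (?y2 x) (z2 x)) = 0"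
      unfolding 1 2 unfolding inner_add_right c unfolding m inner_minus_right by simp
  qed
  have "inner (y1 0) (z1 0) - inner (y2 0) (z2 0) \<le> inner (y1 1) (z1 1) - inner (y2 1) (z2 1)"
    by (rule ac_deriv_mono[OF d]) auto
  moreover have "- (inner (y1 0) (z1 0) - inner (y2 0) (z2 0)) \<le> - (inner (y1 1) (z1 1) - inner (y2 1) (z2 1))"
    using ac_deriv_minus[OF d] by (rule ac_deriv_mono) auto
  ultimately show ?thesis by linarith
qed

section \<open>Existence of solutions and their dependence on the spectral parameter\<close>

definition pair_smult :: "complex \<Rightarrow> (complex^'n) \<times> (complex^'n) \<Rightarrow> (complex^'n) \<times> (complex^'n)" where
  "pair_smult c y = (c *s fst y, c *s snd y)"

definition dirac_sigma :: "(complex^'n) \<times> (complex^'n) \<Rightarrow> (complex^'n) \<times> (complex^'n)" where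
  "dirac_sigma y = (\<i> *s fst y, (-\<i>) *s snd y)"

definition dirac_coupling :: "((complex^'n) \<times> (complex^'n)) \<Rightarrow> complex^'n^'n \<Rightarrow> (complex^'n) \<times> (complex^'n)" where
  "dirac_coupling y A = ((-\<i>) *s (A *v snd y), \<i> *s (ctranspose A *v fst y))"

lemma norm_Pair_power2: "(norm y)\<^sup>2 = (norm (fst y))\<^sup>2 + (norm (snd y))\<^sup>2"
  by (simp add: norm_prod_def)

lemma norm_pair_smult: "norm (pair_smult c y) = cmod c * norm y"
proof -
  have "(norm (pair_smult c y))\<^sup>2 = (cmod c * norm y)\<^sup>2"
    unfolding power_mult_distrib norm_Pair_power2
    by (simp add: pair_smult_def norm_smult_vec power_mult_distrib algebra_simps)
  then show ?thesis by (rule power2_eq_imp_eq) auto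
qed

lemma bounded_linear_pair_smult: "bounded_linear (pair_smult c)"
proof (rule bounded_linear_intro[where K = "cmod c"])
  show "norm (pair_smult c y) \<le> norm y * cmod c" for y by (simp add: norm_pair_smult)
qed (simp_all add: pair_smult_def vec_eq_iff prod_eq_iff algebra_simps)

lemma norm_dirac_sigma: "norm (dirac_sigma y) = norm y"
proof -
  have "(norm (dirac_sigma y))\<^sup>2 = (norm y)\<^sup>2"
    unfolding norm_Pair_power2 by (simp add: dirac_sigma_def norm_smult_vec del: vector_sneg_minus1)
  then show ?thesis by (rule power2_eq_imp_eq) auto
qed

lemma bounded_linear_dirac_sigma: "bounded_linear dirac_sigma"
proof (rule bounded_linear_intro[where K = 1])
  show "norm (dirac_sigma y) \<le> norm y * 1" for y by (simp add: norm_dirac_sigma)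
qed (simp_all add: dirac_sigma_def vec_eq_iff prod_eq_iff algebra_simps)

lemma norm_dirac_coupling: "norm (dirac_coupling y A) \<le> norm A * norm y"
proof -
  have "(norm (dirac_coupling y A))\<^sup>2 = (norm (A *v snd y))\<^sup>2 + (norm (ctranspose A *v fst y))\<^sup>2"
    unfolding norm_Pair_power2 by (simp add: dirac_coupling_def norm_smult_vec)
  also have "\<dots> \<le> (norm A * norm (snd y))\<^sup>2 + (norm A * norm (fst y))\<^sup>2"
    using norm_matrix_vector_le[of A "snd y"] norm_matrix_vector_le[of "ctranspose A" "fst y"]
    by (intro add_mono power_mono) (auto simp: norm_ctranspose)
  also have "\<dots> = (norm A * norm y)\<^sup>2"
    unfolding power_mult_distrib norm_Pair_power2[of y] by (simp add: algebra_simps)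
  finally show ?thesis by (rule power2_le_imp_le) auto
qed

lemma bilinear_dirac_coupling: "bilinear dirac_coupling"
  unfolding bilinear_def
proof (intro conjI allI)
  show "linear (\<lambda>y. dirac_coupling x y)" for x :: "(complex^'n) \<times> (complex^'n)"
    by (rule linearI) (auto simp: dirac_coupling_def prod_eq_iff vec_eq_iff matrix_vector_mult_def
        ctranspose_nth algebra_simps sum.distrib sum_distrib_left scaleR_sum_right)
  show "linear (\<lambda>x. dirac_coupling x A)" for A :: "complex^'n^'n"
    by (rule linearI) (auto simp: dirac_coupling_def prod_eq_iff vec_eq_iff matrix_vector_mult_def
        ctranspose_nth algebra_simps sum.distrib sum_distrib_left scaleR_sum_right)
qed

lemma dirac_coupling_pair_smult: "dirac_coupling (pair_smult c y) A = pair_smult c (dirac_coupling y A)"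
  by (simp add: dirac_coupling_def pair_smult_def vector_scalar_commute[symmetric] vec_eq_iff algebra_simps)

lemma pair_smult_pair_smult: "pair_smult c (pair_smult d y) = pair_smult (c * d) y"
  by (simp add: pair_smult_def)

lemma dirac_sigma_pair_smult: "dirac_sigma (pair_smult c y) = pair_smult c (dirac_sigma y)"
  by (simp add: dirac_sigma_def pair_smult_def vec_eq_iff algebra_simps)

lemma dirac_solution_pair:
  assumes "ac_deriv y (\<lambda>x. dirac_coupling (y x) (V x) + pair_smult \<zeta> (dirac_sigma (y x)))"
  shows "dirac_solution V \<zeta> (\<lambda>x. fst (y x)) (\<lambda>x. snd (y x))"
  unfolding dirac_solution_def
proof
  show "ac_deriv (\<lambda>x. fst (y x)) (\<lambda>x. (\<i> * \<zeta>) *s fst (y x) + (-\<i>) *s (V x *v snd (y x)))"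
    by (rule ac_deriv_cong[OF ac_deriv_bounded_linear[OF bounded_linear_fst assms]])
      (simp add: dirac_coupling_def pair_smult_def dirac_sigma_def vec_eq_iff)
  show "ac_deriv (\<lambda>x. snd (y x)) (\<lambda>x. (- (\<i> * \<zeta>)) *s snd (y x) + \<i> *s (ctranspose (V x) *v fst (y x)))"
    by (rule ac_deriv_cong[OF ac_deriv_bounded_linear[OF bounded_linear_snd assms]])
      (simp add: dirac_coupling_def pair_smult_def dirac_sigma_def vec_eq_iff)
qed

lemma absolutely_integrable_dirac_coupling:
  assumes V: "V absolutely_integrable_on {0..1::real}" and y: "continuous_on {0..1} y"
  shows "(\<lambda>x. dirac_coupling (y x) (V x)) absolutely_integrable_on {0..1}"
proof (rule absolutely_integrable_bounded_measurable_product[OF bilinear_dirac_coupling _ _ _ V])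
  show "y \<in> borel_measurable (lebesgue_on {0..1})"
    using y by (intro continuous_imp_measurable_on_sets_lebesgue) auto
  show "bounded (y ` {0..1})" using y by (intro compact_imp_bounded compact_continuous_image) auto
qed auto

text \<open>The \<open>n\<close>-th increment of the Picard iteration is a polynomial of degree \<open>n\<close> in \<open>\<zeta>\<close>. Its coefficients are
generated separately, which makes the holomorphic dependence of the increments on \<open>\<zeta>\<close> evident although
they are integrals against a function that is only integrable.\<close>

fun picard_coeff where
  "picard_coeff V c 0 k = (\<lambda>x::real. if k = (0::nat) then c else 0)"
| "picard_coeff V c (Suc n) k = (\<lambda>x. integral {0..x}
     (\<lambda>s. dirac_coupling (picard_coeff V c n k s) (V s) +
       (if k = 0 then 0 else dirac_sigma (picard_coeff V c n (k - 1) s))))"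

definition picard_term where
  "picard_term V c n \<zeta> x = (\<Sum>k\<le>n. pair_smult (\<zeta> ^ k) (picard_coeff V c n k x))"

lemma picard_coeff_eq_0: "k > n \<Longrightarrow> picard_coeff V c n k x = 0"
proof (induction n arbitrary: k x)
  case (Suc n)
  have 0: "dirac_coupling 0 A = 0" for A :: "complex^'n^'n" using bilinear_lzero[OF bilinear_dirac_coupling] .
  have 1: "dirac_sigma 0 = (0 :: (complex^'n) \<times> (complex^'n))" by (simp add: dirac_sigma_def prod_eq_iff vec_eq_iff)
  have "picard_coeff V c n k s = 0" "picard_coeff V c n (k - 1) s = 0" for s using Suc by auto
  then show ?case unfolding picard_coeff.simps by (simp only: 0 1 if_cancel add_0 integral_0)
qed auto

lemma ac_deriv_power:
  fixes F :: "real \<Rightarrow> real"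
  assumes "ac_deriv F f"
  shows "ac_deriv (\<lambda>x. F x ^ Suc n) (\<lambda>x. real (Suc n) * F x ^ n * f x)"
proof (induction n)
  case (Suc n)
  have "ac_deriv (\<lambda>x. F x ^ Suc (Suc n)) (\<lambda>x. F x * (real (Suc n) * F x ^ n * f x) + f x * F x ^ Suc n)"
    unfolding power_Suc[of _ "Suc n"] by (rule ac_deriv_bilinear[OF bounded_bilinear_mult assms Suc])
  then show ?case by (rule ac_deriv_cong) (simp add: algebra_simps)
qed (use assms in simp)

locale integrable_potential =
  fixes V :: "real \<Rightarrow> complex^'n^'n"
  assumes V: "V absolutely_integrable_on {0..1}"
begin

definition mass :: "real \<Rightarrow> real" where "mass x = integral {0..x} (\<lambda>s. norm (V s))"

lemma ac_deriv_mass: "ac_deriv mass (\<lambda>x. norm (V x))"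
  unfolding mass_def using absolutely_integrable_norm[OF V, unfolded o_def] by (rule ac_deriv_integral)

lemma mass_0: "mass 0 = 0" by (simp add: mass_def)

lemma mass_mono: "0 \<le> s \<Longrightarrow> s \<le> t \<Longrightarrow> t \<le> 1 \<Longrightarrow> mass s \<le> mass t"
  by (rule ac_deriv_mono[OF ac_deriv_mass]) auto

lemma ac_deriv_picard_coeff:
  "ac_deriv (picard_coeff V c n k) (case n of 0 \<Rightarrow> (\<lambda>_. 0) | Suc m \<Rightarrow>
     (\<lambda>s. dirac_coupling (picard_coeff V c m k s) (V s) +
       (if k = 0 then 0 else dirac_sigma (picard_coeff V c m (k - 1) s))))"
proof (induction n arbitrary: k)
  case 0
  then show ?case by (simp add: ac_deriv_const)
next
  case (Suc n)
  have cont: "continuous_on {0..1} (picard_coeff V c n k)" for k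
    using Suc[of k] by (rule ac_deriv_continuous_on)
  have "(\<lambda>s. if k = 0 then 0 else dirac_sigma (picard_coeff V c n (k - 1) s)) absolutely_integrable_on {0..1}"
    by (cases "k = 0") (auto intro!: absolutely_integrable_continuous_real
        bounded_linear.continuous_on[OF bounded_linear_dirac_sigma] cont)
  then have "(\<lambda>s. dirac_coupling (picard_coeff V c n k s) (V s) +
       (if k = 0 then 0 else dirac_sigma (picard_coeff V c n (k - 1) s))) absolutely_integrable_on {0..1}"
    by (intro set_integral_add(1) absolutely_integrable_dirac_coupling V cont)
  from ac_deriv_integral[OF this] show ?case by simp
qed

lemma ac_deriv_picard_term_Suc:
  "ac_deriv (picard_term V c (Suc n) \<zeta>) (\<lambda>s. dirac_coupling (picard_term V c n \<zeta> s) (V s) +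
     pair_smult \<zeta> (dirac_sigma (picard_term V c n \<zeta> s)))"
proof -
  let ?p = "picard_coeff V c n"
  let ?d = "\<lambda>k s. dirac_coupling (?p k s) (V s) + (if k = 0 then 0 else dirac_sigma (?p (k - 1) s))"
  have "ac_deriv (\<lambda>s. \<Sum>k\<le>Suc n. pair_smult (\<zeta> ^ k) (picard_coeff V c (Suc n) k s))
    (\<lambda>s. \<Sum>k\<le>Suc n. pair_smult (\<zeta> ^ k) (?d k s))"
    using ac_deriv_picard_coeff[of c "Suc n"]
    by (intro ac_deriv_sum ac_deriv_bounded_linear[OF bounded_linear_pair_smult]) auto
  then show ?thesis
    unfolding picard_term_def[abs_def]
  proof (rule ac_deriv_cong)
    fix s
    interpret sm: bounded_linear "pair_smult a" for a by (rule bounded_linear_pair_smult)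
    interpret si: bounded_linear dirac_sigma by (rule bounded_linear_dirac_sigma)
    interpret dc: linear "\<lambda>y. dirac_coupling y A" for A
      using bilinear_dirac_coupling unfolding bilinear_def by blast
    have a: "(\<Sum>k\<le>Suc n. pair_smult (\<zeta> ^ k) (dirac_coupling (?p k s) (V s))) =
        dirac_coupling (\<Sum>k\<le>n. pair_smult (\<zeta> ^ k) (?p k s)) (V s)"
      by (simp add: picard_coeff_eq_0 dc.zero sm.zero dc.sum dirac_coupling_pair_smult)
    have b: "(\<Sum>k\<le>Suc n. pair_smult (\<zeta> ^ k) (if k = 0 then 0 else dirac_sigma (?p (k - 1) s))) =
        pair_smult \<zeta> (dirac_sigma (\<Sum>k\<le>n. pair_smult (\<zeta> ^ k) (?p k s)))"
      by (subst sum.atMost_Suc_shift)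
        (simp add: sm.zero si.sum sm.sum dirac_sigma_pair_smult pair_smult_pair_smult)
    show "(\<Sum>k\<le>Suc n. pair_smult (\<zeta> ^ k) (?d k s)) =
      dirac_coupling (\<Sum>k\<le>n. pair_smult (\<zeta> ^ k) (?p k s)) (V s) +
      pair_smult \<zeta> (dirac_sigma (\<Sum>k\<le>n. pair_smult (\<zeta> ^ k) (?p k s)))"
      unfolding a[symmetric] b[symmetric] by (simp only: sm.add sum.distrib)
  qed
qed

lemma picard_term_0: "picard_term V c 0 \<zeta> x = c"
  by (simp add: picard_term_def pair_smult_def)

lemma picard_term_Suc_at_0: "picard_term V c (Suc n) \<zeta> 0 = 0"
proof -
  interpret sm: bounded_linear "pair_smult a" for a by (rule bounded_linear_pair_smult)
  show ?thesis by (simp add: picard_term_def sm.zero)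
qed

lemma norm_dirac_rhs: "norm (dirac_coupling y A + pair_smult \<zeta> (dirac_sigma y)) \<le> (norm A + cmod \<zeta>) * norm y"
proof -
  have "norm (dirac_coupling y A + pair_smult \<zeta> (dirac_sigma y)) \<le> norm A * norm y + cmod \<zeta> * norm y"
    using norm_dirac_coupling[of y A] norm_triangle_ineq[of "dirac_coupling y A" "pair_smult \<zeta> (dirac_sigma y)"]
    by (simp add: norm_pair_smult norm_dirac_sigma)
  then show ?thesis by (simp add: algebra_simps)
qed

lemma ac_deriv_growth: "ac_deriv (\<lambda>x. mass x + r * x) (\<lambda>x. norm (V x) + r)"
proof (rule ac_deriv_cong)
  show "ac_deriv (\<lambda>x. mass x + r * x) (\<lambda>x. norm (V x) + r * 1)"
    by (intro ac_deriv_add ac_deriv_mass ac_deriv_bounded_linear[OF bounded_linear_mult_right] ac_deriv_ident)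
qed simp

text \<open>The factorial comes from integrating powers of \<open>\<integral>\<^sub>0\<^sup>x \<bar>V\<bar> + \<bar>\<zeta>\<bar> x\<close>, whose derivative is the rate in the
Picard step.\<close>

lemma picard_term_bound:
  assumes "x \<in> {0..1}"
  shows "norm (picard_term V c n \<zeta> x) \<le> norm c * ((mass x + cmod \<zeta> * x) ^ n / fact n)"
  using assms
proof (induction n arbitrary: x)
  case 0
  then show ?case by (simp add: picard_term_0)
next
  case (Suc n)
  let ?b = "\<lambda>x. mass x + cmod \<zeta> * x"
  let ?g = "\<lambda>s. dirac_coupling (picard_term V c n \<zeta> s) (V s) + pair_smult \<zeta> (dirac_sigma (picard_term V c n \<zeta> s))"
  let ?h = "\<lambda>s. (norm c / fact (Suc n)) *\<^sub>R (real (Suc n) * ?b s ^ n * (norm (V s) + cmod \<zeta>))"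
  have g: "(?g has_integral picard_term V c (Suc n) \<zeta> x) {0..x}"
    using ac_deriv_has_integral[OF ac_deriv_picard_term_Suc[of c n \<zeta>], of 0 x] Suc.prems
    by (simp add: picard_term_Suc_at_0)
  have h: "(?h has_integral (norm c / fact (Suc n)) *\<^sub>R (?b x ^ Suc n)) {0..x}"
  proof -
    have "((\<lambda>s. real (Suc n) * ?b s ^ n * (norm (V s) + cmod \<zeta>)) has_integral ?b x ^ Suc n - ?b 0 ^ Suc n) {0..x}"
      using Suc.prems by (intro ac_deriv_has_integral[OF ac_deriv_power[OF ac_deriv_growth]]) auto
    then have "((\<lambda>s. real (Suc n) * ?b s ^ n * (norm (V s) + cmod \<zeta>)) has_integral ?b x ^ Suc n) {0..x}"
      by (simp add: mass_0)
    then show ?thesis by (rule has_integral_cmul)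
  qed
  have "norm (?g s) \<le> ?h s" if s: "s \<in> {0..x}" for s
  proof -
    have "norm (?g s) \<le> (norm (V s) + cmod \<zeta>) * norm (picard_term V c n \<zeta> s)" by (rule norm_dirac_rhs)
    also have "\<dots> \<le> (norm (V s) + cmod \<zeta>) * (norm c * (?b s ^ n / fact n))"
      using s Suc.prems by (intro mult_left_mono Suc.IH) auto
    also have "\<dots> = ?h s"
    proof -
      have "norm c / fact (Suc n) * real (Suc n) = norm c / fact n"
        by (simp add: divide_simps del: of_nat_Suc)
      then have "?h s = norm c / fact n * (?b s ^ n * (norm (V s) + cmod \<zeta>))"
        by (simp only: real_scaleR_def mult.assoc[symmetric])
      then show ?thesis by (simp add: mult_ac)
    qed
    finally show ?thesis .
  qed
  then have "norm (integral {0..x} ?g) \<le> integral {0..x} ?h"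
    using g h by (intro Henstock_Kurzweil_Integration.integral_norm_bound_integral) auto
  then show ?case unfolding integral_unique[OF g] integral_unique[OF h] by simp
qed

definition solution where
  "solution c \<zeta> x = (\<Sum>n. picard_term V c n \<zeta> x)"

lemma picard_term_bound_uniform:
  assumes "x \<in> {0..1}" "cmod \<zeta> \<le> R"
  shows "norm (picard_term V c n \<zeta> x) \<le> norm c * ((mass 1 + R) ^ n / fact n)"
proof -
  have "norm (picard_term V c n \<zeta> x) \<le> norm c * ((mass x + cmod \<zeta> * x) ^ n / fact n)"
    by (rule picard_term_bound[OF assms(1)])
  also have "\<dots> \<le> norm c * ((mass 1 + R) ^ n / fact n)"
  proof -
    have "0 \<le> mass x" using mass_mono[of 0 x] mass_0 assms by auto
    moreover have "mass x \<le> mass 1" using mass_mono[of x 1] assms by auto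
    moreover have "cmod \<zeta> * x \<le> R * 1" using assms by (intro mult_mono) (auto intro: order_trans[OF norm_ge_zero])
    ultimately show ?thesis using assms by (intro mult_left_mono divide_right_mono power_mono add_mono) auto
  qed
  finally show ?thesis .
qed

lemma summable_picard_bound: "summable (\<lambda>n. norm c * ((mass 1 + R) ^ n / fact n))"
  using summable_exp[of "mass 1 + R"] by (intro summable_mult) (simp add: field_simps)

lemma picard_sums:
  assumes "x \<in> {0..1}"
  shows "(\<lambda>n. picard_term V c n \<zeta> x) sums solution c \<zeta> x"
  unfolding solution_def
  by (intro summable_sums summable_comparison_test'[OF summable_picard_bound[of c "cmod \<zeta>"]])
    (use picard_term_bound_uniform[OF assms order_refl] in auto)

text \<open>Dominated convergence carries the integral equation over to the sum of the Picard increments, and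
Lebesgue's differentiation theorem turns it back into the differential equation. The sum itself is only
controlled on the unit interval, hence the separate function \<open>y\<close>.\<close>

theorem dirac_solution_exists:
  obtains y where "dirac_solution V \<zeta> (\<lambda>x. fst (y x)) (\<lambda>x. snd (y x))" "y 0 = c" "y 1 = solution c \<zeta> 1"
proof -
  let ?rhs = "\<lambda>y s. dirac_coupling y (V s) + pair_smult \<zeta> (dirac_sigma y)"
  define S where "S = (\<lambda>N s. \<Sum>n<N. picard_term V c n \<zeta> s)"
  define B where "B = norm c * exp (mass 1 + cmod \<zeta>)"
  interpret sm: bounded_linear "pair_smult a" for a by (rule bounded_linear_pair_smult)
  interpret si: bounded_linear dirac_sigma by (rule bounded_linear_dirac_sigma)
  have bb: "bounded_bilinear dirac_coupling"
    using bilinear_dirac_coupling by (simp add: bilinear_conv_bounded_bilinear)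
  interpret dc: bounded_bilinear dirac_coupling by (rule bb)
  have rhs_lin: "bounded_linear (\<lambda>y. ?rhs y s)" for s
    by (intro bounded_linear_add dc.bounded_linear_left
        bounded_linear_compose[OF bounded_linear_pair_smult bounded_linear_dirac_sigma])
  have rhs_sum: "?rhs (S N s) s = (\<Sum>n<N. ?rhs (picard_term V c n \<zeta> s) s)" for N s
    unfolding S_def using linear_sum[OF bounded_linear.linear[OF rhs_lin]] by simp
  have int: "((\<lambda>s. ?rhs (S N s) s) has_integral (S (Suc N) x - c)) {0..x}" if "x \<in> {0..1}" for N x
  proof -
    have "((\<lambda>s. \<Sum>n<N. ?rhs (picard_term V c n \<zeta> s) s) has_integral (\<Sum>n<N. picard_term V c (Suc n) \<zeta> x)) {0..x}"
    proof (intro has_integral_sum)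
      show "((\<lambda>s. ?rhs (picard_term V c n \<zeta> s) s) has_integral picard_term V c (Suc n) \<zeta> x) {0..x}" for n
        using ac_deriv_has_integral[OF ac_deriv_picard_term_Suc[of c n \<zeta>], of 0 x] that
        by (simp add: picard_term_Suc_at_0)
    qed auto
    moreover have "(\<Sum>n<N. picard_term V c (Suc n) \<zeta> x) = S (Suc N) x - c"
      unfolding S_def by (subst sum.lessThan_Suc_shift) (simp add: picard_term_0)
    ultimately show ?thesis unfolding rhs_sum by simp
  qed
  have SB: "norm (S N x) \<le> B" if "x \<in> {0..1}" for N x
  proof -
    have "norm (S N x) \<le> (\<Sum>n<N. norm c * ((mass 1 + cmod \<zeta>) ^ n / fact n))"
      unfolding S_def by (intro sum_norm_le picard_term_bound_uniform that) auto
    also have "\<dots> \<le> (\<Sum>n. norm c * ((mass 1 + cmod \<zeta>) ^ n / fact n))"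
      using mass_mono[of 0 1] mass_0 by (intro sum_le_suminf summable_picard_bound) auto
    also have "\<dots> = B"
      unfolding B_def exp_def by (subst suminf_mult[symmetric])
        (use summable_exp[of "mass 1 + cmod \<zeta>"] in \<open>auto simp: field_simps\<close>)
    finally show ?thesis .
  qed
  have lim: "(\<lambda>N. S N x) \<longlonglongrightarrow> solution c \<zeta> x" if "x \<in> {0..1}" for x
    using picard_sums[OF that] unfolding S_def sums_def .
  define G where "G = (\<lambda>s. ?rhs (solution c \<zeta> s) s)"
  define h where "h = (\<lambda>s. (norm (V s) + cmod \<zeta>) * B)"
  have hint: "h integrable_on {0..1}"
    using ac_deriv_has_integral[OF ac_deriv_growth[of "cmod \<zeta>"], of 0 1]
    unfolding h_def by (intro integrable_on_mult_left) auto
  have conv: "(\<lambda>N. ?rhs (S N s) s) \<longlonglongrightarrow> G s" if "s \<in> {0..1}" for s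
    unfolding G_def by (rule bounded_linear.tendsto[OF rhs_lin lim[OF that]])
  have nb: "norm (?rhs (S N s) s) \<le> h s" if "s \<in> {0..1}" for N s
    unfolding h_def using norm_dirac_rhs[of "S N s" "V s" \<zeta>] SB[OF that, of N]
    by (meson add_nonneg_nonneg mult_left_mono norm_ge_zero order_trans)
  have Gint: "G integrable_on {0..1}" 
    by (rule dominated_convergence(1)[where f = "\<lambda>N s. ?rhs (S N s) s" and h = h])
      (use int[of 1] hint nb conv in auto)
  have Gabs: "G absolutely_integrable_on {0..1}"
  proof (rule absolutely_integrable_integrable_bound[OF _ Gint hint])
    show "norm (G s) \<le> h s" if "s \<in> {0..1}" for s
      using LIMSEQ_le_const2[OF tendsto_norm[OF conv[OF that]]] nb[OF that] by blast
  qed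
  have eq: "solution c \<zeta> x = c + integral {0..x} G" if x: "x \<in> {0..1}" for x
  proof -
    have sub: "{0..x} \<subseteq> {0..1}" using x by auto
    have "(\<lambda>N. integral {0..x} (\<lambda>s. ?rhs (S N s) s)) \<longlonglongrightarrow> integral {0..x} G"
      by (rule dominated_convergence(2)[where h = h])
        (use int[OF x] integrable_on_subinterval[OF hint sub] nb conv x in auto)
    moreover have "integral {0..x} (\<lambda>s. ?rhs (S N s) s) = S (Suc N) x - c" for N
      using int[OF x] by (rule integral_unique)
    ultimately have "(\<lambda>N. S (Suc N) x - c) \<longlonglongrightarrow> integral {0..x} G" by simp
    moreover have "(\<lambda>N. S (Suc N) x - c) \<longlonglongrightarrow> solution c \<zeta> x - c"
      by (rule tendsto_diff[OF LIMSEQ_Suc[OF lim[OF x]] tendsto_const])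
    ultimately have "integral {0..x} G = solution c \<zeta> x - c" by (rule LIMSEQ_unique)
    then show ?thesis by simp
  qed
  define y where "y = (\<lambda>x. c + integral {0..x} G)"
  have "ac_deriv y (\<lambda>x. 0 + G x)"
    unfolding y_def by (intro ac_deriv_add ac_deriv_const ac_deriv_integral Gabs)
  then have "ac_deriv y (\<lambda>x. ?rhs (y x) x)"
    by (rule ac_deriv_cong) (simp add: G_def y_def eq)
  then have "dirac_solution V \<zeta> (\<lambda>x. fst (y x)) (\<lambda>x. snd (y x))" by (rule dirac_solution_pair)
  moreover have "y 0 = c" by (simp add: y_def)
  moreover have "y 1 = solution c \<zeta> 1" by (simp add: y_def eq)
  ultimately show ?thesis by (rule that)
qed

text \<open>The components of the solution and its boundary forms are instances of the functional \<open>L\<close>.\<close>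

lemma holomorphic_solution:
  assumes "bounded_linear L"
    and L: "\<And>c y. L (pair_smult c y) = c * (L y :: complex)"
  shows "(\<lambda>\<zeta>. L (solution c \<zeta> 1)) holomorphic_on UNIV"
proof (rule holomorphic_uniform_sequence)
  interpret bounded_linear L by fact
  obtain K where K: "K > 0" "\<And>x. norm (L x) \<le> norm x * K" using pos_bounded by blast
  show "(\<lambda>\<zeta>. \<Sum>n<N. L (picard_term V c n \<zeta> 1)) holomorphic_on UNIV" for N
    unfolding picard_term_def sum L by (intro holomorphic_intros)
  fix z :: complex
  have "uniform_limit (cball z 1) (\<lambda>N \<zeta>. \<Sum>n<N. L (picard_term V c n \<zeta> 1))
     (\<lambda>\<zeta>. \<Sum>n. L (picard_term V c n \<zeta> 1)) sequentially"
  proof (rule Weierstrass_m_test)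
    show "summable (\<lambda>n. norm c * ((mass 1 + (cmod z + 1)) ^ n / fact n) * K)"
      by (intro summable_mult2 summable_picard_bound)
    fix n \<zeta> assume "\<zeta> \<in> cball z 1"
    then have "cmod \<zeta> \<le> cmod z + 1"
      using norm_triangle_ineq2[of \<zeta> z] by (simp add: dist_norm norm_minus_commute)
    then have "norm (picard_term V c n \<zeta> 1) \<le> norm c * ((mass 1 + (cmod z + 1)) ^ n / fact n)"
      by (intro picard_term_bound_uniform) auto
    then show "norm (L (picard_term V c n \<zeta> 1)) \<le> norm c * ((mass 1 + (cmod z + 1)) ^ n / fact n) * K"
      using K by (meson less_imp_le mult_right_mono order_trans)
  qed
  moreover have "(\<Sum>n. L (picard_term V c n \<zeta> 1)) = L (solution c \<zeta> 1)" for \<zeta>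
    using sums_unique[OF sums[OF picard_sums[of 1 c \<zeta>]]] by simp
  ultimately show "\<exists>d>0. cball z d \<subseteq> UNIV \<and> uniform_limit (cball z d)
      (\<lambda>N \<zeta>. \<Sum>n<N. L (picard_term V c n \<zeta> 1)) (\<lambda>\<zeta>. L (solution c \<zeta> 1)) sequentially"
    by (intro exI[of _ 1]) auto
qed auto

end

section \<open>Energy and flux of a solution\<close>

lemma dirac_solution_lincomb:
  assumes y: "dirac_solution V \<zeta> y1 y2" and z: "dirac_solution V \<zeta> z1 z2"
  shows "dirac_solution V \<zeta> (\<lambda>x. a *s y1 x + b *s z1 x) (\<lambda>x. a *s y2 x + b *s z2 x)"
  unfolding dirac_solution_def
proof
  have m: "A *v (a *s u + b *s v) = a *s (A *v u) + b *s (A *v v)" for A :: "complex^'n^'n" and u v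
    by (simp add: matrix_vector_right_distrib vector_scalar_commute)
  show "ac_deriv (\<lambda>x. a *s y1 x + b *s z1 x)
     (\<lambda>x. (\<i> * \<zeta>) *s (a *s y1 x + b *s z1 x) + (-\<i>) *s (V x *v (a *s y2 x + b *s z2 x)))"
    using ac_deriv_add[OF ac_deriv_bounded_linear[OF bounded_linear_smult[of a] conjunct1[OF y[unfolded dirac_solution_def]]]
      ac_deriv_bounded_linear[OF bounded_linear_smult[of b] conjunct1[OF z[unfolded dirac_solution_def]]]]
    by (rule ac_deriv_cong) (simp only: m, simp add: vec_eq_iff algebra_simps)
  show "ac_deriv (\<lambda>x. a *s y2 x + b *s z2 x)
     (\<lambda>x. (- (\<i> * \<zeta>)) *s (a *s y2 x + b *s z2 x) + \<i> *s (ctranspose (V x) *v (a *s y1 x + b *s z1 x)))"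
    using ac_deriv_add[OF ac_deriv_bounded_linear[OF bounded_linear_smult[of a] conjunct2[OF y[unfolded dirac_solution_def]]]
      ac_deriv_bounded_linear[OF bounded_linear_smult[of b] conjunct2[OF z[unfolded dirac_solution_def]]]]
    by (rule ac_deriv_cong) (simp only: m, simp add: vec_eq_iff algebra_simps)
qed

lemma mult_exp_minus_le_iff: "a * exp (- k) \<le> b \<longleftrightarrow> a \<le> b * exp (k::real)"
  by (simp add: exp_minus field_simps)

context integrable_potential
begin

context
  fixes \<zeta> y1 y2
  assumes y: "dirac_solution V \<zeta> y1 y2"
begin

abbreviation (input) "energy x \<equiv> (norm (y1 x))\<^sup>2 + (norm (y2 x))\<^sup>2"

abbreviation (input) "coupling x \<equiv> inner (y1 x) ((-\<i>) *s (V x *v y2 x))"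

text \<open>In the derivative of the energy the two coupling terms add up; in that of the flux they cancel.\<close>

lemma ac_deriv_energy:
  "ac_deriv (\<lambda>x. energy x) (\<lambda>x. 2 * Im \<zeta> * ((norm (y2 x))\<^sup>2 - (norm (y1 x))\<^sup>2) + 4 * coupling x)"
  by (rule ac_deriv_cong[OF ac_deriv_add[OF dirac_solution_norm1[OF y] dirac_solution_norm2[OF y]]])
    (simp add: algebra_simps)

lemma ac_deriv_flux:
  "ac_deriv (\<lambda>x. (norm (y2 x))\<^sup>2 - (norm (y1 x))\<^sup>2) (\<lambda>x. 2 * Im \<zeta> * energy x)"
  by (rule ac_deriv_cong[OF ac_deriv_diff[OF dirac_solution_norm2[OF y] dirac_solution_norm1[OF y]]])
    (simp add: algebra_simps)

lemma energy_deriv_bound: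
  "\<bar>2 * Im \<zeta> * ((norm (y2 x))\<^sup>2 - (norm (y1 x))\<^sup>2) + 4 * coupling x\<bar> \<le> 2 * (norm (V x) + \<bar>Im \<zeta>\<bar>) * energy x"
proof -
  have "\<bar>2 * Im \<zeta> * ((norm (y2 x))\<^sup>2 - (norm (y1 x))\<^sup>2)\<bar> \<le> 2 * \<bar>Im \<zeta>\<bar> * energy x"
    unfolding abs_mult by (intro mult_mono) (auto simp: abs_le_iff)
  moreover have "\<bar>4 * coupling x\<bar> \<le> 2 * norm (V x) * energy x"
  proof -
    have "4 * \<bar>coupling x\<bar> \<le> 4 * (norm (V x) * (norm (y1 x) * norm (y2 x)))"
      by (intro mult_left_mono dirac_coupling_bound) auto
    also have "\<dots> = 2 * norm (V x) * (2 * norm (y1 x) * norm (y2 x))" by simp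
    also have "\<dots> \<le> 2 * norm (V x) * energy x"
      using sum_squares_bound[of "norm (y1 x)" "norm (y2 x)"] by (intro mult_left_mono) auto
    finally show ?thesis by simp
  qed
  ultimately show ?thesis by (simp add: algebra_simps)
qed

lemma ac_deriv_double_growth: "ac_deriv (\<lambda>x. 2 * (mass x + r * x)) (\<lambda>x. 2 * (norm (V x) + r))"
  by (rule ac_deriv_bounded_linear[OF bounded_linear_mult_right ac_deriv_growth])

lemma energy_lower:
  assumes "0 \<le> s" "s \<le> t" "t \<le> 1"
  shows "energy s * exp (2 * (mass s + \<bar>Im \<zeta>\<bar> * s)) \<le> energy t * exp (2 * (mass t + \<bar>Im \<zeta>\<bar> * t))"
proof (rule ac_deriv_gronwall[OF ac_deriv_energy ac_deriv_double_growth _ assms])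
  show "0 \<le> (2 * Im \<zeta> * ((norm (y2 x))\<^sup>2 - (norm (y1 x))\<^sup>2) + 4 * coupling x) +
      2 * (norm (V x) + \<bar>Im \<zeta>\<bar>) * energy x" for x
    using energy_deriv_bound[of x] by linarith
qed

lemma energy_upper:
  assumes "0 \<le> s" "s \<le> t" "t \<le> 1"
  shows "energy t * exp (- (2 * (mass t + \<bar>Im \<zeta>\<bar> * t))) \<le> energy s * exp (- (2 * (mass s + \<bar>Im \<zeta>\<bar> * s)))"
proof -
  have "- (energy s) * exp (- (2 * (mass s + \<bar>Im \<zeta>\<bar> * s))) \<le> - (energy t) * exp (- (2 * (mass t + \<bar>Im \<zeta>\<bar> * t)))"
  proof (rule ac_deriv_gronwall[OF ac_deriv_minus[OF ac_deriv_energy] ac_deriv_minus[OF ac_deriv_double_growth] _ assms])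
    show "0 \<le> - (2 * Im \<zeta> * ((norm (y2 x))\<^sup>2 - (norm (y1 x))\<^sup>2) + 4 * coupling x) +
        - (2 * (norm (V x) + \<bar>Im \<zeta>\<bar>)) * - energy x" for x
      using energy_deriv_bound[of x] by (simp only: minus_mult_minus)
  qed
  then show ?thesis by (simp only: mult_minus_left neg_le_iff_le)
qed

lemma energy_le_initial:
  assumes "x \<in> {0..1}"
  shows "energy x \<le> exp (2 * (mass 1 + \<bar>Im \<zeta>\<bar>)) * energy 0"
proof -
  have "energy x \<le> energy 0 * exp (2 * (mass x + \<bar>Im \<zeta>\<bar> * x))"
    using energy_upper[of 0 x] assms unfolding mult_exp_minus_le_iff[of _ "2 * (mass x + \<bar>Im \<zeta>\<bar> * x)"] by (simp add: mass_0)
  also have "\<dots> \<le> energy 0 * exp (2 * (mass 1 + \<bar>Im \<zeta>\<bar> * 1))"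
    using assms mass_mono[of x 1] by (intro mult_left_mono) (auto intro!: add_mono mult_left_le)
  finally show ?thesis by (simp add: mult.commute)
qed

lemma energy_ge_initial:
  assumes "x \<in> {0..1}"
  shows "energy 0 * exp (- (2 * (mass 1 + \<bar>Im \<zeta>\<bar> * x))) \<le> energy x"
proof -
  have "energy 0 * exp (- (2 * (mass 1 + \<bar>Im \<zeta>\<bar> * x))) \<le> energy 0 * exp (- (2 * (mass x + \<bar>Im \<zeta>\<bar> * x)))"
    using assms mass_mono[of x 1] by (intro mult_left_mono) auto
  also have "\<dots> \<le> energy x"
    using energy_lower[of 0 x] assms unfolding mult_exp_minus_le_iff by (simp add: mass_0)
  finally show ?thesis .
qed

text \<open>The flux gains \<open>2 \<bar>Im \<zeta>\<bar>\<close> times the energy, and the energy at \<open>x\<close> is at least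
\<open>e\<^bsup>-2(mass 1 + \<bar>Im \<zeta>\<bar> x)\<^esup>\<close> times its initial value. Integrating this lower bound gives the factor
\<open>1 - e\<^bsup>-2\<bar>Im \<zeta>\<bar>\<^esup>\<close>.\<close>

lemma flux_growth:
  "exp (- 2 * mass 1) * (1 - exp (- 2 * \<bar>Im \<zeta>\<bar>)) * energy 0 \<le>
    sgn (Im \<zeta>) * (((norm (y2 1))\<^sup>2 - (norm (y1 1))\<^sup>2) - ((norm (y2 0))\<^sup>2 - (norm (y1 0))\<^sup>2))"
proof -
  let ?c = "energy 0 * exp (- 2 * mass 1)"
  let ?r = "\<bar>Im \<zeta>\<bar>"
  have "ac_deriv (\<lambda>x. exp ((- 2 * ?r) * x)) (\<lambda>x. exp ((- 2 * ?r) * x) * ((- 2 * ?r) * 1))"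
    by (rule ac_deriv_exp[OF ac_deriv_bounded_linear[OF bounded_linear_mult_right ac_deriv_ident]])
  from ac_deriv_add[OF ac_deriv_bounded_linear[OF bounded_linear_mult_right[of "sgn (Im \<zeta>)"] ac_deriv_flux]
      ac_deriv_bounded_linear[OF bounded_linear_mult_right[of ?c] this]]
  have "sgn (Im \<zeta>) * ((norm (y2 0))\<^sup>2 - (norm (y1 0))\<^sup>2) + ?c * exp ((- 2 * ?r) * 0) \<le>
     sgn (Im \<zeta>) * ((norm (y2 1))\<^sup>2 - (norm (y1 1))\<^sup>2) + ?c * exp ((- 2 * ?r) * 1)"
  proof (rule ac_deriv_mono)
    fix x :: real assume x: "x \<in> {0<..<1}"
    have "?c * exp ((- 2 * ?r) * x) \<le> energy x"
      using energy_ge_initial[of x] x by (simp add: exp_add[symmetric] algebra_simps)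
    from mult_left_mono[OF this, of "2 * ?r"]
    have "2 * ?r * (?c * exp ((- 2 * ?r) * x)) \<le> 2 * ?r * energy x" by simp
    moreover have "sgn (Im \<zeta>) * (2 * Im \<zeta> * energy x) = 2 * ?r * energy x"
      by (simp add: sgn_if)
    ultimately
    show "0 \<le> sgn (Im \<zeta>) * (2 * Im \<zeta> * energy x) + ?c * (exp ((- 2 * ?r) * x) * ((- 2 * ?r) * 1))"
      by (simp add: algebra_simps)
  qed auto
  then show ?thesis by (simp add: algebra_simps)
qed

text \<open>The flux is nondecreasing, so \<open>y\<^sub>2\<close> keeps dominating \<open>y\<^sub>1\<close>. Then the coupling term in the derivative of
\<open>\<bar>y\<^sub>2\<bar>\<^sup>2\<close> is bounded by \<open>\<bar>V\<bar> \<bar>y\<^sub>2\<bar>\<^sup>2\<close> and costs no more than the factor \<open>e\<^bsup>-mass 1\<^esup>\<close>.\<close>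

lemma lower_component_growth:
  assumes "Im \<zeta> \<ge> 0" "norm (y1 0) \<le> norm (y2 0)"
  shows "norm (y2 0) * exp (Im \<zeta> - mass 1) \<le> norm (y2 1)"
proof -
  have le: "norm (y1 x) \<le> norm (y2 x)" if "x \<in> {0..1}" for x
  proof -
    have "(norm (y2 0))\<^sup>2 - (norm (y1 0))\<^sup>2 \<le> (norm (y2 x))\<^sup>2 - (norm (y1 x))\<^sup>2"
      using ac_deriv_mono[OF ac_deriv_flux, of 0 x] that assms by auto
    moreover have "(norm (y1 0))\<^sup>2 \<le> (norm (y2 0))\<^sup>2" using assms by (intro power_mono) auto
    ultimately have "(norm (y1 x))\<^sup>2 \<le> (norm (y2 x))\<^sup>2" by linarith
    then show ?thesis by (rule power2_le_imp_le) auto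
  qed
  have "(norm (y2 0))\<^sup>2 * exp (2 * (mass 0 + (- Im \<zeta>) * 0)) \<le> (norm (y2 1))\<^sup>2 * exp (2 * (mass 1 + (- Im \<zeta>) * 1))"
  proof (rule ac_deriv_gronwall[OF dirac_solution_norm2[OF y] ac_deriv_double_growth])
    fix x :: real assume "x \<in> {0<..<1}"
    then have "\<bar>coupling x\<bar> \<le> norm (V x) * (norm (y2 x))\<^sup>2"
      unfolding power2_eq_square
      by (intro order_trans[OF dirac_coupling_bound] mult_left_mono mult_right_mono le) auto
    then show "0 \<le> (2 * Im \<zeta> * (norm (y2 x))\<^sup>2 + 2 * coupling x) + 2 * (norm (V x) + - Im \<zeta>) * (norm (y2 x))\<^sup>2"
      by (simp add: algebra_simps)
  qed auto
  then have "(norm (y2 0))\<^sup>2 \<le> (norm (y2 1))\<^sup>2 * exp (2 * (mass 1 - Im \<zeta>))" by (simp add: mass_0)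
  from mult_right_mono[OF this, of "exp (2 * (Im \<zeta> - mass 1))"]
  have "(norm (y2 0))\<^sup>2 * exp (2 * (Im \<zeta> - mass 1)) \<le> (norm (y2 1))\<^sup>2"
    by (simp add: mult.assoc exp_add[symmetric] algebra_simps)
  then have "(norm (y2 0) * exp (Im \<zeta> - mass 1))\<^sup>2 \<le> (norm (y2 1))\<^sup>2"
    unfolding power_mult_distrib exp_double[symmetric] .
  then show ?thesis by (rule power2_le_imp_le) auto
qed

text \<open>The same argument run backwards from the right endpoint, with the two components exchanged.\<close>

lemma upper_component_decay:
  assumes "Im \<zeta> \<ge> 0" "norm (y2 1) \<le> norm (y1 1)"
  shows "norm (y1 1) * exp (Im \<zeta> - mass 1) \<le> norm (y1 0)"
proof -
  have le: "norm (y2 x) \<le> norm (y1 x)" if "x \<in> {0..1}" for x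
  proof -
    have "(norm (y2 x))\<^sup>2 - (norm (y1 x))\<^sup>2 \<le> (norm (y2 1))\<^sup>2 - (norm (y1 1))\<^sup>2"
      using ac_deriv_mono[OF ac_deriv_flux, of x 1] that assms by auto
    moreover have "(norm (y2 1))\<^sup>2 \<le> (norm (y1 1))\<^sup>2" using assms by (intro power_mono) auto
    ultimately have "(norm (y2 x))\<^sup>2 \<le> (norm (y1 x))\<^sup>2" by linarith
    then show ?thesis by (rule power2_le_imp_le) auto
  qed
  have "- (norm (y1 0))\<^sup>2 * exp (- (2 * (mass 0 + (- Im \<zeta>) * 0))) \<le> - (norm (y1 1))\<^sup>2 * exp (- (2 * (mass 1 + (- Im \<zeta>) * 1)))"
  proof (rule ac_deriv_gronwall[OF ac_deriv_minus[OF dirac_solution_norm1[OF y]] ac_deriv_minus[OF ac_deriv_double_growth]])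
    fix x :: real assume "x \<in> {0<..<1}"
    then have "\<bar>coupling x\<bar> \<le> norm (V x) * (norm (y1 x))\<^sup>2"
      unfolding power2_eq_square
      by (intro order_trans[OF dirac_coupling_bound] mult_left_mono mult_left_mono le) auto
    then show "0 \<le> - (- 2 * Im \<zeta> * (norm (y1 x))\<^sup>2 + 2 * coupling x) + - (2 * (norm (V x) + - Im \<zeta>)) * - (norm (y1 x))\<^sup>2"
      by (simp add: algebra_simps)
  qed auto
  then have "(norm (y1 1))\<^sup>2 * exp (2 * (Im \<zeta> - mass 1)) \<le> (norm (y1 0))\<^sup>2"
    by (simp add: mass_0 algebra_simps)
  then have "(norm (y1 1) * exp (Im \<zeta> - mass 1))\<^sup>2 \<le> (norm (y1 0))\<^sup>2"
    unfolding power_mult_distrib exp_double[symmetric] .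
  then show ?thesis by (rule power2_le_imp_le) auto
qed

end

lemma dirac_solution_unique:
  assumes y: "dirac_solution V \<zeta> y1 y2" and z: "dirac_solution V \<zeta> z1 z2"
    and 0: "y1 0 = z1 0" "y2 0 = z2 0" and x: "x \<in> {0..1}"
  shows "y1 x = z1 x" "y2 x = z2 x"
proof -
  have d: "dirac_solution V \<zeta> (\<lambda>x. 1 *s y1 x + (-1) *s z1 x) (\<lambda>x. 1 *s y2 x + (-1) *s z2 x)"
    by (rule dirac_solution_lincomb[OF y z])
  have "(norm (1 *s y1 x + (-1) *s z1 x))\<^sup>2 + (norm (1 *s y2 x + (-1) *s z2 x))\<^sup>2 \<le> 0"
    using energy_le_initial[OF d x] 0 by simp
  then have "(norm (y1 x - z1 x))\<^sup>2 + (norm (y2 x - z2 x))\<^sup>2 \<le> 0" by simp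
  then have "(norm (y1 x - z1 x))\<^sup>2 = 0 \<and> (norm (y2 x - z2 x))\<^sup>2 = 0"
    by (metis add_nonneg_eq_0_iff antisym add_nonneg_nonneg zero_le_power2)
  then show "y1 x = z1 x" "y2 x = z2 x" by auto
qed

lemma solution_eq_endpoint:
  assumes "dirac_solution V \<zeta> y1 y2"
  shows "solution (y1 0, y2 0) \<zeta> 1 = (y1 1, y2 1)"
proof -
  obtain z where z: "dirac_solution V \<zeta> (\<lambda>x. fst (z x)) (\<lambda>x. snd (z x))" "z 0 = (y1 0, y2 0)"
    "z 1 = solution (y1 0, y2 0) \<zeta> 1" using dirac_solution_exists by metis
  have "y1 1 = fst (z 1)" "y2 1 = snd (z 1)"
    by (rule dirac_solution_unique[OF assms z(1)]; simp add: z(2))+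
  then show ?thesis using z(3) by simp
qed

lemma solution_lincomb:
  "solution (pair_smult a c + pair_smult b d) \<zeta> 1 = pair_smult a (solution c \<zeta> 1) + pair_smult b (solution d \<zeta> 1)"
proof -
  obtain y where y: "dirac_solution V \<zeta> (\<lambda>x. fst (y x)) (\<lambda>x. snd (y x))" "y 0 = c" "y 1 = solution c \<zeta> 1"
    using dirac_solution_exists by metis
  obtain z where z: "dirac_solution V \<zeta> (\<lambda>x. fst (z x)) (\<lambda>x. snd (z x))" "z 0 = d" "z 1 = solution d \<zeta> 1"
    using dirac_solution_exists by metis
  from solution_eq_endpoint[OF dirac_solution_lincomb[OF y(1) z(1), of a b]]
  show ?thesis by (simp add: y z pair_smult_def)
qed

end

section \<open>Square roots of unitary matrices\<close>

lemma unitary_inner: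
  assumes "U \<in> unitary_matrices"
  shows "inner (U *v x) (U *v y) = inner x y"
proof -
  have "inner (U *v x) (U *v y) = inner (ctranspose U *v (U *v x)) y" by (rule inner_ctranspose[symmetric])
  also have "ctranspose U *v (U *v x) = x"
    using assms by (simp add: matrix_vector_mul_assoc unitary_matrices_def)
  finally show ?thesis .
qed

lemma unitary_norm: "U \<in> unitary_matrices \<Longrightarrow> norm (U *v x) = norm x"
  by (simp add: norm_eq_sqrt_inner unitary_inner)

lemma unitary_mult_ctranspose:
  assumes "U \<in> unitary_matrices"
  shows "ctranspose U *v (U *v x) = x" "U *v (ctranspose U *v x) = x"
  using assms by (simp_all add: matrix_vector_mul_assoc unitary_matrices_def)

lemma mat_1_unitary: "mat 1 \<in> unitary_matrices"
proof -
  have "ctranspose (mat 1) = (mat 1 :: complex^'n^'n)"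
    by (simp add: vec_eq_iff ctranspose_nth mat_def)
  then show ?thesis by (simp add: unitary_matrices_def)
qed

lemma scaleR_eq_smult: "r *\<^sub>R x = complex_of_real r *s (x :: complex^'n)"
  unfolding vec_eq_iff vector_scaleR_component vector_smult_component by (simp add: scaleR_conv_of_real)

text \<open>A maximiser \<open>x\<close> of \<open>Re \<langle>x, U x\<rangle>\<close> on the unit sphere of \<open>S\<close>, with maximum \<open>m\<close>, satisfies
\<open>(U + U\<^sup>*) x = 2 m x\<close>, that is \<open>U\<^sup>2 x - 2 m U x + x = 0\<close>. With \<open>c = m + i \<surd>(1 - m\<^sup>2)\<close> this factors as
\<open>(U - c) (U - c\<^sup>*) x = 0\<close>, so either \<open>x\<close> or \<open>(U - c\<^sup>*) x\<close> is an eigenvector.\<close>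

lemma unitary_eigenvector_in_invariant_subspace:
  fixes U :: "complex^'n^'n" and S :: "(complex^'n) set"
  assumes U: "U \<in> unitary_matrices"
    and S: "subspace S" "\<And>c x. x \<in> S \<Longrightarrow> c *s x \<in> S"
    and inv: "\<And>x. x \<in> S \<Longrightarrow> U *v x \<in> S" "\<And>x. x \<in> S \<Longrightarrow> ctranspose U *v x \<in> S"
    and ne: "S \<noteq> {0}"
  obtains w c where "w \<in> S" "w \<noteq> 0" "U *v w = c *s w"
proof -
  define q where "q = (\<lambda>x. inner x (U *v x))"
  obtain x0 where x0: "x0 \<in> S" "x0 \<noteq> 0" using ne subspace_0[OF S(1)] by blast
  have "compact (S \<inter> sphere 0 1)"
    using closed_subspace[OF S(1)] by (intro closed_Int_compact) auto
  moreover have "(1 / norm x0) *\<^sub>R x0 \<in> S \<inter> sphere 0 1"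
    using x0 subspace_scale[OF S(1)] by auto
  moreover have "continuous_on (S \<inter> sphere 0 1) q"
    unfolding q_def by (intro continuous_intros linear_continuous_on[OF matrix_vector_mul_bounded_linear])
  ultimately obtain x where xm: "x \<in> S \<inter> sphere 0 1" "\<forall>y\<in>S \<inter> sphere 0 1. q y \<le> q x"
    using continuous_attains_sup[of "S \<inter> sphere 0 1" q] by blast
  then have x: "x \<in> S" "norm x = 1" and max: "\<And>y. y \<in> S \<Longrightarrow> norm y = 1 \<Longrightarrow> q y \<le> q x"
    by auto
  define m where "m = q x"
  have quad: "q y \<le> m * (norm y)\<^sup>2" if "y \<in> S" for y
  proof (cases "y = 0")
    case False
    have "q ((1 / norm y) *\<^sub>R y) \<le> m"
      unfolding m_def using False that by (intro max subspace_scale[OF S(1)]) auto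
    moreover have "q ((1 / norm y) *\<^sub>R y) = q y / (norm y)\<^sup>2"
    proof -
      have "U *v (r *\<^sub>R y) = r *\<^sub>R (U *v y)" for r
        by (simp add: scaleR_eq_smult vector_scalar_commute)
      then show ?thesis by (simp add: q_def power2_eq_square)
    qed
    ultimately show ?thesis using False by (simp add: field_simps)
  qed (simp add: q_def)
  define y where "y = U *v x + ctranspose U *v x - (2 * m) *\<^sub>R x"
  have yS: "y \<in> S"
    unfolding y_def using S(1) inv x by (intro subspace_diff subspace_add subspace_scale) auto
  have yy: "inner y (U *v x) + inner x (U *v y) - 2 * m * inner x y = inner y y"
  proof -
    have "inner x (U *v y) = inner y (ctranspose U *v x)"
      by (metis inner_commute inner_ctranspose)
    then show ?thesis
      by (subst (5) y_def) (simp add: inner_diff_right inner_add_right inner_commute[of x y])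
  qed
  have ineq: "t * inner y y + t\<^sup>2 * (q y - m * (norm y)\<^sup>2) \<le> 0" for t :: real
  proof -
    have "x + t *\<^sub>R y \<in> S" using x yS S(1) by (intro subspace_add subspace_scale) auto
    from quad[OF this] have "q (x + t *\<^sub>R y) - m * (norm (x + t *\<^sub>R y))\<^sup>2 \<le> 0" by simp
    moreover have "q (x + t *\<^sub>R y) = m + t * (inner y (U *v x) + inner x (U *v y)) + t\<^sup>2 * q y"
    proof -
      have "U *v (t *\<^sub>R y) = t *\<^sub>R (U *v y)" by (simp add: scaleR_eq_smult vector_scalar_commute)
      then show ?thesis
        by (simp add: q_def m_def matrix_vector_right_distrib inner_add_left inner_add_right power2_eq_square algebra_simps)
    qed
    moreover have "(norm (x + t *\<^sub>R y))\<^sup>2 = 1 + 2 * t * inner x y + t\<^sup>2 * (norm y)\<^sup>2"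
    proof -
      have "inner x x = 1" using x(2) by (simp add: power2_norm_eq_inner[symmetric])
      then show ?thesis
        unfolding power2_norm_eq_inner
        by (simp add: inner_add_left inner_add_right inner_commute[of y x] power2_eq_square algebra_simps)
    qed
    ultimately show ?thesis unfolding yy[symmetric] by (simp add: algebra_simps)
  qed
  have "inner y y = 0"
  proof (rule ccontr)
    assume "inner y y \<noteq> 0"
    then have pos: "inner y y > 0" by simp
    define k where "k = \<bar>q y - m * (norm y)\<^sup>2\<bar> + 1"
    have "k > 0" by (simp add: k_def add_nonneg_pos)
    \<comment> \<open>For a small step in the direction \<open>y\<close> the linear gain beats the quadratic loss.\<close>
    define t where "t = inner y y / (2 * k)"
    have t: "t > 0" using pos \<open>k > 0\<close> by (simp add: t_def)
    have "- k \<le> q y - m * (norm y)\<^sup>2" unfolding k_def by linarith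
    then have "t\<^sup>2 * (- k) \<le> t\<^sup>2 * (q y - m * (norm y)\<^sup>2)" by (rule mult_left_mono) auto
    with ineq[of t] have "t * inner y y - t\<^sup>2 * k \<le> 0" by (simp add: algebra_simps)
    moreover have "t * inner y y - t\<^sup>2 * k = t * (inner y y / 2)"
      using \<open>k > 0\<close> by (simp add: t_def power2_eq_square field_simps)
    ultimately show False using mult_pos_pos[OF t, of "inner y y / 2"] pos by linarith
  qed
  then have crit: "U *v x + ctranspose U *v x = (2 * m) *\<^sub>R x" by (simp add: y_def)
  \<comment> \<open>A root of \<open>X\<^sup>2 - 2 m X + 1\<close>; Cauchy-Schwarz gives \<open>m\<^sup>2 \<le> 1\<close>.\<close>
  define c where "c = Complex m (sqrt (1 - m\<^sup>2))"
  have "\<bar>m\<bar> \<le> norm x * norm (U *v x)" unfolding m_def q_def by (rule Cauchy_Schwarz_ineq2)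
  then have m1: "m\<^sup>2 \<le> 1" using x(2) unitary_norm[OF U] by (simp add: abs_square_le_1)
  have csum: "c + cnj c = of_real (2 * m)" by (simp add: c_def complex_eq_iff)
  have cprod: "c * cnj c = 1"
    using m1 by (simp add: c_def complex_eq_iff power2_eq_square)
  have "U *v (U *v x) + x = (2 * m) *\<^sub>R (U *v x)"
  proof -
    have "U *v (U *v x + ctranspose U *v x) = U *v (U *v x) + x"
      by (simp add: matrix_vector_right_distrib unitary_mult_ctranspose[OF U])
    then show ?thesis unfolding crit by (simp add: scaleR_eq_smult vector_scalar_commute)
  qed
  then have UU: "U *v (U *v x) = (c + cnj c) *s (U *v x) - x"
    unfolding csum by (simp add: scaleR_eq_smult algebra_simps)
  define w where "w = U *v x - cnj c *s x"
  show ?thesis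
  proof (cases "w = 0")
    case True
    show ?thesis by (rule that[of x "cnj c"]) (use x True in \<open>auto simp: w_def\<close>)
  next
    case False
    have "U *v w = c *s w"
    proof -
      have "U *v w = U *v (U *v x) - cnj c *s (U *v x)"
        by (simp add: w_def matrix_vector_mult_diff_distrib vector_scalar_commute)
      also have "\<dots> = c *s (U *v x) - x" unfolding UU by (simp add: vec_eq_iff algebra_simps)
      also have "\<dots> = c *s (U *v x) - (c * cnj c) *s x" by (simp add: cprod)
      also have "\<dots> = c *s w" by (simp add: w_def vec_eq_iff algebra_simps)
      finally show ?thesis .
    qed
    moreover have "w \<in> S" unfolding w_def using S inv x by (intro subspace_diff) auto
    ultimately show ?thesis using False that by blast
  qed
qed

text \<open>The orthogonal complement of all eigenvectors is invariant under \<open>U\<close> and its adjoint, so it would contain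
an eigenvector if it were nonzero. Real and complex spans are compared because orthogonal complements
are taken with respect to the real inner product.\<close>

lemma unitary_eigenvectors_span:
  fixes U :: "complex^'n^'n"
  assumes U: "U \<in> unitary_matrices"
  shows "vec.span {e. \<exists>c. U *v e = c *s e} = UNIV"
proof -
  let ?E = "{e. \<exists>c. U *v e = c *s e}"
  have "span ?E = UNIV"
  proof (rule ccontr)
    assume "span ?E \<noteq> UNIV"
    then obtain a where a: "a \<noteq> 0" "\<And>x. x \<in> span ?E \<Longrightarrow> inner a x = 0"
      using span_not_UNIV_orthogonal by blast
    define S where "S = {x. \<forall>e\<in>?E. inner x e = 0}"
    have E_smult: "c *s e \<in> ?E" if e: "e \<in> ?E" for c e
    proof -
      obtain d where "U *v e = d *s e" using e by blast
      then have "U *v (c *s e) = d *s (c *s e)" by (simp add: vector_scalar_commute mult.commute)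
      then show ?thesis by blast
    qed
    have eig: "U *v e \<in> ?E" "ctranspose U *v e \<in> ?E" if e: "e \<in> ?E" for e
    proof -
      obtain d where d: "U *v e = d *s e" using e by blast
      show "U *v e \<in> ?E" unfolding d using e by (rule E_smult)
      have "e = d *s (ctranspose U *v e)"
        using unitary_mult_ctranspose(1)[OF U, of e] unfolding d by (simp add: vector_scalar_commute)
      then have "ctranspose U *v e = inverse d *s e \<or> e = 0"
        by (cases "d = 0") (metis vector_smult_lzero, metis left_inverse vector_smult_assoc vector_smult_lid)
      moreover have "(0 :: complex^'n) \<in> ?E" by (auto intro: exI[of _ 0])
      ultimately show "ctranspose U *v e \<in> ?E" using E_smult[OF e, of "inverse d"] by auto
    qed
    have "subspace S" unfolding S_def subspace_def by (auto simp: inner_add_left)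
    moreover have "c *s x \<in> S" if "x \<in> S" for c x
      using that E_smult unfolding S_def by (auto simp: inner_smult)
    moreover have "U *v x \<in> S" if "x \<in> S" for x
    proof -
      have "inner (U *v x) e = 0" if "e \<in> ?E" for e
      proof -
        have "inner (U *v x) e = inner x (ctranspose U *v e)"
          by (metis inner_commute inner_ctranspose)
        moreover have "inner x (ctranspose U *v e) = 0"
          using eig(2)[OF that] \<open>x \<in> S\<close> unfolding S_def by blast
        ultimately show ?thesis by simp
      qed
      then show ?thesis unfolding S_def by blast
    qed
    moreover have "ctranspose U *v x \<in> S" if "x \<in> S" for x
      using that eig(1) unfolding S_def by (auto simp: inner_ctranspose)
    moreover have "S \<noteq> {0}"
    proof -
      have "inner a e = 0" if "e \<in> ?E" for e using that by (rule a(2)[OF span_base])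
      then have "a \<in> S" unfolding S_def by blast
      then show ?thesis using a(1) by auto
    qed
    ultimately obtain w c where w: "w \<in> S" "w \<noteq> 0" "U *v w = c *s w"
      using unitary_eigenvector_in_invariant_subspace[OF U, of S] by metis
    then have "inner w w = 0" unfolding S_def by blast
    then show False using w by simp
  qed
  moreover have "span ?E \<subseteq> vec.span ?E"
  proof (rule span_minimal)
    show "subspace (vec.span ?E)"
      unfolding subspace_def by (auto simp: vec.span_zero vec.span_add scaleR_eq_smult vec.span_scale)
  qed (rule vec.span_superset)
  ultimately show ?thesis by blast
qed

lemma cis_double_inj:
  assumes "cis (2 * a) = cis (2 * b)" "a \<in> {0..<pi}" "b \<in> {0..<pi}"
  shows "a = b"
proof -
  have ab: "Arg2pi (cis (2 * a)) = 2 * a" "Arg2pi (cis (2 * b)) = 2 * b"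
    using assms(2,3) by (auto intro!: Arg2pi_unique[of 1] simp: cis_conv_exp)
  have "2 * a = 2 * b" using ab unfolding assms(1) by linarith
  then show ?thesis by simp
qed

text \<open>The matrix acting on a basis of eigenvectors by \<open>e\<^bsup>2i\<gamma>\<^esup> \<mapsto> e\<^bsup>i\<gamma>\<^esup>\<close> is the only one that meets the
defining condition of \<open>unitary_sqrt\<close>: an arbitrary eigenvector for \<open>e\<^bsup>2i\<gamma>\<^esup>\<close> only involves basis vectors with
the same \<open>\<gamma>\<close>.\<close>

theorem unitary_sqrt_square:
  fixes U :: "complex^'n^'n"
  assumes U: "U \<in> unitary_matrices"
  shows "unitary_sqrt U ** unitary_sqrt U = U"
proof -
  let ?E = "{e. \<exists>c. U *v e = c *s e}"
  obtain B where B: "B \<subseteq> ?E" "vec.independent B" "?E \<subseteq> vec.span B"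
    by (rule vec.maximal_independent_subset[of ?E])
  have spanB: "vec.span B = UNIV"
    using unitary_eigenvectors_span[OF U] vec.span_mono[OF B(3)] unfolding vec.span_span by blast
  have finB: "finite B" using B(2) by (rule vec.finiteI_independent)
  have nz: "e \<noteq> 0" if "e \<in> B" for e using that B(2) vec.dependent_zero by blast
  have "\<exists>g\<in>{0..<pi}. U *v e = cis (2 * g) *s e" if e: "e \<in> B" for e
  proof -
    obtain c where c: "U *v e = c *s e" using e B(1) by blast
    have "cmod c * norm e = norm e" using unitary_norm[OF U, of e] unfolding c norm_smult_vec .
    then have "cmod c = 1" using nz[OF e] by simp
    then have "c = cis (Arg2pi c)" using Arg2pi_eq[of c] by (simp add: cis_conv_exp)
    then have "U *v e = cis (2 * (Arg2pi c / 2)) *s e" using c by simp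
    moreover have "Arg2pi c / 2 \<in> {0..<pi}" using Arg2pi[of c] by auto
    ultimately show ?thesis by blast
  qed
  then obtain g where g: "\<And>e. e \<in> B \<Longrightarrow> g e \<in> {0..<pi}" "\<And>e. e \<in> B \<Longrightarrow> U *v e = cis (2 * g e) *s e"
    by metis
  obtain h where h: "Vector_Spaces.linear (*s) (*s) h" "\<And>e. e \<in> B \<Longrightarrow> h e = cis (g e) *s e"
    using vector_space_pair.linear_independent_extend[OF _ B(2), of "(*s)" "\<lambda>e. cis (g e) *s e"]
      vec.vector_space_pair_axioms by blast
  define W where "W = matrix h"
  have WB: "W *v e = cis (g e) *s e" if "e \<in> B" for e
    unfolding W_def using matrix_works[OF h(1)] h(2)[OF that] by simp
  have expand: "\<exists>u. v = (\<Sum>e\<in>B. u e *s e)" for v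
  proof -
    have "v \<in> range (\<lambda>u. \<Sum>e\<in>B. u e *s e)"
      using spanB unfolding vec.span_finite[OF finB] by simp
    then show ?thesis by (rule rangeE) blast
  qed
  have lin: "A *v (\<Sum>e\<in>B. u e *s e) = (\<Sum>e\<in>B. u e *s (A *v e))" for A :: "complex^'n^'n" and u
    unfolding vec.linear_sum[OF matrix_vector_mul_linear_gen] by (simp only: vector_scalar_commute)
  have eqI: "A = A'" if eq: "\<And>e. e \<in> B \<Longrightarrow> A *v e = A' *v e" for A A' :: "complex^'n^'n"
  proof -
    have "A *v x = A' *v x" for x
    proof -
      obtain u where u: "x = (\<Sum>e\<in>B. u e *s e)" using expand by blast
      show ?thesis unfolding u lin by (intro sum.cong refl) (simp add: eq)
    qed
    then show ?thesis by (simp add: matrix_eq)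
  qed
  have Wprop: "W *v v = cis \<gamma> *s v" if \<gamma>: "\<gamma> \<in> {0..<pi}" and v: "U *v v = cis (2 * \<gamma>) *s v" for \<gamma> v
  proof -
    obtain u where u: "v = (\<Sum>e\<in>B. u e *s e)" using expand by blast
    have "(\<Sum>e\<in>B. (u e * (cis (2 * g e) - cis (2 * \<gamma>))) *s e) =
        (\<Sum>e\<in>B. u e *s (U *v e)) - cis (2 * \<gamma>) *s (\<Sum>e\<in>B. u e *s e)"
      unfolding vec.scale_sum_right sum_subtractf[symmetric]
      by (intro sum.cong refl) (simp add: g(2) vec_eq_iff algebra_simps)
    also have "\<dots> = 0" using v unfolding u lin by simp
    finally have *: "(\<Sum>e\<in>B. (u e * (cis (2 * g e) - cis (2 * \<gamma>))) *s e) = 0" .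
    have "u e *s (W *v e) = cis \<gamma> *s (u e *s e)" if e: "e \<in> B" for e
    proof -
      have "u e * (cis (2 * g e) - cis (2 * \<gamma>)) = 0"
        using vec.independentD[OF B(2) finB order_refl * e] .
      then consider "u e = 0" | "g e = \<gamma>" using cis_double_inj[OF _ g(1)[OF e] \<gamma>] by auto
      then show ?thesis by cases (auto simp: WB[OF e] mult.commute)
    qed
    then show ?thesis unfolding u lin vec.scale_sum_right by (intro sum.cong refl)
  qed
  have "unitary_sqrt U = W"
    unfolding unitary_sqrt_def
  proof (rule the_equality)
    show "\<forall>\<gamma>\<in>{0..<pi}. \<forall>v. U *v v = cis (2 * \<gamma>) *s v \<longrightarrow> W *v v = cis \<gamma> *s v"
      using Wprop by blast
  next
    fix W' assume "\<forall>\<gamma>\<in>{0..<pi}. \<forall>v. U *v v = cis (2 * \<gamma>) *s v \<longrightarrow> W' *v v = cis \<gamma> *s v"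
    then show "W' = W" using g WB by (intro eqI) auto
  qed
  moreover have "W ** W = U"
    by (rule eqI) (simp add: matrix_vector_mul_assoc[symmetric] WB vector_scalar_commute g(2) cis_mult)
  ultimately show ?thesis by simp
qed

lemma unitary_sqrt_inverse:
  assumes U: "U \<in> unitary_matrices"
  shows "matrix_inv (unitary_sqrt U) ** unitary_sqrt U = mat 1"
    "unitary_sqrt U ** matrix_inv (unitary_sqrt U) = mat 1"
proof -
  have "unitary_sqrt U ** (unitary_sqrt U ** ctranspose U) = mat 1"
    using unitary_sqrt_square[OF U] U by (simp add: matrix_mul_assoc unitary_matrices_def)
  then have "invertible (unitary_sqrt U)" unfolding invertible_right_inverse by blast
  then have "unitary_sqrt U ** matrix_inv (unitary_sqrt U) = mat 1 \<and> matrix_inv (unitary_sqrt U) ** unitary_sqrt U = mat 1"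
    unfolding invertible_def matrix_inv_def by (rule someI_ex)
  then show "matrix_inv (unitary_sqrt U) ** unitary_sqrt U = mat 1"
    "unitary_sqrt U ** matrix_inv (unitary_sqrt U) = mat 1"
    by simp_all
qed

section \<open>Block vectors\<close>

definition join :: "complex^'n \<Rightarrow> complex^'n \<Rightarrow> complex^('n + 'n)" where
  "join a b = (\<chi> i. case i of Inl k \<Rightarrow> a $ k | Inr k \<Rightarrow> b $ k)"

lemma upper_join [simp]: "upper (join a b) = a" and lower_join [simp]: "lower (join a b) = b"
  by (simp_all add: upper_def lower_def join_def vec_eq_iff)

lemma join_upper_lower [simp]: "join (upper y) (lower y) = y"
  by (simp add: upper_def lower_def join_def vec_eq_iff split: sum.split)

lemma join_eq_iff: "join a b = join c d \<longleftrightarrow> a = c \<and> b = d"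
  by (metis upper_join lower_join)

lemma join_smult: "c *s join a b = join (c *s a) (c *s b)"
  by (simp add: join_def vec_eq_iff split: sum.split)

lemma join_add: "join a b + join c d = join (a + c) (b + d)"
  by (simp add: join_def vec_eq_iff split: sum.split)

lemma join_eq_0_iff: "join a b = 0 \<longleftrightarrow> a = 0 \<and> b = 0"
  by (auto simp: join_def vec_eq_iff split: sum.split_asm sum.split)

lemma sum_UNIV_Plus: "(\<Sum>x\<in>UNIV. f x) = (\<Sum>a\<in>UNIV. f (Inl a)) + (\<Sum>b\<in>UNIV. f (Inr b))"
  for f :: "'a::finite + 'b::finite \<Rightarrow> 'c::comm_monoid_add"
  by (subst UNIV_Plus_UNIV[symmetric], subst sum.Plus) (auto simp: o_def)

lemma block_matrix_mult_join:
  "block_matrix A B C D *v join a b = join (A *v a + B *v b) (C *v a + D *v b)"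
  by (simp add: vec_eq_iff matrix_vector_mult_def block_matrix_def block_row_def join_def sum_UNIV_Plus
      split: sum.split)

lemma block_row_mult_join: "block_row A B *v join a b = A *v a + B *v b"
  by (simp add: vec_eq_iff matrix_vector_mult_def block_row_def join_def sum_UNIV_Plus)

lemma cscale_mult_vec: "cscale c A *v x = c *s (A *v x)"
  by (simp add: vec_eq_iff matrix_vector_mult_def cscale_def map_matrix_def sum_distrib_left mult.assoc)

lemma uminus_mat_mult: "(- A) *v x = - (A *v x)" for A :: "complex^'n^'m"
  by (simp add: vec_eq_iff matrix_vector_mult_def sum_negf)

lemma J_mat_mult_join: "J_mat *v join a b = join ((-\<i>) *s a) (\<i> *s b)"
  unfolding J_mat_def cscale_mult_vec block_matrix_mult_join
  by (simp add: uminus_mat_mult join_smult join_eq_iff vec_eq_iff)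

lemma V_mat_mult_join: "V_mat A *v join a b = join (A *v b) (ctranspose A *v a)"
  unfolding V_mat_def block_matrix_mult_join by simp

lemma a_mat_adjoint_mult: "ctranspose a_mat *v v = join ((1 / sqrt 2) *s v) (- (1 / sqrt 2) *s v)"
proof -
  have "(ctranspose a_mat *v v) $ i = join ((1 / sqrt 2) *s v) (- (1 / sqrt 2) *s v) $ i" for i
  proof -
    have s: "(\<Sum>j\<in>UNIV. cnj (if j = k then 1 else 0) * (v $ j)) = v $ k" for k
      by (simp add: if_distrib[of cnj] if_distrib[of "\<lambda>x. x * _"] cong: if_cong)
    show ?thesis
    proof (cases i)
      case (Inl k)
      have "(ctranspose a_mat *v v) $ i = (\<Sum>j\<in>UNIV. (1 / sqrt 2) * (cnj (if j = k then 1 else 0) * (v $ j)))"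
        unfolding matrix_vector_mult_def vec_lambda_beta
        by (intro sum.cong refl) (simp add: ctranspose_nth a_mat_def cscale_def map_matrix_def block_row_def mat_def Inl)
      then show ?thesis unfolding sum_distrib_left[symmetric] s by (simp add: join_def Inl)
    next
      case (Inr k)
      have "(ctranspose a_mat *v v) $ i = (\<Sum>j\<in>UNIV. - (1 / sqrt 2) * (cnj (if j = k then 1 else 0) * (v $ j)))"
        unfolding matrix_vector_mult_def vec_lambda_beta
        by (intro sum.cong refl) (simp add: ctranspose_nth a_mat_def cscale_def map_matrix_def block_row_def mat_def Inr)
      then show ?thesis unfolding sum_distrib_left[symmetric] s by (simp add: join_def Inr)
    qed
  qed
  then show ?thesis by (simp add: vec_eq_iff)
qed

text \<open>Since \<open>b\<^sub>U (a, b) = 2\<^bsup>-1/2\<^esup> U\<^bsup>-1/2\<^esup> (a - U b)\<close>, the kernel of \<open>b\<^sub>U\<close> is the boundary condition at the right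
endpoint, and the square root enters only through its invertibility.\<close>

lemma b_mat_mult_join:
  assumes "U \<in> unitary_matrices"
  shows "b_mat U *v join a b = (1 / sqrt 2) *s (matrix_inv (unitary_sqrt U) *v (a - U *v b))"
proof -
  let ?W = "unitary_sqrt U"
  have "?W *v b = matrix_inv ?W *v (U *v b)"
  proof -
    have "matrix_inv ?W ** U = matrix_inv ?W ** (?W ** ?W)" using unitary_sqrt_square[OF assms] by simp
    also have "\<dots> = ?W" using unitary_sqrt_inverse[OF assms] by (simp add: matrix_mul_assoc)
    finally show ?thesis by (simp add: matrix_vector_mul_assoc)
  qed
  then show ?thesis
    unfolding b_mat_def cscale_mult_vec block_row_mult_join
    by (simp add: uminus_mat_mult matrix_vector_mult_diff_distrib)
qed

lemma bounded_linear_upper: "bounded_linear upper" and bounded_linear_lower: "bounded_linear lower"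
  by (auto simp: linear_conv_bounded_linear[symmetric] upper_def lower_def vec_eq_iff intro!: linearI)

section \<open>Matrix solutions\<close>

lemma Lp01_1_iff: "f \<in> Lp01 1 \<longleftrightarrow> f absolutely_integrable_on {0..1}"
  for f :: "real \<Rightarrow> 'a::euclidean_space"
proof -
  have "f \<in> Lp01 1 \<longleftrightarrow> integrable (lebesgue_on {0<..<1}) f"
  proof -
    have "(\<lambda>x. norm (f x) powr 1) = (\<lambda>x. norm (f x))" by auto
    then show ?thesis unfolding Lp01_def
      using integrable_norm_iff[of f "lebesgue_on {0<..<1}"] by auto
  qed
  also have "\<dots> \<longleftrightarrow> f absolutely_integrable_on {0<..<1}"
    by (simp add: integrable_restrict_space set_integrable_def)
  also have "\<dots> \<longleftrightarrow> f absolutely_integrable_on {0..1}"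
  proof (rule absolutely_integrable_spike_set_eq)
    show "negligible {x \<in> {0<..<1} - {0..1}. f x \<noteq> 0}"
      by (rule negligible_subset[of "{}"]) auto
    show "negligible {x \<in> {0..1} - {0<..<1}. f x \<noteq> 0}"
      by (rule negligible_subset[of "{0,1}"]) auto
  qed
  finally show ?thesis .
qed

lemma Lp01_imp_absolutely_integrable:
  fixes f :: "real \<Rightarrow> 'a::euclidean_space"
  assumes "1 \<le> p" "f \<in> Lp01 p"
  shows "f absolutely_integrable_on {0..1}"
proof -
  have f: "f \<in> borel_measurable (lebesgue_on {0<..<1})"
    "integrable (lebesgue_on {0<..<1}) (\<lambda>x. norm (f x) powr p)" using assms(2) by (auto simp: Lp01_def)
  have "finite_measure (lebesgue_on {0<..<1::real})"
    by (rule finite_measure_lebesgue_on) auto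
  then have c: "integrable (lebesgue_on {0<..<1}) (\<lambda>x. 1 + norm (f x) powr p)"
    using f(2) by (intro Bochner_Integration.integrable_add finite_measure.integrable_const)
  have "integrable (lebesgue_on {0<..<1}) f"
  proof (rule Bochner_Integration.integrable_bound[OF c f(1)], rule AE_I2)
    fix x
    have "norm (f x) \<le> 1 + norm (f x) powr p"
    proof (cases "norm (f x) \<le> 1")
      case False
      then have "norm (f x) powr 1 \<le> norm (f x) powr p" using assms(1) by (intro powr_mono) auto
      then show ?thesis using False by simp
    qed (simp add: add_increasing2)
    then show "norm (f x) \<le> norm (1 + norm (f x) powr p)" by simp
  qed
  then have "f \<in> Lp01 1" using f(1) by (simp add: Lp01_def)
  then show ?thesis by (simp add: Lp01_1_iff)
qed

lemma W11_imp_ac_deriv: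
  assumes "F \<in> W11"
  shows "ac_deriv F (\<lambda>x. vector_derivative F (at x))"
proof -
  have "negligible {x\<in>{0<..<1}. \<not> (F differentiable (at x))}"
    using assms by (simp add: W11_def AE_lebesgue_on_01_iff)
  moreover have "{x\<in>{0<..<1}. \<not> (F has_vector_derivative vector_derivative F (at x)) (at x)} =
     {x\<in>{0<..<1}. \<not> (F differentiable (at x))}"
    using vector_derivative_works by blast
  ultimately show ?thesis using assms by (simp add: W11_def ac_deriv_def)
qed

lemma ac_deriv_vector_derivative:
  assumes "ac_deriv F f"
  shows "negligible {x\<in>{0<..<1}. vector_derivative F (at x) \<noteq> f x}"
proof -
  have "negligible {x\<in>{0<..<1}. \<not> (F has_vector_derivative f x) (at x)}"
    using assms by (simp add: ac_deriv_def)
  then show ?thesis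
    by (rule negligible_subset) (auto intro: vector_derivative_at)
qed

lemma ac_deriv_imp_W11:
  assumes F: "ac_deriv F f" and f: "f absolutely_integrable_on {0..1}"
  shows "F \<in> W11"
proof -
  have 1: "AE x in lebesgue_on {0<..<1}. F differentiable (at x)"
    unfolding AE_lebesgue_on_01_iff
    by (rule negligible_subset[OF conjunct2[OF F[unfolded ac_deriv_def]]])
      (auto intro: differentiableI_vector)
  have "negligible ({x\<in>{0<..<1}. vector_derivative F (at x) \<noteq> f x} \<union> {0,1})"
    using ac_deriv_vector_derivative[OF F] by (intro negligible_Un) auto
  then have "(\<lambda>x. vector_derivative F (at x)) absolutely_integrable_on {0..1}"
    by (rule absolutely_integrable_spike[OF f]) auto
  then show ?thesis using F 1 by (simp add: W11_def Lp01_1_iff ac_deriv_def)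
qed

lemma ac_deriv_cong_AE:
  assumes "ac_deriv F f" "negligible {x\<in>{0<..<1}. f x \<noteq> g x}"
  shows "ac_deriv F g"
proof -
  have "negligible ({x\<in>{0<..<1}. \<not> (F has_vector_derivative f x) (at x)} \<union> {x\<in>{0<..<1}. f x \<noteq> g x})"
    using assms unfolding ac_deriv_def by (intro negligible_Un) auto
  then have "negligible {x\<in>{0<..<1}. \<not> (F has_vector_derivative g x) (at x)}"
    by (rule negligible_subset) auto
  then show ?thesis using assms(1) by (simp add: ac_deriv_def)
qed

lemma dirac_equation_iff:
  "J_mat *v join d1 d2 + V_mat A *v join a b = \<zeta> *s join a b \<longleftrightarrow>
     d1 = (\<i> * \<zeta>) *s a + (-\<i>) *s (A *v b) \<and> d2 = (- (\<i> * \<zeta>)) *s b + \<i> *s (ctranspose A *v a)"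
proof -
  have i: "(-\<i>) * x + y = z \<longleftrightarrow> x = \<i> * z + (-\<i>) * y" "\<i> * x + y = z \<longleftrightarrow> x = (-\<i>) * z + \<i> * y" for x y z :: complex
  proof -
    have "(-\<i>) * (\<i> * z + (-\<i>) * y) + y = z" "\<i> * ((-\<i>) * z + \<i> * y) + y = z"
      "\<i> * ((-\<i>) * x + y) + (-\<i>) * y = x" "(-\<i>) * (\<i> * x + y) + \<i> * y = x"
      by (simp_all add: algebra_simps) 
    then show "(-\<i>) * x + y = z \<longleftrightarrow> x = \<i> * z + (-\<i>) * y" "\<i> * x + y = z \<longleftrightarrow> x = (-\<i>) * z + \<i> * y" by metis+
  qed
  have "J_mat *v join d1 d2 + V_mat A *v join a b = \<zeta> *s join a b \<longleftrightarrow>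
    (-\<i>) *s d1 + A *v b = \<zeta> *s a \<and> \<i> *s d2 + ctranspose A *v a = \<zeta> *s b"
    unfolding J_mat_mult_join V_mat_mult_join join_add join_smult join_eq_iff ..
  also have "(-\<i>) *s d1 + A *v b = \<zeta> *s a \<longleftrightarrow> d1 = (\<i> * \<zeta>) *s a + (-\<i>) *s (A *v b)"
    unfolding vec_eq_iff vector_add_component vector_smult_component i by (simp add: mult.assoc)
  also have "\<i> *s d2 + ctranspose A *v a = \<zeta> *s b \<longleftrightarrow> d2 = (- (\<i> * \<zeta>)) *s b + \<i> *s (ctranspose A *v a)"
    unfolding vec_eq_iff vector_add_component vector_smult_component i by (simp add: mult.assoc)
  finally show ?thesis .
qed

lemma bounded_linear_matrix_column: "bounded_linear (\<lambda>Y :: complex^'n^'m. Y *v c)"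
  unfolding linear_conv_bounded_linear[symmetric]
  by (rule linearI) (simp_all add: vec_eq_iff matrix_vector_mult_def sum.distrib algebra_simps scaleR_sum_right)

lemma is_solution_imp_dirac_solution:
  assumes "is_solution V \<zeta> Y"
  shows "dirac_solution V \<zeta> (\<lambda>x. upper (Y x *v c)) (\<lambda>x. lower (Y x *v c))"
proof -
  let ?D = "\<lambda>x. vector_derivative Y (at x)"
  have "Y \<in> W11" using assms by (simp add: is_solution_def)
  then have Y: "ac_deriv Y ?D" by (rule W11_imp_ac_deriv)
  have neg: "negligible {x\<in>{0<..<1}. J_mat ** ?D x + V_mat (V x) ** Y x \<noteq> cscale \<zeta> (Y x)}"
    using assms by (simp add: is_solution_def AE_lebesgue_on_01_iff)
  have eq: "upper (?D x *v c) = (\<i> * \<zeta>) *s upper (Y x *v c) + (-\<i>) *s (V x *v lower (Y x *v c)) \<and>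
    lower (?D x *v c) = (- (\<i> * \<zeta>)) *s lower (Y x *v c) + \<i> *s (ctranspose (V x) *v upper (Y x *v c))"
    if "J_mat ** ?D x + V_mat (V x) ** Y x = cscale \<zeta> (Y x)" for x
  proof -
    have "(J_mat ** ?D x + V_mat (V x) ** Y x) *v c = cscale \<zeta> (Y x) *v c" using that by simp
    then have "J_mat *v (?D x *v c) + V_mat (V x) *v (Y x *v c) = \<zeta> *s (Y x *v c)"
      by (simp add: matrix_vector_mult_add_rdistrib matrix_vector_mul_assoc cscale_mult_vec)
    then have "J_mat *v join (upper (?D x *v c)) (lower (?D x *v c)) + V_mat (V x) *v join (upper (Y x *v c)) (lower (Y x *v c))
      = \<zeta> *s join (upper (Y x *v c)) (lower (Y x *v c))" by simp
    then show ?thesis unfolding dirac_equation_iff .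
  qed
  have u: "ac_deriv (\<lambda>x. upper (Y x *v c)) (\<lambda>x. upper (?D x *v c))"
    by (rule ac_deriv_bounded_linear[OF bounded_linear_compose[OF bounded_linear_upper bounded_linear_matrix_column] Y])
  have l: "ac_deriv (\<lambda>x. lower (Y x *v c)) (\<lambda>x. lower (?D x *v c))"
    by (rule ac_deriv_bounded_linear[OF bounded_linear_compose[OF bounded_linear_lower bounded_linear_matrix_column] Y])
  show ?thesis
    unfolding dirac_solution_def
    by (intro conjI ac_deriv_cong_AE[OF u] ac_deriv_cong_AE[OF l] negligible_subset[OF neg]) (use eq in auto)
qed

definition from_columns :: "('n \<Rightarrow> complex^'m) \<Rightarrow> complex^'n^'m" where
  "from_columns f = (\<chi> i j. f j $ i)"

lemma matrix_axis_nth: "(A *v axis j 1) $ i = A $ i $ j" for A :: "complex^'n^'m"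
  by (simp add: matrix_vector_mult_def axis_def if_distrib[of "\<lambda>x. _ * x"] cong: if_cong)

lemma from_columns_axis: "from_columns f *v axis j 1 = f j"
  unfolding vec_eq_iff matrix_axis_nth by (simp add: from_columns_def)

lemma matrix_eq_columns: "A = B \<longleftrightarrow> (\<forall>j. A *v axis j 1 = B *v axis j 1)" for A B :: "complex^'n^'m"
  by (auto simp: vec_eq_iff matrix_axis_nth)

lemma from_columns_eq_sum:
  fixes g :: "'n::finite \<Rightarrow> complex^'m"
  shows "from_columns g = (\<Sum>k\<in>UNIV. from_columns (\<lambda>j. if j = k then g k else 0))"
  by (simp add: vec_eq_iff from_columns_def if_distrib[of "\<lambda>v::complex^'m. v $ _"] cong: if_cong)

lemma bounded_linear_single_column:
  "bounded_linear (\<lambda>v::complex^'m. from_columns (\<lambda>j::'n::finite. if j = k then v else 0))"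
  unfolding linear_conv_bounded_linear[symmetric]
  by (rule linearI) (simp_all add: from_columns_def vec_eq_iff)

lemma ac_deriv_from_columns:
  fixes F :: "'n::finite \<Rightarrow> real \<Rightarrow> complex^'m"
  assumes "\<And>j. ac_deriv (F j) (f j)"
  shows "ac_deriv (\<lambda>x. from_columns (\<lambda>j. F j x)) (\<lambda>x. from_columns (\<lambda>j. f j x))"
proof -
  have "ac_deriv (\<lambda>x. \<Sum>k\<in>UNIV. from_columns (\<lambda>j. if j = k then F k x else 0))
      (\<lambda>x. \<Sum>k\<in>UNIV. from_columns (\<lambda>j. if j = k then f k x else 0))"
    by (intro ac_deriv_sum ac_deriv_bounded_linear[OF bounded_linear_single_column] assms)
  then show ?thesis by (simp only: from_columns_eq_sum[symmetric])
qed

lemma bounded_linear_join_left: "bounded_linear (\<lambda>a. join a 0)"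
  and bounded_linear_join_right: "bounded_linear (\<lambda>a. join 0 a)"
  unfolding linear_conv_bounded_linear[symmetric]
  by (auto intro!: linearI simp: join_def vec_eq_iff split: sum.split)

lemma ac_deriv_join:
  assumes "ac_deriv F f" "ac_deriv G g"
  shows "ac_deriv (\<lambda>x. join (F x) (G x)) (\<lambda>x. join (f x) (g x))"
  using ac_deriv_add[OF ac_deriv_bounded_linear[OF bounded_linear_join_left assms(1)]
      ac_deriv_bounded_linear[OF bounded_linear_join_right assms(2)]]
  by (simp add: join_add)

lemma absolutely_integrable_join:
  assumes "f absolutely_integrable_on S" "g absolutely_integrable_on S"
  shows "(\<lambda>x::real. join (f x) (g x)) absolutely_integrable_on S"
  using set_integral_add(1)[OF absolutely_integrable_linear[OF assms(1) bounded_linear_join_left]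
      absolutely_integrable_linear[OF assms(2) bounded_linear_join_right]]
  by (simp add: join_add)

lemma absolutely_integrable_from_columns:
  fixes f :: "'n::finite \<Rightarrow> real \<Rightarrow> complex^'m"
  assumes "\<And>j. (\<lambda>x. f j x) absolutely_integrable_on S"
  shows "(\<lambda>x. from_columns (\<lambda>j. f j x)) absolutely_integrable_on (S :: real set)"
proof -
  have "(\<lambda>x. \<Sum>k\<in>UNIV. from_columns (\<lambda>j. if j = k then f k x else 0)) absolutely_integrable_on S"
    by (intro absolutely_integrable_sum finite
        absolutely_integrable_linear[OF assms bounded_linear_single_column, unfolded o_def])
  then show ?thesis by (simp only: from_columns_eq_sum[symmetric])
qed

context integrable_potential
begin

lemma absolutely_integrable_dirac_rhs:
  assumes "dirac_solution V \<zeta> y1 y2"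
  shows "(\<lambda>x. (\<i> * \<zeta>) *s y1 x + (-\<i>) *s (V x *v y2 x)) absolutely_integrable_on {0..1}"
    "(\<lambda>x. (- (\<i> * \<zeta>)) *s y2 x + \<i> *s (ctranspose (V x) *v y1 x)) absolutely_integrable_on {0..1}"
proof -
  have c: "continuous_on {0..1} y1" "continuous_on {0..1} y2"
    using assms unfolding dirac_solution_def by (auto intro: ac_deriv_continuous_on)
  have p: "(\<lambda>x. dirac_coupling (y1 x, y2 x) (V x)) absolutely_integrable_on {0..1}"
    by (intro absolutely_integrable_dirac_coupling V continuous_on_Pair c)
  have "(\<lambda>x. (-\<i>) *s (V x *v y2 x)) absolutely_integrable_on {0..1}"
    using absolutely_integrable_linear[OF p bounded_linear_fst] by (simp add: dirac_coupling_def o_def)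
  moreover have "(\<lambda>x. (\<i> * \<zeta>) *s y1 x) absolutely_integrable_on {0..1}"
    by (intro absolutely_integrable_continuous_real bounded_linear.continuous_on[OF bounded_linear_smult] c)
  ultimately show "(\<lambda>x. (\<i> * \<zeta>) *s y1 x + (-\<i>) *s (V x *v y2 x)) absolutely_integrable_on {0..1}"
    by (intro set_integral_add(1))
  have "(\<lambda>x. \<i> *s (ctranspose (V x) *v y1 x)) absolutely_integrable_on {0..1}"
    using absolutely_integrable_linear[OF p bounded_linear_snd] by (simp add: dirac_coupling_def o_def)
  moreover have "(\<lambda>x. (- (\<i> * \<zeta>)) *s y2 x) absolutely_integrable_on {0..1}"
    by (intro absolutely_integrable_continuous_real bounded_linear.continuous_on[OF bounded_linear_smult] c)
  ultimately show "(\<lambda>x. (- (\<i> * \<zeta>)) *s y2 x + \<i> *s (ctranspose (V x) *v y1 x)) absolutely_integrable_on {0..1}"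
    by (intro set_integral_add(1))
qed

lemma matrix_solution_exists:
  fixes Y0 :: "complex^'n^('n + 'n)"
  obtains Y where "is_solution V \<zeta> Y" "Y 0 = Y0"
proof -
  have "\<exists>y. dirac_solution V \<zeta> (\<lambda>x. fst (y x)) (\<lambda>x. snd (y x)) \<and>
      y 0 = (upper (Y0 *v axis j 1), lower (Y0 *v axis j 1))" for j
    using dirac_solution_exists by metis
  then obtain y where y: "\<And>j. dirac_solution V \<zeta> (\<lambda>x. fst (y j x)) (\<lambda>x. snd (y j x))"
    "\<And>j. y j 0 = (upper (Y0 *v axis j 1), lower (Y0 *v axis j 1))" by metis
  define d where "d = (\<lambda>j x. ((\<i> * \<zeta>) *s fst (y j x) + (-\<i>) *s (V x *v snd (y j x)),
    (- (\<i> * \<zeta>)) *s snd (y j x) + \<i> *s (ctranspose (V x) *v fst (y j x))))"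
  define Y where "Y = (\<lambda>x. from_columns (\<lambda>j. join (fst (y j x)) (snd (y j x))))"
  define E where "E = (\<lambda>x. from_columns (\<lambda>j. join (fst (d j x)) (snd (d j x))))"
  have col: "ac_deriv (\<lambda>x. join (fst (y j x)) (snd (y j x))) (\<lambda>x. join (fst (d j x)) (snd (d j x)))" for j
    using y(1)[of j] unfolding dirac_solution_def d_def fst_conv snd_conv by (intro ac_deriv_join) auto
  have Y: "ac_deriv Y E" unfolding Y_def E_def by (intro ac_deriv_from_columns col)
  have "(\<lambda>x. join (fst (d j x)) (snd (d j x))) absolutely_integrable_on {0..1}" for j
    unfolding d_def fst_conv snd_conv
    by (intro absolutely_integrable_join absolutely_integrable_dirac_rhs[OF y(1)])
  then have "E absolutely_integrable_on {0..1}" unfolding E_def by (rule absolutely_integrable_from_columns)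
  with Y have W: "Y \<in> W11" by (rule ac_deriv_imp_W11)
  have "J_mat ** E x + V_mat (V x) ** Y x = cscale \<zeta> (Y x)" for x
    unfolding matrix_eq_columns matrix_vector_mult_add_rdistrib matrix_vector_mul_assoc[symmetric] cscale_mult_vec
      E_def Y_def from_columns_axis dirac_equation_iff d_def fst_conv snd_conv by blast
  then have "negligible {x\<in>{0<..<1}. J_mat ** vector_derivative Y (at x) + V_mat (V x) ** Y x \<noteq> cscale \<zeta> (Y x)}"
    by (intro negligible_subset[OF ac_deriv_vector_derivative[OF Y]]) auto
  then have "is_solution V \<zeta> Y" using W by (simp add: is_solution_def AE_lebesgue_on_01_iff)
  moreover have "Y 0 = Y0"
    unfolding matrix_eq_columns Y_def from_columns_axis by (simp add: y(2))
  ultimately show ?thesis by (rule that)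
qed

text \<open>Columns reduce the matrix-valued initial value problem to the vector-valued one, for existence and for
uniqueness.\<close>

lemma cauchy_solution_mult:
  "cauchy_solution V Y0 1 \<zeta> *v c =
     join (fst (solution (upper (Y0 *v c), lower (Y0 *v c)) \<zeta> 1)) (snd (solution (upper (Y0 *v c), lower (Y0 *v c)) \<zeta> 1))"
proof -
  let ?s = "\<lambda>c. solution (upper (Y0 *v c), lower (Y0 *v c)) \<zeta> 1"
  have val: "Y 1 *v c = join (fst (?s c)) (snd (?s c))" if "is_solution V \<zeta> Y" "Y 0 = Y0" for Y c
    using solution_eq_endpoint[OF is_solution_imp_dirac_solution[OF that(1), of c]] that(2) by simp
  obtain Y where Y: "is_solution V \<zeta> Y" "Y 0 = Y0" by (rule matrix_solution_exists)
  have "cauchy_solution V Y0 1 \<zeta> = Y 1"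
    unfolding cauchy_solution_def
  proof (rule the_equality)
    show "\<exists>y. is_solution V \<zeta> y \<and> y 0 = Y0 \<and> y 1 = Y 1" using Y by blast
    fix Y1 assume "\<exists>y. is_solution V \<zeta> y \<and> y 0 = Y0 \<and> y 1 = Y1"
    then obtain y where "is_solution V \<zeta> y" "y 0 = Y0" "y 1 = Y1" by blast
    then show "Y1 = Y 1" using val[of y] val[OF Y] by (auto simp: matrix_eq_columns)
  qed
  then show ?thesis using val[OF Y] by simp
qed

end

section \<open>The Weyl function\<close>

text \<open>The initial value \<open>a\<^sup>* v + J a\<^sup>* m\<close>, so that the solution starting from it is \<open>\<psi> v + \<phi> m\<close>; for the Weyl
solution \<open>m = M v\<close>. The map \<open>(v, m) \<mapsto> weyl_init v m\<close> is isometric and turns the flux into \<open>-2 Im \<langle>m, v\<rangle>\<close>, since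
\<open>inner m (\<i> *s v)\<close> is that imaginary part.\<close>

definition weyl_init :: "complex^'n \<Rightarrow> complex^'n \<Rightarrow> (complex^'n) \<times> (complex^'n)" where
  "weyl_init v m = ((1 / sqrt 2) *s (v - \<i> *s m), (1 / sqrt 2) *s (- v - \<i> *s m))"

lemma J_mat_a_mat_adjoint_mult:
  "J_mat *v (ctranspose a_mat *v c) = join (fst (weyl_init 0 c)) (snd (weyl_init 0 c))"
  unfolding a_mat_adjoint_mult J_mat_mult_join weyl_init_def
  by (simp add: join_eq_iff vec_eq_iff)

lemma a_mat_adjoint_mult': "ctranspose a_mat *v v = join (fst (weyl_init v 0)) (snd (weyl_init v 0))"
  unfolding a_mat_adjoint_mult weyl_init_def by (simp add: join_eq_iff vec_eq_iff)

lemma weyl_init_add: "weyl_init v m = weyl_init v 0 + weyl_init 0 m"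
  by (simp add: weyl_init_def prod_eq_iff vec_eq_iff algebra_simps)

lemma pair_smult_1: "pair_smult 1 y = y" by (simp add: pair_smult_def)

lemma norm_csqrt2_smult: "(norm ((1 / complex_of_real (sqrt 2)) *s v))\<^sup>2 = (norm v)\<^sup>2 / 2" for v :: "complex^'n"
  by (simp add: norm_smult_vec norm_divide power_mult_distrib power_divide)

lemma inner_csqrt2_smult:
  "inner ((1 / complex_of_real (sqrt 2)) *s v) ((1 / complex_of_real (sqrt 2)) *s w) = inner v w / 2"
  for v w :: "complex^'n"
proof -
  have "(1 / complex_of_real (sqrt 2)) *s v = (1 / sqrt 2) *\<^sub>R v" for v :: "complex^'n"
    by (simp add: scaleR_eq_smult)
  then show ?thesis by (simp add: field_simps)
qed

lemma norm_i_smult: "norm (\<i> *s m) = norm m" for m :: "complex^'n" by (simp add: norm_smult_vec)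

lemma inner_i_smult: "inner v (\<i> *s m) = - inner m (\<i> *s v)" for v m :: "complex^'n"
proof -
  have "cnj \<i> *s v = - (\<i> *s v)" by (simp add: vec_eq_iff)
  then show ?thesis using inner_smult[of \<i> m v] by (simp add: inner_commute[of v])
qed

lemma weyl_init_energy: "(norm (fst (weyl_init v m)))\<^sup>2 + (norm (snd (weyl_init v m)))\<^sup>2 = (norm v)\<^sup>2 + (norm m)\<^sup>2"
proof -
  have "(norm (v - \<i> *s m))\<^sup>2 + (norm (- v - \<i> *s m))\<^sup>2 = 2 * ((norm v)\<^sup>2 + (norm m)\<^sup>2)"
    unfolding norm_i_smult[of m, symmetric] power2_norm_eq_inner
    by (simp add: inner_diff_left inner_diff_right inner_commute algebra_simps)
  then show ?thesis unfolding weyl_init_def fst_conv snd_conv of_real_divide of_real_1 norm_csqrt2_smult by simp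
qed

lemma weyl_init_flux: "(norm (snd (weyl_init v m)))\<^sup>2 - (norm (fst (weyl_init v m)))\<^sup>2 = - 2 * inner m (\<i> *s v)"
proof -
  have "(norm (- v - \<i> *s m))\<^sup>2 - (norm (v - \<i> *s m))\<^sup>2 = 4 * inner v (\<i> *s m)"
    unfolding power2_norm_eq_inner
    by (simp add: inner_diff_left inner_diff_right inner_commute algebra_simps)
  then show ?thesis
    unfolding weyl_init_def fst_conv snd_conv of_real_divide of_real_1 norm_csqrt2_smult inner_i_smult[of v] by simp
qed

lemma weyl_init_wronskian:
  "inner (fst (weyl_init v m)) (fst (weyl_init u n)) - inner (snd (weyl_init v m)) (snd (weyl_init u n)) =
     inner n (\<i> *s v) - inner u (\<i> *s m)"
proof -
  have "inner (v - \<i> *s m) (u - \<i> *s n) - inner (- v - \<i> *s m) (- u - \<i> *s n) =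
      - 2 * inner v (\<i> *s n) - 2 * inner u (\<i> *s m)"
    by (simp add: inner_diff_left inner_diff_right inner_commute[of "\<i> *s m" u])
  then show ?thesis
    unfolding weyl_init_def fst_conv snd_conv of_real_divide of_real_1 inner_csqrt2_smult inner_i_smult[of v] by simp
qed

lemma norm_fst_weyl_init_le: "norm (fst (weyl_init v m)) \<le> norm v + norm m"
proof (rule power2_le_imp_le)
  have "(norm (fst (weyl_init v m)))\<^sup>2 \<le> (norm v)\<^sup>2 + (norm m)\<^sup>2"
    using weyl_init_energy[of v m] zero_le_power2[of "norm (snd (weyl_init v m))"] by linarith
  also have "\<dots> \<le> (norm v + norm m)\<^sup>2" by (simp add: power2_sum)
  finally show "(norm (fst (weyl_init v m)))\<^sup>2 \<le> (norm v + norm m)\<^sup>2" .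
qed auto

lemma matrix_inv_mult:
  fixes A :: "complex^'n^'n"
  assumes "det A \<noteq> 0"
  shows "A ** matrix_inv A = mat 1" "matrix_inv A ** A = mat 1"
proof -
  have "invertible A" using assms by (simp add: invertible_det_nz)
  then have "A ** matrix_inv A = mat 1 \<and> matrix_inv A ** A = mat 1"
    unfolding invertible_def matrix_inv_def by (rule someI_ex)
  then show "A ** matrix_inv A = mat 1" "matrix_inv A ** A = mat 1" by auto
qed

lemma det_eq_0_iff_kernel: "det A = 0 \<longleftrightarrow> (\<exists>c. c \<noteq> 0 \<and> A *v c = 0)" for A :: "complex^'n^'n"
  by (metis invertible_det_nz invertible_left_inverse matrix_left_invertible_ker)

lemma matrix_inv_nth:
  fixes A :: "complex^'n^'n"
  assumes "det A \<noteq> 0"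
  shows "matrix_inv A $ k $ l = det (\<chi> i j. if j = k then axis l 1 $ i else A $ i $ j) / det A"
proof -
  have "A *v (matrix_inv A *v axis l 1) = axis l 1"
    by (simp add: matrix_vector_mul_assoc matrix_inv_mult[OF assms])
  then have eq: "matrix_inv A *v axis l 1 = (\<chi> k. det (\<chi> i j. if j = k then axis l 1 $ i else A $ i $ j) / det A)"
    using cramer[OF assms] by blast
  have "(matrix_inv A *v axis l 1) $ k = det (\<chi> i j. if j = k then axis l 1 $ i else A $ i $ j) / det A"
    unfolding eq by simp
  then show ?thesis by (simp only: matrix_axis_nth)
qed

lemma holomorphic_on_det:
  fixes A :: "complex \<Rightarrow> complex^'n^'n"
  assumes "\<And>i j. (\<lambda>z. A z $ i $ j) holomorphic_on S"
  shows "(\<lambda>z. det (A z)) holomorphic_on S"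
  unfolding det_def by (intro holomorphic_intros assms)

lemma norm_axis_1_complex: "norm (axis k 1 :: complex^'n) = 1"
  by (simp add: norm_vec_def L2_set_def axis_def if_distrib[of norm] if_distrib[of "\<lambda>x. x\<^sup>2"] cong: if_cong)

lemma inner_axis_complex: "inner v (axis k 1) = Re (v $ k)" for v :: "complex^'n"
proof -
  have "inner v (axis k 1) = (\<Sum>l\<in>UNIV. if l = k then Re (v $ k) else 0)"
    unfolding inner_vec_def by (intro sum.cong refl) (simp add: axis_def inner_complex_def)
  then show ?thesis by simp
qed

definition char_matrix :: "(real \<Rightarrow> complex^'n^'n) \<Rightarrow> complex^'n^'n \<Rightarrow> complex \<Rightarrow> complex^'n^'n" where
  "char_matrix V U \<zeta> = b_mat U ** phi V 1 \<zeta>"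

text \<open>Its zeros are the eigenvalues of the operator (\<open>eigenvalues_eq_spectrum\<close>).\<close>

definition char_det :: "(real \<Rightarrow> complex^'n^'n) \<Rightarrow> complex^'n^'n \<Rightarrow> complex \<Rightarrow> complex" where
  "char_det V U \<zeta> = det (char_matrix V U \<zeta>)"

lemma sqrt_inverse_inj:
  assumes "U \<in> unitary_matrices"
  shows "matrix_inv (unitary_sqrt U) *v x = 0 \<longleftrightarrow> x = 0"
proof
  assume "matrix_inv (unitary_sqrt U) *v x = 0"
  then have "unitary_sqrt U *v (matrix_inv (unitary_sqrt U) *v x) = 0" by simp
  then show "x = 0" by (simp add: matrix_vector_mul_assoc unitary_sqrt_inverse[OF assms])
qed simp

definition bc_form :: "complex^'n^'n \<Rightarrow> (complex^'n) \<times> (complex^'n) \<Rightarrow> complex^'n" where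
  "bc_form U y = b_mat U *v join (fst y) (snd y)"

lemma bc_form_eq_0_iff: "U \<in> unitary_matrices \<Longrightarrow> bc_form U y = 0 \<longleftrightarrow> fst y = U *v snd y"
  by (simp add: bc_form_def b_mat_mult_join vector_mul_eq_0 sqrt_inverse_inj)

lemma bc_form_lincomb: "bc_form U (pair_smult a y + pair_smult b z) = a *s bc_form U y + b *s bc_form U z"
  unfolding bc_form_def
  by (simp add: pair_smult_def join_add[symmetric] join_smult[symmetric] matrix_vector_right_distrib vector_scalar_commute)

lemma bounded_linear_bc_form_nth: "bounded_linear (\<lambda>y. bc_form U y $ i)"
  unfolding bc_form_def
  by (intro bounded_linear_compose[OF bounded_linear_vec_nth]
      bounded_linear_compose[OF matrix_vector_mul_bounded_linear])
    (auto simp: linear_conv_bounded_linear[symmetric] join_def vec_eq_iff intro!: linearI split: sum.split)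

context integrable_potential
begin

lemma bc_phi: "(b_mat U ** phi V 1 \<zeta>) *v c = bc_form U (solution (weyl_init 0 c) \<zeta> 1)"
  unfolding matrix_vector_mul_assoc[symmetric] phi_def cauchy_solution_mult J_mat_a_mat_adjoint_mult bc_form_def
  by simp

lemma bc_psi: "(b_mat U ** psi V 1 \<zeta>) *v c = bc_form U (solution (weyl_init c 0) \<zeta> 1)"
  unfolding matrix_vector_mul_assoc[symmetric] psi_def cauchy_solution_mult a_mat_adjoint_mult' bc_form_def
  by simp

lemma char_matrix_mult: "char_matrix V U \<zeta> *v c = bc_form U (solution (weyl_init 0 c) \<zeta> 1)"
  by (simp add: char_matrix_def bc_phi)

text \<open>This characterises \<open>M v\<close>: the solution \<open>\<psi> v + \<phi> M v\<close> satisfies the boundary condition at the right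
endpoint. All properties of the Weyl function are derived from it.\<close>

lemma weyl_function_boundary:
  assumes U: "U \<in> unitary_matrices" and d: "char_det V U \<zeta> \<noteq> 0"
  shows "fst (solution (weyl_init v (weyl_function V U \<zeta> *v v)) \<zeta> 1) =
    U *v snd (solution (weyl_init v (weyl_function V U \<zeta> *v v)) \<zeta> 1)"
proof -
  let ?m = "weyl_function V U \<zeta> *v v"
  have inv: "char_matrix V U \<zeta> ** matrix_inv (char_matrix V U \<zeta>) = mat 1"
    using d by (intro matrix_inv_mult) (simp add: char_det_def)
  have "char_matrix V U \<zeta> *v ?m = - ((b_mat U ** psi V 1 \<zeta>) *v v)"
    unfolding weyl_function_def char_matrix_def[symmetric] uminus_mat_mult
    by (simp add: matrix_vector_mul_assoc[symmetric] vec.neg)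
       (simp add: matrix_vector_mul_assoc inv matrix_mul_assoc)
  then have "bc_form U (solution (weyl_init 0 ?m) \<zeta> 1) + bc_form U (solution (weyl_init v 0) \<zeta> 1) = 0"
    unfolding char_matrix_mult bc_psi by simp
  then have "bc_form U (solution (weyl_init v ?m) \<zeta> 1) = 0"
    using solution_lincomb[of 1 "weyl_init v 0" 1 "weyl_init 0 ?m" \<zeta>]
      bc_form_lincomb[of U 1 "solution (weyl_init v 0) \<zeta> 1" 1 "solution (weyl_init 0 ?m) \<zeta> 1"]
    by (simp add: pair_smult_1 weyl_init_add[of v ?m, symmetric] add.commute)
  then show ?thesis using bc_form_eq_0_iff[OF U] by blast
qed

lemma char_det_eq_0_iff:
  assumes U: "U \<in> unitary_matrices"
  shows "char_det V U \<zeta> = 0 \<longleftrightarrow>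
    (\<exists>c. c \<noteq> 0 \<and> fst (solution (weyl_init 0 c) \<zeta> 1) = U *v snd (solution (weyl_init 0 c) \<zeta> 1))"
  unfolding char_det_def det_eq_0_iff_kernel char_matrix_mult bc_form_eq_0_iff[OF U] ..

lemma solution_flux_growth:
  "exp (- 2 * mass 1) * (1 - exp (- 2 * \<bar>Im \<zeta>\<bar>)) * ((norm (fst c))\<^sup>2 + (norm (snd c))\<^sup>2) \<le>
    sgn (Im \<zeta>) * (((norm (snd (solution c \<zeta> 1)))\<^sup>2 - (norm (fst (solution c \<zeta> 1)))\<^sup>2) - ((norm (snd c))\<^sup>2 - (norm (fst c))\<^sup>2))"
proof -
  obtain y where y: "dirac_solution V \<zeta> (\<lambda>x. fst (y x)) (\<lambda>x. snd (y x))" "y 0 = c" "y 1 = solution c \<zeta> 1"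
    using dirac_solution_exists by metis
  from flux_growth[OF y(1)] show ?thesis unfolding y .
qed

lemma norm_solution_le: "norm (solution c \<zeta> 1) \<le> exp (mass 1 + \<bar>Im \<zeta>\<bar>) * norm c"
proof (rule power2_le_imp_le)
  obtain y where y: "dirac_solution V \<zeta> (\<lambda>x. fst (y x)) (\<lambda>x. snd (y x))" "y 0 = c" "y 1 = solution c \<zeta> 1"
    using dirac_solution_exists by metis
  from energy_le_initial[OF y(1), of 1]
  show "(norm (solution c \<zeta> 1))\<^sup>2 \<le> (exp (mass 1 + \<bar>Im \<zeta>\<bar>) * norm c)\<^sup>2"
    unfolding y power_mult_distrib norm_Pair_power2 exp_double[symmetric] by simp
qed simp

text \<open>Both boundary conditions make the flux vanish, so a solution satisfying them at a nonreal \<open>\<zeta>\<close> contradicts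
the strict growth of the flux.\<close>

lemma char_det_nonreal:
  assumes U: "U \<in> unitary_matrices" and "Im \<zeta> \<noteq> 0"
  shows "char_det V U \<zeta> \<noteq> 0"
proof
  assume "char_det V U \<zeta> = 0"
  then obtain c where c: "c \<noteq> 0" "fst (solution (weyl_init 0 c) \<zeta> 1) = U *v snd (solution (weyl_init 0 c) \<zeta> 1)"
    unfolding char_det_eq_0_iff[OF U] by blast
  have "exp (- 2 * mass 1) * (1 - exp (- 2 * \<bar>Im \<zeta>\<bar>)) * ((norm (0::complex^'n))\<^sup>2 + (norm c)\<^sup>2) \<le> 0"
    using solution_flux_growth[of \<zeta> "weyl_init 0 c"]
    unfolding weyl_init_energy weyl_init_flux c(2) unitary_norm[OF U] by simp
  moreover have "exp (- 2 * mass 1) * (1 - exp (- 2 * \<bar>Im \<zeta>\<bar>)) * ((norm (0::complex^'n))\<^sup>2 + (norm c)\<^sup>2) > 0"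
    using c(1) assms(2) by simp
  ultimately show False by linarith
qed

text \<open>A quantitative Herglotz property. The Weyl solution has no flux at the right endpoint, so the flux at
\<open>0\<close>, which is \<open>-2 Im \<langle>M v, v\<rangle>\<close>, pays for the whole growth.\<close>

lemma weyl_function_herglotz:
  assumes U: "U \<in> unitary_matrices" and d: "char_det V U \<zeta> \<noteq> 0"
  shows "exp (- 2 * mass 1) * (1 - exp (- 2 * \<bar>Im \<zeta>\<bar>)) * ((norm v)\<^sup>2 + (norm (weyl_function V U \<zeta> *v v))\<^sup>2) \<le>
    2 * (sgn (Im \<zeta>) * inner (weyl_function V U \<zeta> *v v) (\<i> *s v))"
  using solution_flux_growth[of \<zeta> "weyl_init v (weyl_function V U \<zeta> *v v)"]
  unfolding weyl_init_energy weyl_init_flux weyl_function_boundary[OF U d] unitary_norm[OF U] by simp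

lemma weyl_function_norm_bound:
  assumes U: "U \<in> unitary_matrices" and d: "char_det V U \<zeta> \<noteq> 0"
  shows "exp (- 2 * mass 1) * (1 - exp (- 2 * \<bar>Im \<zeta>\<bar>)) * norm (weyl_function V U \<zeta> *v v) \<le> 2 * norm v"
proof -
  let ?m = "weyl_function V U \<zeta> *v v" and ?k = "exp (- 2 * mass 1) * (1 - exp (- 2 * \<bar>Im \<zeta>\<bar>))"
  have k: "?k \<ge> 0" by simp
  show ?thesis
  proof (cases "?m = 0")
    case False
    have "?k * (norm ?m)\<^sup>2 \<le> ?k * ((norm v)\<^sup>2 + (norm ?m)\<^sup>2)" using k by (intro mult_left_mono) auto
    also have "\<dots> \<le> 2 * (sgn (Im \<zeta>) * inner ?m (\<i> *s v))" by (rule weyl_function_herglotz[OF U d])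
    also have "\<dots> \<le> 2 * (norm ?m * norm v)"
    proof -
      have "\<bar>sgn (Im \<zeta>) * inner ?m (\<i> *s v)\<bar> \<le> 1 * (norm ?m * norm (\<i> *s v))"
        unfolding abs_mult by (intro mult_mono Cauchy_Schwarz_ineq2) (auto simp: sgn_if)
      then show ?thesis by (simp add: norm_i_smult)
    qed
    finally have "(?k * norm ?m) * norm ?m \<le> (2 * norm v) * norm ?m" by (simp add: power2_eq_square mult_ac)
    then show ?thesis using False by simp
  qed simp
qed

text \<open>The Wronskian of the Weyl solutions at \<open>\<zeta>\<close> and at its conjugate is constant and vanishes at the right
endpoint; its value at \<open>0\<close> is the difference of the two sesquilinear forms.\<close>

lemma weyl_function_symmetric:
  assumes U: "U \<in> unitary_matrices" and d: "char_det V U \<zeta> \<noteq> 0" "char_det V U (cnj \<zeta>) \<noteq> 0"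
  shows "weyl_function V U (cnj \<zeta>) = ctranspose (weyl_function V U \<zeta>)"
proof -
  let ?M = "weyl_function V U \<zeta>" and ?N = "weyl_function V U (cnj \<zeta>)"
  have eq: "inner (?N *v u) (\<i> *s v) = inner u (\<i> *s (?M *v v))" for u v
  proof -
    obtain y where y: "dirac_solution V \<zeta> (\<lambda>x. fst (y x)) (\<lambda>x. snd (y x))" "y 0 = weyl_init v (?M *v v)"
      "y 1 = solution (weyl_init v (?M *v v)) \<zeta> 1" using dirac_solution_exists by metis
    obtain z where z: "dirac_solution V (cnj \<zeta>) (\<lambda>x. fst (z x)) (\<lambda>x. snd (z x))" "z 0 = weyl_init u (?N *v u)"
      "z 1 = solution (weyl_init u (?N *v u)) (cnj \<zeta>) 1" using dirac_solution_exists by metis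
    from dirac_wronskian_constant[OF y(1) z(1)] show ?thesis
      unfolding y z weyl_init_wronskian weyl_function_boundary[OF U d(1)] weyl_function_boundary[OF U d(2)]
        unitary_inner[OF U] by simp
  qed
  have "inner (?N *v u) v = inner (ctranspose ?M *v u) v" for u v
  proof -
    have "v = \<i> *s ((-\<i>) *s v)" by (simp add: vec_eq_iff)
    then have "inner (?N *v u) v = inner (?N *v u) (\<i> *s ((-\<i>) *s v))" by simp
    also have "\<dots> = inner u (\<i> *s (?M *v ((-\<i>) *s v)))" by (rule eq)
    also have "\<i> *s (?M *v ((-\<i>) *s v)) = ?M *v v" by (simp only: vector_scalar_commute) (simp add: vec_eq_iff)
    finally show ?thesis by (simp add: inner_ctranspose)
  qed
  then have "?N *v u = ctranspose ?M *v u" for u by (metis vector_eq_rdot)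
  then show ?thesis by (simp add: matrix_eq)
qed

lemma weyl_solution_decay:
  assumes U: "U \<in> unitary_matrices" and I: "Im \<zeta> > 0"
  shows "norm (snd (solution (weyl_init v (weyl_function V U \<zeta> *v v)) \<zeta> 1)) * exp (Im \<zeta> - mass 1) \<le>
    norm v + norm (weyl_function V U \<zeta> *v v)"
proof -
  let ?c = "weyl_init v (weyl_function V U \<zeta> *v v)"
  obtain y where y: "dirac_solution V \<zeta> (\<lambda>x. fst (y x)) (\<lambda>x. snd (y x))" "y 0 = ?c" "y 1 = solution ?c \<zeta> 1"
    using dirac_solution_exists by metis
  have n: "norm (fst (y 1)) = norm (snd (y 1))"
    unfolding y weyl_function_boundary[OF U char_det_nonreal[OF U less_imp_neq[OF I, symmetric]]] unitary_norm[OF U] ..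
  have "norm (fst (y 1)) * exp (Im \<zeta> - mass 1) \<le> norm (fst (y 0))"
    by (rule upper_component_decay[OF y(1)]) (use I n in auto)
  also have "\<dots> \<le> norm v + norm (weyl_function V U \<zeta> *v v)" unfolding y by (rule norm_fst_weyl_init_le)
  finally show ?thesis unfolding n unfolding y .
qed

text \<open>The difference of the two Weyl solutions starts at \<open>J a\<^sup>* (m - n)\<close>, where both components have the same norm,
so its lower component grows by \<open>e\<^bsup>Im \<zeta> - mass 1\<^esup>\<close>. At the right endpoint each Weyl solution is smaller than
its initial value by the same factor.\<close>

lemma weyl_function_difference_decay:
  assumes U: "U \<in> unitary_matrices" "U' \<in> unitary_matrices" and I: "Im \<zeta> > 0"
  shows "norm ((weyl_function V U \<zeta> - weyl_function V U' \<zeta>) *v v) * exp (2 * (Im \<zeta> - mass 1)) \<le>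
    2 * (2 * norm v + norm (weyl_function V U \<zeta> *v v) + norm (weyl_function V U' \<zeta> *v v))"
proof -
  let ?m = "weyl_function V U \<zeta> *v v" and ?n = "weyl_function V U' \<zeta> *v v"
  let ?e = "exp (Im \<zeta> - mass 1)"
  have c: "weyl_init 0 (?m - ?n) = pair_smult 1 (weyl_init v ?m) + pair_smult (-1) (weyl_init v ?n)"
    by (simp add: weyl_init_def pair_smult_def prod_eq_iff vec_eq_iff algebra_simps)
  obtain y where y: "dirac_solution V \<zeta> (\<lambda>x. fst (y x)) (\<lambda>x. snd (y x))" "y 0 = weyl_init 0 (?m - ?n)"
    "y 1 = solution (weyl_init 0 (?m - ?n)) \<zeta> 1" using dirac_solution_exists by metis
  have eqn: "norm (fst (y 0)) = norm (snd (y 0))" unfolding y by (simp add: weyl_init_def)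
  have en: "norm (?m - ?n) \<le> 2 * norm (snd (y 0))"
  proof (rule power2_le_imp_le)
    have "(norm (snd (y 0)))\<^sup>2 + (norm (snd (y 0)))\<^sup>2 = (norm (?m - ?n))\<^sup>2"
      using weyl_init_energy[of 0 "?m - ?n"] eqn unfolding y by simp
    then have "(norm (?m - ?n))\<^sup>2 = 2 * (norm (snd (y 0)))\<^sup>2" by simp
    then show "(norm (?m - ?n))\<^sup>2 \<le> (2 * norm (snd (y 0)))\<^sup>2" unfolding power_mult_distrib by simp
  qed simp
  have "norm (snd (y 0)) * ?e \<le> norm (snd (y 1))"
    by (rule lower_component_growth[OF y(1)]) (use I eqn in auto)
  also have "y 1 = pair_smult 1 (solution (weyl_init v ?m) \<zeta> 1) + pair_smult (-1) (solution (weyl_init v ?n) \<zeta> 1)"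
    unfolding y c solution_lincomb ..
  also have "norm (snd \<dots>) \<le> norm (snd (solution (weyl_init v ?m) \<zeta> 1)) + norm (snd (solution (weyl_init v ?n) \<zeta> 1))"
    by (simp add: pair_smult_def norm_triangle_ineq4)
  finally have "norm (snd (y 0)) * ?e * ?e \<le> (norm (snd (solution (weyl_init v ?m) \<zeta> 1)) + norm (snd (solution (weyl_init v ?n) \<zeta> 1))) * ?e"
    by (intro mult_right_mono) auto
  also have "\<dots> \<le> (norm v + norm ?m) + (norm v + norm ?n)"
    unfolding distrib_right by (intro add_mono weyl_solution_decay U I)
  finally have f: "norm (snd (y 0)) * ?e * ?e \<le> (norm v + norm ?m) + (norm v + norm ?n)" .
  have "exp (2 * (Im \<zeta> - mass 1)) = ?e * ?e" by (simp only: exp_double power2_eq_square)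
  then have "2 * norm (snd (y 0)) * exp (2 * (Im \<zeta> - mass 1)) = 2 * (norm (snd (y 0)) * ?e * ?e)"
    by (simp only: mult_ac)
  also have "\<dots> \<le> 2 * ((norm v + norm ?m) + (norm v + norm ?n))" using f by (rule mult_left_mono) simp
  finally have "2 * norm (snd (y 0)) * exp (2 * (Im \<zeta> - mass 1)) \<le> 2 * ((norm v + norm ?m) + (norm v + norm ?n))" .
  moreover have "norm (?m - ?n) * exp (2 * (Im \<zeta> - mass 1)) \<le> 2 * norm (snd (y 0)) * exp (2 * (Im \<zeta> - mass 1))"
    by (intro mult_right_mono en) auto
  ultimately have "norm (?m - ?n) * exp (2 * (Im \<zeta> - mass 1)) \<le> 2 * ((norm v + norm ?m) + (norm v + norm ?n))"
    by (rule order_trans[rotated])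
  then show ?thesis unfolding matrix_vector_mult_diff_rdistrib by (simp add: algebra_simps)
qed

lemma holomorphic_bc_phi: "(\<lambda>\<zeta>. (b_mat U ** phi V 1 \<zeta>) $ i $ j) holomorphic_on UNIV"
proof -
  have "(\<lambda>\<zeta>. bc_form U (solution (weyl_init 0 (axis j 1)) \<zeta> 1) $ i) holomorphic_on UNIV"
    by (rule holomorphic_solution[OF bounded_linear_bc_form_nth])
      (use bc_form_lincomb[of U _ _ 0] in \<open>simp add: pair_smult_def\<close>)
  then show ?thesis unfolding bc_phi[symmetric] matrix_axis_nth .
qed

lemma holomorphic_bc_psi: "(\<lambda>\<zeta>. (b_mat U ** psi V 1 \<zeta>) $ i $ j) holomorphic_on UNIV"
proof -
  have "(\<lambda>\<zeta>. bc_form U (solution (weyl_init (axis j 1) 0) \<zeta> 1) $ i) holomorphic_on UNIV"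
    by (rule holomorphic_solution[OF bounded_linear_bc_form_nth])
      (use bc_form_lincomb[of U _ _ 0] in \<open>simp add: pair_smult_def\<close>)
  then show ?thesis unfolding bc_psi[symmetric] matrix_axis_nth .
qed

lemma holomorphic_char_det: "char_det V U holomorphic_on UNIV"
  unfolding char_det_def[abs_def] char_matrix_def by (intro holomorphic_on_det holomorphic_bc_phi)

lemma open_char_det_nonzero: "open (- {\<zeta>. char_det V U \<zeta> = 0})"
proof -
  have "closed {\<zeta> \<in> UNIV. char_det V U \<zeta> = 0}"
    by (rule continuous_closed_preimage_constant) (auto intro: holomorphic_on_imp_continuous_on holomorphic_char_det)
  then show ?thesis by (simp add: open_closed)
qed

text \<open>The numerator that Cramer's rule gives for an entry of the Weyl function over the denominator \<open>char_det\<close>.\<close>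

definition weyl_numerator where
  "weyl_numerator U i j \<zeta> = - (\<Sum>k\<in>UNIV. det (\<chi> i' j'. if j' = i then axis k 1 $ i' else char_matrix V U \<zeta> $ i' $ j') *
     (b_mat U ** psi V 1 \<zeta>) $ k $ j)"

lemma holomorphic_weyl_numerator: "weyl_numerator U i j holomorphic_on UNIV"
proof -
  have "(\<lambda>z. (\<chi> i' j'. if j' = i then axis k 1 $ i' else char_matrix V U z $ i' $ j') $ a $ b) holomorphic_on UNIV" for k a b
    by (cases "b = i") (auto simp: char_matrix_def intro!: holomorphic_bc_phi)
  then show ?thesis
    unfolding weyl_numerator_def[abs_def]
    by (intro holomorphic_intros holomorphic_on_det holomorphic_bc_psi)
qed

lemma weyl_function_eq_quotient:
  assumes "char_det V U \<zeta> \<noteq> 0"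
  shows "weyl_function V U \<zeta> $ i $ j = weyl_numerator U i j \<zeta> / char_det V U \<zeta>"
proof -
  have "weyl_function V U \<zeta> $ i $ j = - (\<Sum>k\<in>UNIV. matrix_inv (char_matrix V U \<zeta>) $ i $ k * (b_mat U ** psi V 1 \<zeta>) $ k $ j)"
    unfolding weyl_function_def char_matrix_def[symmetric] by (simp add: matrix_matrix_mult_def)
  then show ?thesis
    using assms unfolding char_det_def weyl_numerator_def
    by (simp add: matrix_inv_nth sum_divide_distrib)
qed

lemma holomorphic_weyl_function:
  "(\<lambda>\<zeta>. weyl_function V U \<zeta> $ i $ j) holomorphic_on - {\<zeta>. char_det V U \<zeta> = 0}"
proof (rule holomorphic_transform)
  show "(\<lambda>\<zeta>. weyl_numerator U i j \<zeta> / char_det V U \<zeta>) holomorphic_on - {\<zeta>. char_det V U \<zeta> = 0}"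
    by (intro holomorphic_on_divide holomorphic_on_subset[OF holomorphic_weyl_numerator]
        holomorphic_on_subset[OF holomorphic_char_det]) auto
qed (simp add: weyl_function_eq_quotient)

end

section \<open>Eigenvalues\<close>

context integrable_potential
begin

lemma eigenvalue_imp_char_det_0:
  assumes U: "U \<in> unitary_matrices" and z: "\<zeta> \<in> eigenvalues V U"
  shows "char_det V U \<zeta> = 0"
proof -
  obtain f where f: "f \<in> S_dom V U" "\<not> (AE x in lebesgue_on {0<..<1}. f x = 0)"
    "AE x in lebesgue_on {0<..<1}. S_op V f x = \<zeta> *s f x"
    using z unfolding eigenvalues_def by blast
  define y1 where "y1 = (\<lambda>x. upper (f x))"
  define y2 where "y2 = (\<lambda>x. lower (f x))"
  define d1 where "d1 = (\<lambda>x. vector_derivative y1 (at x))"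
  define d2 where "d2 = (\<lambda>x. vector_derivative y2 (at x))"
  have a: "ac_deriv y1 d1" "ac_deriv y2 d2"
    using f(1) unfolding S_dom_def d1_def d2_def y1_def y2_def by (auto intro: W11_imp_ac_deriv)
  have fj: "f = (\<lambda>x. join (y1 x) (y2 x))" by (simp add: y1_def y2_def)
  have "ac_deriv f (\<lambda>x. join (d1 x) (d2 x))" unfolding fj by (rule ac_deriv_join[OF a])
  then have n: "negligible ({x\<in>{0<..<1}. vector_derivative f (at x) \<noteq> join (d1 x) (d2 x)} \<union>
      {x\<in>{0<..<1}. S_op V f x \<noteq> \<zeta> *s f x})"
    using f(3) unfolding AE_lebesgue_on_01_iff by (intro negligible_Un ac_deriv_vector_derivative)
  have eq: "d1 x = (\<i> * \<zeta>) *s y1 x + (-\<i>) *s (V x *v y2 x) \<and>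
      d2 x = (- (\<i> * \<zeta>)) *s y2 x + \<i> *s (ctranspose (V x) *v y1 x)"
    if "vector_derivative f (at x) = join (d1 x) (d2 x)" "S_op V f x = \<zeta> *s f x" for x
    using that unfolding S_op_def dirac_equation_iff[symmetric] by (simp add: y1_def y2_def)
  have y: "dirac_solution V \<zeta> y1 y2"
    unfolding dirac_solution_def
    by (intro conjI ac_deriv_cong_AE[OF a(1)] ac_deriv_cong_AE[OF a(2)] negligible_subset[OF n])
      (use eq in blast)+
  have bc: "y1 0 = y2 0" "y1 1 = U *v y2 1" using f(1) by (auto simp: S_dom_def y1_def y2_def)
  have nz: "y1 0 \<noteq> 0"
  proof
    assume "y1 0 = 0"
    then have "(norm (y1 x))\<^sup>2 + (norm (y2 x))\<^sup>2 \<le> 0" if "x \<in> {0..1}" for x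
      using energy_le_initial[OF y that] bc(1) by simp
    then have "y1 x = 0 \<and> y2 x = 0" if "x \<in> {0..1}" for x
      using that by (metis add_nonneg_eq_0_iff antisym norm_eq_zero add_nonneg_nonneg zero_le_power2 power_eq_0_iff)
    then have "f x = 0" if "x \<in> {0<..<1}" for x
      using that unfolding fj by (simp add: join_eq_0_iff)
    then have "{x\<in>{0<..<1}. f x \<noteq> 0} = {}" by auto
    then have "negligible {x\<in>{0<..<1}. f x \<noteq> 0}" by (simp only: negligible_empty)
    then show False using f(2) unfolding AE_lebesgue_on_01_iff by blast
  qed
  \<comment> \<open>Chosen so that \<open>J a\<^sup>* c\<close> has both components equal to \<open>y1 0\<close>.\<close>
  define c where "c = (\<i> * sqrt 2) *s y1 0"
  have "weyl_init 0 c = (y1 0, y2 0)"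
  proof -
    have "(1 / sqrt 2) * (\<i> * (\<i> * sqrt 2)) = (-1::complex)" by (simp add: mult.assoc[symmetric])
    then show ?thesis by (simp add: weyl_init_def c_def bc(1)[symmetric] vec_eq_iff)
  qed
  then have "solution (weyl_init 0 c) \<zeta> 1 = (y1 1, y2 1)" using solution_eq_endpoint[OF y] by simp
  then show ?thesis unfolding char_det_eq_0_iff[OF U]
    using bc(2) nz by (intro exI[of _ c]) (simp add: c_def vector_mul_eq_0)
qed

lemma char_det_0_imp_eigenvalue:
  assumes U: "U \<in> unitary_matrices" and z: "char_det V U \<zeta> = 0"
  shows "\<zeta> \<in> eigenvalues V U"
proof -
  obtain c where c: "c \<noteq> 0" "fst (solution (weyl_init 0 c) \<zeta> 1) = U *v snd (solution (weyl_init 0 c) \<zeta> 1)"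
    using z unfolding char_det_eq_0_iff[OF U] by blast
  obtain y where y: "dirac_solution V \<zeta> (\<lambda>x. fst (y x)) (\<lambda>x. snd (y x))" "y 0 = weyl_init 0 c"
    "y 1 = solution (weyl_init 0 c) \<zeta> 1" using dirac_solution_exists by metis
  define f where "f = (\<lambda>x. join (fst (y x)) (snd (y x)))"
  define d1 where "d1 = (\<lambda>x. (\<i> * \<zeta>) *s fst (y x) + (-\<i>) *s (V x *v snd (y x)))"
  define d2 where "d2 = (\<lambda>x. (- (\<i> * \<zeta>)) *s snd (y x) + \<i> *s (ctranspose (V x) *v fst (y x)))"
  have a: "ac_deriv (\<lambda>x. fst (y x)) d1" "ac_deriv (\<lambda>x. snd (y x)) d2"
    using y(1) unfolding dirac_solution_def d1_def d2_def by auto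
  have i: "d1 absolutely_integrable_on {0..1}" "d2 absolutely_integrable_on {0..1}"
    unfolding d1_def d2_def by (intro absolutely_integrable_dirac_rhs[OF y(1)])+
  have W: "(\<lambda>x. upper (f x)) \<in> W11" "(\<lambda>x. lower (f x)) \<in> W11"
    unfolding f_def upper_join lower_join by (rule ac_deriv_imp_W11[OF a(1) i(1)], rule ac_deriv_imp_W11[OF a(2) i(2)])
  have fa: "ac_deriv f (\<lambda>x. join (d1 x) (d2 x))" unfolding f_def by (rule ac_deriv_join[OF a])
  have S: "S_op V f x = \<zeta> *s f x" if "vector_derivative f (at x) = join (d1 x) (d2 x)" for x
    unfolding S_op_def that unfolding f_def dirac_equation_iff by (simp add: d1_def d2_def)
  then have neg: "negligible {x\<in>{0<..<1}. S_op V f x \<noteq> \<zeta> *s f x}"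
    by (intro negligible_subset[OF ac_deriv_vector_derivative[OF fa]]) auto
  have fc: "continuous_on {0..1} (\<lambda>x. \<zeta> *s f x)"
    by (intro bounded_linear.continuous_on[OF bounded_linear_smult] ac_deriv_continuous_on[OF fa])
  have neg': "negligible ({x\<in>{0<..<1}. S_op V f x \<noteq> \<zeta> *s f x} \<union> {0,1})"
    using neg by (intro negligible_Un) auto
  have "S_op V f absolutely_integrable_on {0..1}"
    by (rule absolutely_integrable_spike[OF absolutely_integrable_continuous_real[OF fc] neg']) auto
  then have 1: "S_op V f \<in> Lp01 1" by (simp add: Lp01_1_iff)
  have "continuous_on {0..1} (\<lambda>x. (norm (\<zeta> *s f x))\<^sup>2)" by (intro continuous_intros fc)
  then have "(\<lambda>x. (norm (S_op V f x))\<^sup>2) absolutely_integrable_on {0..1}"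
    by (intro absolutely_integrable_spike[OF absolutely_integrable_continuous_real neg']) auto
  then have 2: "(\<lambda>x. (norm (S_op V f x))\<^sup>2) \<in> Lp01 1" by (simp add: Lp01_1_iff)
  have p2: "r powr 2 = r\<^sup>2" if "r \<ge> 0" for r :: real
    using that by (cases "r = 0") (auto simp: powr_numeral)
  have L2: "S_op V f \<in> Lp01 2"
    using 1 2 by (simp add: Lp01_def p2)
  have "f \<in> S_dom V U"
    using W L2 c(2) by (simp add: S_dom_def f_def y weyl_init_def)
  moreover have "\<not> (AE x in lebesgue_on {0<..<1}. f x = 0)"
  proof
    assume "AE x in lebesgue_on {0<..<1}. f x = 0"
    then have "negligible {x\<in>{0<..<1}. f x \<noteq> 0}" by (simp add: AE_lebesgue_on_01_iff)
    moreover have "f x \<noteq> 0" if x: "x \<in> {0<..<1}" for x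
    proof
      assume "f x = 0"
      then have "y x = (0, 0)" unfolding f_def join_eq_0_iff by (simp add: prod_eq_iff)
      then have "((norm (0::complex^'n))\<^sup>2 + (norm c)\<^sup>2) * exp (- (2 * (mass 1 + \<bar>Im \<zeta>\<bar> * x))) \<le> 0"
        using energy_ge_initial[OF y(1), of x] x unfolding y weyl_init_energy by simp
      then show False using c(1) by (simp add: mult_le_0_iff)
    qed
    then have "{x\<in>{0<..<1}. f x \<noteq> 0} = {0<..<1}" by auto
    ultimately have "negligible {0<..<1::real}" by simp
    then show False using open_not_negligible[of "{0<..<1::real}"] by auto
  qed
  moreover have "AE x in lebesgue_on {0<..<1}. S_op V f x = \<zeta> *s f x"
    using neg by (simp add: AE_lebesgue_on_01_iff)
  ultimately show ?thesis unfolding eigenvalues_def by blast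
qed

text \<open>The eigenvalues as real numbers.\<close>

definition spectrum :: "complex^'n^'n \<Rightarrow> real set" where
  "spectrum U = {x. char_det V U (of_real x) = 0}"

lemma eigenvalues_eq_spectrum:
  assumes "U \<in> unitary_matrices"
  shows "eigenvalues V U = of_real ` spectrum U"
proof -
  have "eigenvalues V U = {\<zeta>. char_det V U \<zeta> = 0}"
    using eigenvalue_imp_char_det_0[OF assms] char_det_0_imp_eigenvalue[OF assms] by blast
  also have "\<dots> = of_real ` spectrum U"
  proof
    show "{\<zeta>. char_det V U \<zeta> = 0} \<subseteq> of_real ` spectrum U"
    proof clarify
      fix \<zeta> assume z: "char_det V U \<zeta> = 0"
      then have "Im \<zeta> = 0" using char_det_nonreal[OF assms] by blast
      then have "\<zeta> = of_real (Re \<zeta>)" by (simp add: complex_eq_iff)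
      then show "\<zeta> \<in> of_real ` spectrum U" using z unfolding spectrum_def by (metis (mono_tags) imageI mem_Collect_eq)
    qed
  qed (auto simp: spectrum_def)
  finally show ?thesis .
qed

lemma char_det_0_iff_spectrum:
  assumes "U \<in> unitary_matrices"
  shows "char_det V U \<zeta> = 0 \<longleftrightarrow> Im \<zeta> = 0 \<and> Re \<zeta> \<in> spectrum U"
proof (cases "Im \<zeta> = 0")
  case True
  then have "of_real (Re \<zeta>) = \<zeta>" by (simp add: complex_eq_iff)
  then show ?thesis using True by (simp add: spectrum_def)
qed (use char_det_nonreal[OF assms] in auto)

lemma spectrum_locally_finite:
  assumes "U \<in> unitary_matrices"
  shows "finite (spectrum U \<inter> {a..b})"
proof (cases "char_det V U constant_on UNIV")
  case True
  then have "char_det V U z = char_det V U \<i>" for z by (auto simp: constant_on_def)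
  moreover have "char_det V U \<i> \<noteq> 0" by (rule char_det_nonreal[OF assms]) simp
  ultimately have "char_det V U z \<noteq> 0" for z by metis
  then have "spectrum U = {}" by (simp add: spectrum_def)
  then show ?thesis by simp
next
  case False
  have "finite {z \<in> of_real ` {a..b}. char_det V U z = 0}"
    by (rule holomorphic_compact_finite_zeros[OF holomorphic_char_det _ _ _ _ False])
      (auto intro!: compact_continuous_image continuous_intros)
  moreover have "of_real ` (spectrum U \<inter> {a..b}) \<subseteq> {z \<in> of_real ` {a..b}. char_det V U z = 0}"
    by (auto simp: spectrum_def)
  ultimately have "finite ((of_real :: real \<Rightarrow> complex) ` (spectrum U \<inter> {a..b}))" by (rule finite_subset[rotated])
  then show ?thesis by (rule finite_imageD) (auto intro: inj_onI)
qed

section \<open>Growth of the Weyl function on spectral gaps\<close>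

lemma weyl_function_diag_herglotz:
  assumes U: "U \<in> unitary_matrices" and d: "char_det V U \<zeta> \<noteq> 0"
  shows "exp (- 2 * mass 1) * (1 - exp (- 2 * \<bar>Im \<zeta>\<bar>)) * (1 + (cmod (weyl_function V U \<zeta> $ k $ k))\<^sup>2) \<le>
    2 * (sgn (Im \<zeta>) * Im (weyl_function V U \<zeta> $ k $ k))"
proof -
  let ?v = "axis k 1 :: complex^'n" and ?M = "weyl_function V U \<zeta>"
  have 1: "inner (?M *v ?v) (\<i> *s ?v) = Im (?M $ k $ k)"
    unfolding inner_i_smult[of "?M *v ?v"] inner_commute[of ?v] inner_smult inner_axis_complex
    by (simp add: matrix_axis_nth)
  have 2: "norm ?v = 1" by (rule norm_axis_1_complex)
  have "cmod (?M $ k $ k) \<le> norm (?M *v ?v)"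
    using Finite_Cartesian_Product.norm_nth_le[of "?M *v ?v" k] by (simp add: matrix_axis_nth)
  then have "(cmod (?M $ k $ k))\<^sup>2 \<le> (norm (?M *v ?v))\<^sup>2" by (intro power_mono) auto
  then have "exp (- 2 * mass 1) * (1 - exp (- 2 * \<bar>Im \<zeta>\<bar>)) * (1 + (cmod (?M $ k $ k))\<^sup>2) \<le>
      exp (- 2 * mass 1) * (1 - exp (- 2 * \<bar>Im \<zeta>\<bar>)) * ((norm ?v)\<^sup>2 + (norm (?M *v ?v))\<^sup>2)"
    unfolding 2 by (intro mult_left_mono add_mono) auto
  also have "\<dots> \<le> 2 * (sgn (Im \<zeta>) * inner (?M *v ?v) (\<i> *s ?v))" by (rule weyl_function_herglotz[OF U d])
  finally show ?thesis unfolding 1 .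
qed

lemma one_minus_exp_ge:
  fixes x :: real
  assumes "x \<ge> 0"
  shows "x / (1 + x) \<le> 1 - exp (- x)"
proof -
  have "exp (- x) \<le> 1 / (1 + x)"
    using exp_ge_add_one_self[of x] assms by (simp add: exp_minus divide_simps)
  moreover have "x / (1 + x) = 1 - 1 / (1 + x)" using assms by (simp add: divide_simps)
  ultimately show ?thesis by linarith
qed

text \<open>On the real axis outside the spectrum a diagonal entry \<open>m\<close> is real, so \<open>m'(x)\<close> is the limit of
\<open>Im m(x + i y) / y\<close>, which the Herglotz inequality bounds from below.\<close>

lemma weyl_function_diag_derivative:
  assumes U: "U \<in> unitary_matrices" and l: "x \<notin> spectrum U"
    and D: "((\<lambda>\<zeta>. weyl_function V U \<zeta> $ k $ k) has_field_derivative D) (at (of_real x))"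
  shows "exp (- 2 * mass 1) * (1 + (Re (weyl_function V U (of_real x) $ k $ k))\<^sup>2) \<le> Re D"
proof -
  define m where "m = (\<lambda>\<zeta>. weyl_function V U \<zeta> $ k $ k)"
  define p where "p = (\<lambda>y::real. of_real x + \<i> * of_real y)"
  have dl: "char_det V U (of_real x) \<noteq> 0" using l by (simp add: spectrum_def)
  have real: "Im (m (of_real x)) = 0"
  proof -
    have "weyl_function V U (of_real x) = ctranspose (weyl_function V U (of_real x))"
      using weyl_function_symmetric[OF U dl] dl by simp
    then have "m (of_real x) = cnj (m (of_real x))" unfolding m_def by (metis ctranspose_nth)
    then show ?thesis by (simp add: complex_eq_iff)
  qed
  have lim0: "filterlim (\<lambda>y::real. \<i> * of_real y) (at 0) (at_right 0)"
    unfolding filterlim_at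
  proof
    have "((\<lambda>y::real. \<i> * of_real y) \<longlongrightarrow> \<i> * of_real 0) (at_right 0)" by (intro tendsto_intros)
    then show "((\<lambda>y::real. \<i> * of_real y) \<longlongrightarrow> 0) (at_right 0)" by simp
    show "\<forall>\<^sub>F y::real in at_right 0. \<i> * of_real y \<in> UNIV \<and> \<i> * of_real y \<noteq> 0"
      by (auto simp: eventually_at_filter)
  qed
  have "((\<lambda>h. (m (of_real x + h) - m (of_real x)) / h) \<longlongrightarrow> D) (at 0)"
    using D[unfolded DERIV_def] unfolding m_def .
  from filterlim_compose[OF this lim0]
  have "((\<lambda>y. (m (p y) - m (of_real x)) / (\<i> * of_real y)) \<longlongrightarrow> D) (at_right 0)" by (simp add: p_def)
  from tendsto_Re[OF this]
  have L1: "((\<lambda>y. Im (m (p y)) / y) \<longlongrightarrow> Re D) (at_right 0)"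
  proof (rule Lim_transform_eventually)
    have "Re ((m (p y) - m (of_real x)) / (\<i> * of_real y)) = Im (m (p y)) / y" for y
    proof -
      have "w / (\<i> * of_real y) = (- \<i> * w) / of_real y" for w
        by (simp add: divide_simps)
      then show ?thesis by (simp add: real Re_divide_of_real)
    qed
    then show "\<forall>\<^sub>F y in at_right 0. Re ((m (p y) - m (of_real x)) / (\<i> * of_real y)) = Im (m (p y)) / y" by simp
  qed
  have "isCont m (of_real x)" using D unfolding m_def by (rule DERIV_isCont)
  moreover have "(p \<longlongrightarrow> of_real x + \<i> * of_real 0) (at_right 0)" unfolding p_def by (intro tendsto_intros)
  ultimately have mlim: "((\<lambda>y. m (p y)) \<longlongrightarrow> m (of_real x)) (at_right 0)"
    by (intro isCont_tendsto_compose[of _ m]) auto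
  have "((\<lambda>y. exp (- 2 * mass 1) * (1 / (1 + 2 * y)) * (1 + (cmod (m (p y)))\<^sup>2)) \<longlongrightarrow>
     exp (- 2 * mass 1) * (1 / (1 + 2 * 0)) * (1 + (cmod (m (of_real x)))\<^sup>2)) (at_right 0)"
    by (intro tendsto_intros mlim) auto
  moreover have "(cmod (m (of_real x)))\<^sup>2 = (Re (m (of_real x)))\<^sup>2" using real by (simp add: cmod_power2)
  ultimately have L2: "((\<lambda>y. exp (- 2 * mass 1) * (1 / (1 + 2 * y)) * (1 + (cmod (m (p y)))\<^sup>2)) \<longlongrightarrow>
     exp (- 2 * mass 1) * (1 + (Re (m (of_real x)))\<^sup>2)) (at_right 0)" by simp
  have "exp (- 2 * mass 1) * (1 / (1 + 2 * y)) * (1 + (cmod (m (p y)))\<^sup>2) \<le> Im (m (p y)) / y" if y: "y > 0" for y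
  proof -
    have Ip: "Im (p y) = y" by (simp add: p_def)
    then have d: "char_det V U (p y) \<noteq> 0" using y by (intro char_det_nonreal[OF U]) auto
    have "exp (- 2 * mass 1) * ((2 * y) / (1 + 2 * y)) * (1 + (cmod (m (p y)))\<^sup>2) \<le>
        exp (- 2 * mass 1) * (1 - exp (- (2 * y))) * (1 + (cmod (m (p y)))\<^sup>2)"
      using y by (intro mult_right_mono mult_left_mono one_minus_exp_ge) auto
    also have "\<dots> \<le> 2 * Im (m (p y))"
      using weyl_function_diag_herglotz[OF U d, of k] y unfolding Ip m_def by simp
    finally have "(2 * y) * (exp (- 2 * mass 1) * (1 / (1 + 2 * y)) * (1 + (cmod (m (p y)))\<^sup>2)) \<le> 2 * Im (m (p y))"
      by (simp add: mult_ac)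
    then have "2 * (y * (exp (- 2 * mass 1) * (1 / (1 + 2 * y)) * (1 + (cmod (m (p y)))\<^sup>2))) \<le> 2 * Im (m (p y))"
      by (simp only: mult.assoc)
    then have "y * (exp (- 2 * mass 1) * (1 / (1 + 2 * y)) * (1 + (cmod (m (p y)))\<^sup>2)) \<le> Im (m (p y))"
      by linarith
    then show ?thesis by (subst pos_le_divide_eq[OF y], subst mult.commute)
  qed
  then have "\<forall>\<^sub>F y in at_right 0. exp (- 2 * mass 1) * (1 / (1 + 2 * y)) * (1 + (cmod (m (p y)))\<^sup>2) \<le> Im (m (p y)) / y"
    by (auto simp: eventually_at_filter)
  from tendsto_le[OF _ L1 L2 this] show ?thesis by (simp add: m_def)
qed

text \<open>On a gap \<open>arctan m - e\<^bsup>-2 mass 1\<^esup> x\<close> is nondecreasing, and \<open>arctan\<close> has range of length \<open>\<pi>\<close>.\<close>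

lemma spectrum_gap:
  assumes U: "U \<in> unitary_matrices"
  shows "\<exists>x\<in>spectrum U. a \<le> x \<and> x \<le> a + pi * exp (2 * mass 1)"
proof (rule ccontr)
  assume no: "\<not> ?thesis"
  define k :: 'n where "k = undefined"
  define L where "L = pi * exp (2 * mass 1)"
  define m where "m = (\<lambda>\<zeta>. weyl_function V U \<zeta> $ k $ k)"
  define g where "g = (\<lambda>t::real. Re (m (of_real t)))"
  have "L > 0" by (simp add: L_def)
  let ?k = "exp (- 2 * mass 1)"
  have "\<exists>D. (g has_real_derivative D) (at t) \<and> ?k * (1 + (g t)\<^sup>2) \<le> D" if t: "a \<le> t" "t \<le> a + L" for t
  proof -
    have ns: "t \<notin> spectrum U" using no t unfolding L_def by auto
    have "of_real t \<in> - {\<zeta>. char_det V U \<zeta> = 0}" using ns by (simp add: spectrum_def)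
    then have "m field_differentiable at (of_real t)"
      unfolding m_def using holomorphic_on_imp_differentiable_at[OF holomorphic_weyl_function open_char_det_nonzero] by blast
    then obtain D where D: "(m has_field_derivative D) (at (of_real t))" unfolding field_differentiable_def by blast
    have "(g has_real_derivative Re D) (at t)"
    proof -
      have "((\<lambda>t::real. m (of_real t)) has_vector_derivative D) (at t)"
        by (rule has_vector_derivative_real_field[OF D])
      from bounded_linear.has_vector_derivative[OF bounded_linear_Re this] show ?thesis
        by (simp add: g_def has_real_derivative_iff_has_vector_derivative)
    qed
    moreover have "?k * (1 + (g t)\<^sup>2) \<le> Re D"
      using weyl_function_diag_derivative[OF U ns D[unfolded m_def]] by (simp add: g_def m_def)
    ultimately show ?thesis by blast
  qed
  then obtain D where D: "\<And>t. a \<le> t \<Longrightarrow> t \<le> a + L \<Longrightarrow> (g has_real_derivative D t) (at t)"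
    "\<And>t. a \<le> t \<Longrightarrow> t \<le> a + L \<Longrightarrow> ?k * (1 + (g t)\<^sup>2) \<le> D t" by metis
  have "arctan (g a) - ?k * a \<le> arctan (g (a + L)) - ?k * (a + L)"
  proof (rule DERIV_nonneg_imp_nondecreasing[where f = "\<lambda>t. arctan (g t) - ?k * t"])
    fix t assume t: "a \<le> t" "t \<le> a + L"
    have "((\<lambda>t. arctan (g t) - ?k * t) has_real_derivative (inverse (1 + (g t)\<^sup>2) * D t - ?k)) (at t)"
      by (auto intro!: derivative_eq_intros D(1) t)
    moreover have "0 < 1 + (g t)\<^sup>2" by (simp add: add_pos_nonneg)
    then have "0 \<le> inverse (1 + (g t)\<^sup>2) * D t - ?k"
      using D(2)[OF t] by (simp add: field_simps)
    ultimately show "\<exists>y. ((\<lambda>t. arctan (g t) - ?k * t) has_real_derivative y) (at t) \<and> 0 \<le> y" by blast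
  qed (use \<open>L > 0\<close> in auto)
  then have "?k * L \<le> arctan (g (a + L)) - arctan (g a)" by (simp add: algebra_simps)
  also have "\<dots> < pi" using arctan_ubound[of "g (a + L)"] arctan_lbound[of "g a"] by linarith
  also have "?k * L = pi" by (simp add: L_def exp_minus)
  finally show False by simp
qed

lemma spectrum_unbounded:
  assumes "U \<in> unitary_matrices"
  shows "\<exists>z\<in>spectrum U. b < z" "\<exists>z\<in>spectrum U. z < b"
proof -
  show "\<exists>z\<in>spectrum U. b < z" using spectrum_gap[OF assms, of "b + 1"] by force
  show "\<exists>z\<in>spectrum U. z < b" using spectrum_gap[OF assms, of "b - 1 - pi * exp (2 * mass 1)"] by force
qed

end

section \<open>Bounds on the characteristic determinant\<close>

lemma norm_det_le:
  fixes A :: "complex^'n^'n"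
  assumes "\<And>i j. cmod (A $ i $ j) \<le> K"
  shows "cmod (det A) \<le> fact CARD('n) * K ^ CARD('n)"
proof -
  have K: "0 \<le> K" using assms[of undefined undefined] norm_ge_zero order_trans by blast
  have "cmod (det A) \<le> (\<Sum>p\<in>{p. p permutes (UNIV::'n set)}. K ^ CARD('n))"
    unfolding det_def
  proof (rule sum_norm_le)
    fix p :: "'n \<Rightarrow> 'n"
    have "cmod (of_int (sign p) * (\<Prod>i\<in>UNIV. A $ i $ p i)) = (\<Prod>i\<in>UNIV. cmod (A $ i $ p i))"
      by (simp add: norm_mult prod_norm sign_def)
    also have "\<dots> \<le> (\<Prod>i\<in>(UNIV::'n set). K)" by (intro prod_mono) (auto simp: assms)
    finally show "cmod (of_int (sign p) * (\<Prod>i\<in>UNIV. A $ i $ p i)) \<le> K ^ CARD('n)" by simp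
  qed
  also have "\<dots> = fact CARD('n) * K ^ CARD('n)"
    by (simp add: card_permutations)
  finally show ?thesis .
qed

lemma norm_weyl_init: "norm (weyl_init v m) = sqrt ((norm v)\<^sup>2 + (norm m)\<^sup>2)"
  using weyl_init_energy[of v m] norm_Pair_power2[of "weyl_init v m"] by (metis norm_ge_zero real_sqrt_unique)

lemma norm_entry_le: "cmod (A $ i $ j) \<le> norm (A *v axis j 1)" for A :: "complex^'n^'m"
  by (metis Finite_Cartesian_Product.norm_nth_le matrix_axis_nth)

context integrable_potential
begin

lemma boundary_matrices_bounded:
  fixes U :: "complex^'n^'n"
  obtains K where "1 \<le> K" "\<And>\<zeta> i j. \<bar>Im \<zeta>\<bar> \<le> 2 \<Longrightarrow> cmod (char_matrix V U \<zeta> $ i $ j) \<le> K"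
    "\<And>\<zeta> i j. \<bar>Im \<zeta>\<bar> \<le> 2 \<Longrightarrow> cmod ((b_mat U ** psi V 1 \<zeta>) $ i $ j) \<le> K"
proof -
  have "\<exists>k\<ge>0. \<forall>y. cmod (bc_form U y $ i) \<le> norm y * k" for i
    using bounded_linear.nonneg_bounded[OF bounded_linear_bc_form_nth] .
  then obtain k where k: "\<And>i. 0 \<le> k i" "\<And>i y. cmod (bc_form U y $ i) \<le> norm y * k i" by metis
  define K where "K = exp (mass 1 + 2) * (\<Sum>i\<in>UNIV. k i) + 1"
  have le: "cmod (bc_form U (solution c \<zeta> 1) $ i) \<le> K" if "\<bar>Im \<zeta>\<bar> \<le> 2" "norm c = 1" for c \<zeta> i
  proof -
    have "cmod (bc_form U (solution c \<zeta> 1) $ i) \<le> norm (solution c \<zeta> 1) * k i" by (rule k(2))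
    also have "\<dots> \<le> exp (mass 1 + 2) * (\<Sum>i\<in>UNIV. k i)"
    proof (intro mult_mono)
      show "norm (solution c \<zeta> 1) \<le> exp (mass 1 + 2)"
      proof -
        have "norm (solution c \<zeta> 1) \<le> exp (mass 1 + \<bar>Im \<zeta>\<bar>)" using norm_solution_le[of c \<zeta>] that(2) by simp
        also have "\<dots> \<le> exp (mass 1 + 2)" using that(1) by simp
        finally show ?thesis .
      qed
      show "k i \<le> (\<Sum>i\<in>UNIV. k i)" by (rule member_le_sum) (auto simp: k)
    qed (auto simp: k)
    finally show ?thesis by (simp add: K_def)
  qed
  show ?thesis
  proof (rule that[of K])
    show "1 \<le> K" unfolding K_def using k(1) by (simp add: sum_nonneg)
    fix \<zeta> :: complex and i j :: 'n assume z: "\<bar>Im \<zeta>\<bar> \<le> 2"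
    show "cmod (char_matrix V U \<zeta> $ i $ j) \<le> K"
      using le[OF z, of "weyl_init 0 (axis j 1)" i]
      by (simp only: char_matrix_mult[symmetric] matrix_axis_nth norm_weyl_init norm_axis_1_complex) simp
    show "cmod ((b_mat U ** psi V 1 \<zeta>) $ i $ j) \<le> K"
      using le[OF z, of "weyl_init (axis j 1) 0" i]
      by (simp only: bc_psi[symmetric] matrix_axis_nth norm_weyl_init norm_axis_1_complex) simp
  qed
qed

lemma char_det_bounded:
  obtains B where "0 < B" "\<And>\<zeta>. \<bar>Im \<zeta>\<bar> \<le> 2 \<Longrightarrow> cmod (char_det V U \<zeta>) \<le> B"
proof -
  obtain K where K: "1 \<le> K" "\<And>\<zeta> i j. \<bar>Im \<zeta>\<bar> \<le> 2 \<Longrightarrow> cmod (char_matrix V U \<zeta> $ i $ j) \<le> K"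
    using boundary_matrices_bounded[of U] by metis
  show ?thesis
  proof (rule that)
    show "0 < fact CARD('n) * K ^ CARD('n)" using K(1) by simp
    show "cmod (char_det V U \<zeta>) \<le> fact CARD('n) * K ^ CARD('n)" if "\<bar>Im \<zeta>\<bar> \<le> 2" for \<zeta>
      unfolding char_det_def by (intro norm_det_le K(2) that)
  qed
qed

lemma weyl_numerator_bounded:
  obtains B where "0 < B" "\<And>\<zeta> i j. \<bar>Im \<zeta>\<bar> \<le> 2 \<Longrightarrow> cmod (weyl_numerator U i j \<zeta>) \<le> B"
proof -
  obtain K where K: "1 \<le> K" "\<And>\<zeta> i j. \<bar>Im \<zeta>\<bar> \<le> 2 \<Longrightarrow> cmod (char_matrix V U \<zeta> $ i $ j) \<le> K"
    "\<And>\<zeta> i j. \<bar>Im \<zeta>\<bar> \<le> 2 \<Longrightarrow> cmod ((b_mat U ** psi V 1 \<zeta>) $ i $ j) \<le> K"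
    using boundary_matrices_bounded[of U] by metis
  let ?B = "real CARD('n) * (fact CARD('n) * K ^ CARD('n) * K)"
  show ?thesis
  proof (rule that)
    show "0 < ?B" using K(1) by simp
    fix \<zeta> :: complex and i j :: 'n assume z: "\<bar>Im \<zeta>\<bar> \<le> 2"
    have "cmod (weyl_numerator U i j \<zeta>) \<le> (\<Sum>k\<in>(UNIV::'n set). fact CARD('n) * K ^ CARD('n) * K)"
      unfolding weyl_numerator_def norm_minus_cancel
    proof (rule sum_norm_le)
      fix k :: 'n
      have "cmod ((\<chi> i' j'. if j' = i then axis k 1 $ i' else char_matrix V U \<zeta> $ i' $ j') $ a $ b) \<le> K" for a b
        using K(1) K(2)[OF z, of a b] by (auto simp: axis_def)
      then have "cmod (det (\<chi> i' j'. if j' = i then axis k 1 $ i' else char_matrix V U \<zeta> $ i' $ j')) \<le> fact CARD('n) * K ^ CARD('n)"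
        by (rule norm_det_le)
      then show "cmod (det (\<chi> i' j'. if j' = i then axis k 1 $ i' else char_matrix V U \<zeta> $ i' $ j') *
         (b_mat U ** psi V 1 \<zeta>) $ k $ j) \<le> fact CARD('n) * K ^ CARD('n) * K"
        unfolding norm_mult using K(1) K(3)[OF z] by (intro mult_mono) auto
    qed
    then show "cmod (weyl_numerator U i j \<zeta>) \<le> ?B" by simp
  qed
qed

text \<open>On the line \<open>Im \<zeta> = 1\<close> the growth of the flux bounds \<open>\<bar>y\<^sub>2\<bar> - \<bar>y\<^sub>1\<bar>\<close> at the right endpoint from below, hence
also the boundary form. So the characteristic matrix has a uniformly bounded inverse, and the
determinant of that inverse is bounded.\<close>

lemma char_det_lower_bound:
  assumes U: "U \<in> unitary_matrices"
  obtains c where "0 < c" "\<And>t. c \<le> cmod (char_det V U (Complex t 1))"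
proof -
  define \<kappa> where "\<kappa> = exp (- 2 * mass 1) * (1 - exp (- 2))"
  define G where "G = sqrt 2 * norm (unitary_sqrt U) * (2 * exp (mass 1 + 1))"
  have "\<kappa> > 0" by (simp add: \<kappa>_def)
  have G0: "G \<ge> 0" by (simp add: G_def)
  have inj: "\<kappa> * norm c \<le> G * norm (char_matrix V U (Complex t 1) *v c)" for c t
  proof (cases "c = 0")
    case False
    let ?z = "Complex t 1"
    let ?y = "solution (weyl_init 0 c) ?z 1"
    let ?r = "fst ?y - U *v snd ?y"
    have r: "norm ?r \<le> sqrt 2 * norm (unitary_sqrt U) * norm (char_matrix V U ?z *v c)"
    proof -
      have "unitary_sqrt U *v (char_matrix V U ?z *v c) = (1 / sqrt 2) *s ?r"
        unfolding char_matrix_mult bc_form_def b_mat_mult_join[OF U] vector_scalar_commute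
        by (simp add: matrix_vector_mul_assoc unitary_sqrt_inverse[OF U])
      then have "norm (unitary_sqrt U *v (char_matrix V U ?z *v c)) = norm ((1 / sqrt 2) *s ?r)"
        by (rule arg_cong)
      also have "\<dots> = norm ?r / sqrt 2" unfolding norm_smult_vec by (simp add: norm_divide)
      finally have "norm (unitary_sqrt U *v (char_matrix V U ?z *v c)) = norm ?r / sqrt 2" .
      then have "norm ?r / sqrt 2 \<le> norm (unitary_sqrt U) * norm (char_matrix V U ?z *v c)"
        by (metis norm_matrix_vector_le)
      then show ?thesis by (simp add: field_simps)
    qed
    have n: "norm ?y \<le> exp (mass 1 + 1) * norm c"
      using norm_solution_le[of "weyl_init 0 c" ?z] by (simp add: norm_weyl_init)
    have fn: "norm (fst ?y) \<le> norm ?y" "norm (snd ?y) \<le> norm ?y"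
      using norm_fst_le[of "fst ?y" "snd ?y"] norm_snd_le[of "snd ?y" "fst ?y"] by simp_all
    have "\<kappa> * (norm c)\<^sup>2 \<le> (norm (snd ?y))\<^sup>2 - (norm (fst ?y))\<^sup>2"
      using solution_flux_growth[of ?z "weyl_init 0 c"]
      unfolding weyl_init_energy weyl_init_flux \<kappa>_def by simp
    also have "\<dots> = (norm (U *v snd ?y) - norm (fst ?y)) * (norm (snd ?y) + norm (fst ?y))"
      by (simp add: unitary_norm[OF U] power2_eq_square algebra_simps)
    also have "\<dots> \<le> norm ?r * (2 * norm ?y)"
    proof (rule mult_mono)
      show "norm (U *v snd ?y) - norm (fst ?y) \<le> norm ?r"
        using norm_triangle_ineq2[of "U *v snd ?y" "fst ?y"] by (simp add: norm_minus_commute)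
      show "norm (snd ?y) + norm (fst ?y) \<le> 2 * norm ?y" using fn by linarith
    qed auto
    also have "\<dots> \<le> (sqrt 2 * norm (unitary_sqrt U) * norm (char_matrix V U ?z *v c)) * (2 * (exp (mass 1 + 1) * norm c))"
      using r n by (intro mult_mono) auto
    also have "\<dots> = (G * norm (char_matrix V U ?z *v c)) * norm c" by (simp add: G_def mult_ac)
    finally have "(\<kappa> * norm c) * norm c \<le> (G * norm (char_matrix V U ?z *v c)) * norm c"
      by (simp add: power2_eq_square mult_ac)
    then show ?thesis using False by simp
  qed simp
  define Q where "Q = fact CARD('n) * (G / \<kappa>) ^ CARD('n) + 1"
  have "Q > 0" unfolding Q_def using G0 \<open>\<kappa> > 0\<close> by (intro add_nonneg_pos) auto
  show ?thesis
  proof (rule that[of "1 / Q"])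
    show "0 < 1 / Q" using \<open>Q > 0\<close> by simp
    fix t
    let ?E = "char_matrix V U (Complex t 1)"
    have d: "det ?E \<noteq> 0" using char_det_nonreal[OF U, of "Complex t 1"] by (simp add: char_det_def)
    have "cmod (matrix_inv ?E $ i $ j) \<le> G / \<kappa>" for i j
    proof -
      have "\<kappa> * norm (matrix_inv ?E *v axis j 1) \<le> G * norm (?E *v (matrix_inv ?E *v axis j 1))" by (rule inj)
      also have "?E *v (matrix_inv ?E *v axis j 1) = axis j 1"
        by (simp add: matrix_vector_mul_assoc matrix_inv_mult[OF d])
      finally have "norm (matrix_inv ?E *v axis j 1) \<le> G / \<kappa>"
        using \<open>\<kappa> > 0\<close> by (simp add: norm_axis_1_complex field_simps)
      then show ?thesis using norm_entry_le order_trans by blast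
    qed
    then have "cmod (det (matrix_inv ?E)) \<le> fact CARD('n) * (G / \<kappa>) ^ CARD('n)" by (rule norm_det_le)
    then have le: "cmod (det (matrix_inv ?E)) \<le> Q" by (simp add: Q_def)
    have "det ?E * det (matrix_inv ?E) = 1"
      unfolding det_mul[symmetric] matrix_inv_mult(1)[OF d] by simp
    then have "1 = cmod (det ?E) * cmod (det (matrix_inv ?E))" by (metis norm_mult norm_one)
    also have "\<dots> \<le> cmod (det ?E) * Q" using le by (intro mult_left_mono) auto
    finally show "1 / Q \<le> cmod (char_det V U (Complex t 1))"
      using \<open>Q > 0\<close> by (simp add: char_det_def field_simps)
  qed
qed

section \<open>Bounds on the Weyl function\<close>

lemma weyl_function_column_bound:
  assumes U: "U \<in> unitary_matrices" and I: "1 \<le> \<bar>Im \<zeta>\<bar>"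
  shows "norm (weyl_function V U \<zeta> *v axis j 1) \<le> 4 * exp (2 * mass 1)"
proof -
  let ?n = "norm (weyl_function V U \<zeta> *v axis j 1)"
  have d: "char_det V U \<zeta> \<noteq> 0" using I by (intro char_det_nonreal[OF U]) auto
  have "(2::real) \<le> exp 2" using exp_ge_add_one_self[of "2::real"] by linarith
  then have "exp (- 2::real) \<le> 1 / 2" by (simp add: exp_minus field_simps)
  moreover have "exp (- 2 * \<bar>Im \<zeta>\<bar>) \<le> exp (- 2)" using I by simp
  ultimately have h: "1 / 2 \<le> 1 - exp (- 2 * \<bar>Im \<zeta>\<bar>)" by linarith
  have "exp (- 2 * mass 1) * (1 / 2) * ?n \<le> exp (- 2 * mass 1) * (1 - exp (- 2 * \<bar>Im \<zeta>\<bar>)) * ?n"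
    by (intro mult_right_mono mult_left_mono h) auto
  also have "\<dots> \<le> 2" using weyl_function_norm_bound[OF U d, of "axis j 1"] by (simp add: norm_axis_1_complex)
  finally show ?thesis by (simp add: exp_minus field_simps)
qed

lemma weyl_function_entry_bound:
  assumes U: "U \<in> unitary_matrices" and I: "1 \<le> \<bar>Im \<zeta>\<bar>"
  shows "cmod (weyl_function V U \<zeta> $ i $ j) \<le> 4 * exp (2 * mass 1)"
  using weyl_function_column_bound[OF assms] norm_entry_le order_trans by blast

text \<open>The lower half-plane follows from the upper one by the symmetry of the Weyl function.\<close>

lemma weyl_function_difference_bound:
  assumes U: "U \<in> unitary_matrices" "U' \<in> unitary_matrices"
  obtains K where "0 < K" "\<And>\<zeta> i j. 1 \<le> \<bar>Im \<zeta>\<bar> \<Longrightarrow>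
    cmod (weyl_function V U \<zeta> $ i $ j - weyl_function V U' \<zeta> $ i $ j) * exp (2 * \<bar>Im \<zeta>\<bar>) \<le> K"
proof -
  define K where "K = exp (2 * mass 1) * (2 * (2 + 8 * exp (2 * mass 1)))"
  have up: "cmod (weyl_function V U \<zeta> $ i $ j - weyl_function V U' \<zeta> $ i $ j) * exp (2 * Im \<zeta>) \<le> K"
    if I: "1 \<le> Im \<zeta>" for \<zeta> i j
  proof -
    let ?A = "weyl_function V U \<zeta> - weyl_function V U' \<zeta>"
    have "cmod (?A $ i $ j) * exp (2 * (Im \<zeta> - mass 1)) \<le> norm (?A *v axis j 1) * exp (2 * (Im \<zeta> - mass 1))"
      by (intro mult_right_mono norm_entry_le) auto
    also have "\<dots> \<le> 2 * (2 * 1 + norm (weyl_function V U \<zeta> *v axis j 1) + norm (weyl_function V U' \<zeta> *v axis j 1))"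
      using weyl_function_difference_decay[OF U, of \<zeta> "axis j 1"] I by (simp add: norm_axis_1_complex)
    also have "\<dots> \<le> 2 * (2 * 1 + 4 * exp (2 * mass 1) + 4 * exp (2 * mass 1))"
      using I by (intro mult_left_mono add_mono weyl_function_column_bound U) auto
    finally have le: "cmod (?A $ i $ j) * exp (2 * (Im \<zeta> - mass 1)) \<le> 2 * (2 + 8 * exp (2 * mass 1))" by simp
    have e: "exp (2 * Im \<zeta>) = exp (2 * mass 1) * exp (2 * (Im \<zeta> - mass 1))"
      by (simp add: exp_add[symmetric] algebra_simps)
    have "cmod (?A $ i $ j) * exp (2 * Im \<zeta>) = exp (2 * mass 1) * (cmod (?A $ i $ j) * exp (2 * (Im \<zeta> - mass 1)))"
      unfolding e by (simp only: mult_ac)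
    also have "\<dots> \<le> K" unfolding K_def by (intro mult_left_mono le) auto
    finally show ?thesis by simp
  qed
  show ?thesis
  proof (rule that[of K])
    show "0 < K" by (simp add: K_def add_pos_pos)
    fix \<zeta> :: complex and i j :: 'n assume I: "1 \<le> \<bar>Im \<zeta>\<bar>"
    show "cmod (weyl_function V U \<zeta> $ i $ j - weyl_function V U' \<zeta> $ i $ j) * exp (2 * \<bar>Im \<zeta>\<bar>) \<le> K"
    proof (cases "Im \<zeta> \<ge> 0")
      case True
      then show ?thesis using up[of \<zeta> i j] I by simp
    next
      case False
      have nz: "Im \<zeta> \<noteq> 0" "Im (cnj \<zeta>) \<noteq> 0" using False by auto
      have s: "weyl_function V W (cnj \<zeta>) $ j $ i = cnj (weyl_function V W \<zeta> $ i $ j)" if "W \<in> unitary_matrices" for W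
        using weyl_function_symmetric[OF that char_det_nonreal[OF that nz(1)] char_det_nonreal[OF that nz(2)]]
        by (simp add: ctranspose_nth)
      have "cmod (weyl_function V U (cnj \<zeta>) $ j $ i - weyl_function V U' (cnj \<zeta>) $ j $ i) * exp (2 * Im (cnj \<zeta>)) \<le> K"
        using False I by (intro up) simp
      then show ?thesis unfolding s[OF U(1)] s[OF U(2)] complex_cnj_diff[symmetric] complex_mod_cnj
        using False by simp
    qed
  qed
qed

section \<open>Residues of the Weyl function\<close>

lemma spectrum_isolated:
  assumes U: "U \<in> unitary_matrices"
  obtains r where "r > 0" "\<And>w. w \<in> ball (of_real x) r - {of_real x} \<Longrightarrow> char_det V U w \<noteq> 0"
proof -
  obtain d where d: "d > 0" "\<And>y. y \<in> spectrum U \<inter> {x-1..x+1} \<Longrightarrow> y \<noteq> x \<Longrightarrow> d \<le> dist x y"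
    using finite_set_avoid[OF spectrum_locally_finite[OF U], of "x-1" "x+1" x] by blast
  show ?thesis
  proof (rule that[of "min d 1"])
    fix w assume w: "w \<in> ball (of_real x) (min d 1) - {complex_of_real x}"
    show "char_det V U w \<noteq> 0"
    proof
      assume "char_det V U w = 0"
      then have *: "Im w = 0" "Re w \<in> spectrum U" using char_det_0_iff_spectrum[OF U] by auto
      then have wr: "w = of_real (Re w)" by (simp add: complex_eq_iff)
      have "dist (complex_of_real x) (of_real (Re w)) < min d 1" using w wr by (metis DiffD1 mem_ball)
      then have "\<bar>x - Re w\<bar> < d" "\<bar>x - Re w\<bar> < 1" by (auto simp: dist_of_real dist_real_def)
      moreover have "Re w \<noteq> x" using w wr by (metis Diff_iff insertI1)
      moreover have "x - 1 \<le> Re w" "Re w \<le> x + 1" using \<open>\<bar>x - Re w\<bar> < 1\<close> by linarith+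
      ultimately show False using d(2)[of "Re w"] *(2) by (auto simp: dist_real_def)
    qed
  qed (use d in auto)
qed

lemma vertical_approach: "filterlim (\<lambda>y. of_real x + \<i> * of_real (s * y)) (at (of_real x)) (at_right 0)"
  if "s \<noteq> 0" for x s :: real
  unfolding filterlim_at
proof
  have "((\<lambda>y. of_real x + \<i> * of_real (s * y)) \<longlongrightarrow> of_real x + \<i> * of_real (s * 0)) (at_right 0)"
    by (intro tendsto_intros)
  then show "((\<lambda>y. of_real x + \<i> * of_real (s * y)) \<longlongrightarrow> of_real x) (at_right 0)" by simp
  show "\<forall>\<^sub>F y in at_right 0. of_real x + \<i> * of_real (s * y) \<in> UNIV \<and> of_real x + \<i> * of_real (s * y) \<noteq> of_real x"
    using that by (auto simp: eventually_at_filter)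
qed

abbreviation weyl_residue :: "complex^'n^'n \<Rightarrow> real \<Rightarrow> complex^'n^'n" where
  "weyl_residue U x \<equiv> matrix_residue (weyl_function V U) (complex_of_real x)"

text \<open>Poles of the Weyl function are at most simple: as a quotient of entire functions \<open>(w - x) M(w)\<close> has no
essential singularity at \<open>x\<close>, and it has no pole because the Herglotz inequality bounds it along the
vertical line through \<open>x\<close>.\<close>

lemma weyl_function_residue_limit:
  assumes U: "U \<in> unitary_matrices"
  shows "((\<lambda>w. weyl_function V U w $ i $ j * (w - of_real x)) \<longlongrightarrow>
    weyl_residue U x $ i $ j) (at (of_real x))"
proof -
  let ?x = "complex_of_real x"
  let ?f = "\<lambda>w. weyl_function V U w $ i $ j"
  obtain r where r: "r > 0" "\<And>w. w \<in> ball ?x r - {?x} \<Longrightarrow> char_det V U w \<noteq> 0"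
    using spectrum_isolated[OF U] by metis
  define g where "g = (\<lambda>w. (weyl_numerator U i j w * (w - ?x)) / char_det V U w)"
  have fg: "?f w * (w - ?x) = g w" if "w \<in> ball ?x r - {?x}" for w
    using r(2)[OF that] by (simp add: weyl_function_eq_quotient g_def)
  have ev: "\<forall>\<^sub>F w in at ?x. ?f w * (w - ?x) = g w"
    using r(1) fg by (auto simp: eventually_at dist_commute intro!: exI[of _ r])
  have an: "(\<lambda>w. weyl_numerator U i j w * (w - ?x)) analytic_on {?x}" "char_det V U analytic_on {?x}"
    using holomorphic_on_imp_analytic_at[OF holomorphic_weyl_numerator[of U i j], of ?x]
      holomorphic_on_imp_analytic_at[OF holomorphic_char_det[of U], of ?x]
    by (auto intro!: analytic_intros)
  have ness: "not_essential g ?x"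
    unfolding g_def by (intro not_essential_divide not_essential_analytic isolated_singularity_at_analytic an)
  have nopole: "\<not> is_pole g ?x"
  proof
    assume "is_pole g ?x"
    then have "filterlim g at_infinity (at ?x)" by (simp add: is_pole_def)
    then have "filterlim (\<lambda>w. ?f w * (w - ?x)) at_infinity (at ?x)"
      using filterlim_cong[OF refl refl ev] by simp
    then have "filterlim (\<lambda>y::real. ?f (?x + \<i> * of_real (1 * y)) * ((?x + \<i> * of_real (1 * y)) - ?x)) at_infinity (at_right 0)"
      by (rule filterlim_compose) (rule vertical_approach, simp)
    then have "\<forall>\<^sub>F y in at_right 0. 4 * exp (2 * mass 1) \<le> norm (?f (?x + \<i> * of_real (1 * y)) * ((?x + \<i> * of_real (1 * y)) - ?x))"
      unfolding filterlim_at_infinity[OF order_refl] by (simp add: add_pos_pos)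
    moreover have "\<forall>\<^sub>F y::real in at_right 0. 0 < y \<and> y < 1/2"
      unfolding eventually_at_right_field by (intro exI[of _ "1/2"]) auto
    ultimately have "\<forall>\<^sub>F y::real in at_right 0. False"
    proof eventually_elim
      case (elim y)
      let ?z = "?x + \<i> * of_real y"
      have d: "char_det V U ?z \<noteq> 0" using elim by (intro char_det_nonreal[OF U]) simp
      have "exp (- 2 * mass 1) * ((2 * y) / (1 + 2 * y)) * norm (weyl_function V U ?z *v axis j 1) \<le> 
         exp (- 2 * mass 1) * (1 - exp (- (2 * y))) * norm (weyl_function V U ?z *v axis j 1)"
        using elim by (intro mult_right_mono mult_left_mono one_minus_exp_ge) auto
      also have "\<dots> \<le> 2"
        using weyl_function_norm_bound[OF U d, of "axis j 1"] elim by (simp add: norm_axis_1_complex)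
      finally have h: "exp (- 2 * mass 1) * ((2 * y) / (1 + 2 * y)) * norm (weyl_function V U ?z *v axis j 1) \<le> 2" .
      have a: "exp (2 * mass 1) * exp (- 2 * mass 1) = 1" by (simp add: exp_add[symmetric])
      have b: "(1 + 2 * y) * ((2 * y) / (1 + 2 * y)) = 2 * y" using elim by simp
      have "(2 * y) * norm (weyl_function V U ?z *v axis j 1) =
          (exp (2 * mass 1) * exp (- 2 * mass 1)) * ((1 + 2 * y) * ((2 * y) / (1 + 2 * y))) * norm (weyl_function V U ?z *v axis j 1)"
        unfolding a b by simp
      also have "\<dots> = (exp (2 * mass 1) * (1 + 2 * y)) * (exp (- 2 * mass 1) * ((2 * y) / (1 + 2 * y)) * norm (weyl_function V U ?z *v axis j 1))"
        by (simp only: mult_ac)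
      also have "\<dots> \<le> (exp (2 * mass 1) * (1 + 2 * y)) * 2" using elim by (intro mult_left_mono h) auto
      finally have "y * norm (weyl_function V U ?z *v axis j 1) \<le> exp (2 * mass 1) * (1 + 2 * y)"
        by (simp add: algebra_simps)
      also have "\<dots> < exp (2 * mass 1) * 4" using elim by (intro mult_strict_left_mono) auto
      finally have "y * norm (weyl_function V U ?z *v axis j 1) < 4 * exp (2 * mass 1)" by simp
      moreover have "y * cmod (?f ?z) \<le> y * norm (weyl_function V U ?z *v axis j 1)"
        using elim by (intro mult_left_mono norm_entry_le) auto
      moreover have "4 * exp (2 * mass 1) \<le> y * cmod (?f ?z)" using elim by (simp add: norm_mult mult_ac)
      ultimately show False by linarith
    qed
    then show False by (simp add: eventually_False trivial_limit_at_right_real)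
  qed
  obtain c where c: "(g \<longlongrightarrow> c) (at ?x)" using ness nopole unfolding not_essential_def by blast
  then have lim: "((\<lambda>w. ?f w * (w - ?x)) \<longlongrightarrow> c) (at ?x)"
    using filterlim_cong[OF refl refl ev] by blast
  have "residue ?f ?x = c"
  proof (rule residue_simple'[OF open_ball _ _ lim])
    show "?x \<in> ball ?x r" using r by simp
    show "?f holomorphic_on ball ?x r - {?x}"
      by (rule holomorphic_on_subset[OF holomorphic_weyl_function]) (use r in auto)
  qed
  then show ?thesis using lim by (simp add: matrix_residue_def)
qed

lemma weyl_function_residue_vertical:
  assumes U: "U \<in> unitary_matrices" and s: "s \<noteq> 0"
  shows "((\<lambda>y. weyl_function V U (of_real x + \<i> * of_real (s * y)) $ i $ j * (\<i> * of_real (s * y))) \<longlongrightarrow>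
    weyl_residue U x $ i $ j) (at_right 0)"
  using filterlim_compose[OF weyl_function_residue_limit[OF U] vertical_approach[OF s]] by simp

lemma residue_hermitian:
  assumes U: "U \<in> unitary_matrices"
  shows "weyl_residue U x $ j $ i = cnj (weyl_residue U x $ i $ j)"
proof -
  let ?R = "weyl_residue U x"
  have "((\<lambda>y. cnj (weyl_function V U (of_real x + \<i> * of_real (1 * y)) $ i $ j * (\<i> * of_real (1 * y)))) \<longlongrightarrow> cnj (?R $ i $ j)) (at_right 0)"
    by (intro tendsto_cnj weyl_function_residue_vertical U) simp
  moreover have "\<forall>\<^sub>F y::real in at_right 0. cnj (weyl_function V U (of_real x + \<i> * of_real (1 * y)) $ i $ j * (\<i> * of_real (1 * y))) =
      weyl_function V U (of_real x + \<i> * of_real (-1 * y)) $ j $ i * (\<i> * of_real (-1 * y))"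
  proof -
    have "cnj (weyl_function V U (of_real x + \<i> * of_real (1 * y)) $ i $ j * (\<i> * of_real (1 * y))) =
      weyl_function V U (of_real x + \<i> * of_real (-1 * y)) $ j $ i * (\<i> * of_real (-1 * y))" if "y > 0" for y :: real
    proof -
      let ?z = "of_real x + \<i> * of_real y"
      have "weyl_function V U (cnj ?z) = ctranspose (weyl_function V U ?z)"
        using that by (intro weyl_function_symmetric[OF U] char_det_nonreal[OF U]) auto
      then show ?thesis by (simp add: ctranspose_nth)
    qed
    then show ?thesis by (auto simp: eventually_at_filter)
  qed
  ultimately have "((\<lambda>y. weyl_function V U (of_real x + \<i> * of_real (-1 * y)) $ j $ i * (\<i> * of_real (-1 * y))) \<longlongrightarrow> cnj (?R $ i $ j)) (at_right 0)"
    by (rule Lim_transform_eventually)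
  moreover have "((\<lambda>y. weyl_function V U (of_real x + \<i> * of_real (-1 * y)) $ j $ i * (\<i> * of_real (-1 * y))) \<longlongrightarrow> ?R $ j $ i) (at_right 0)"
    by (rule weyl_function_residue_vertical[OF U]) simp
  ultimately show ?thesis using tendsto_unique[OF trivial_limit_at_right_real] by blast
qed

text \<open>On the vertical line through \<open>x\<close> the residue is the limit of \<open>i y M(x + i y)\<close>, and
\<open>Re \<langle>i y M v, v\<rangle> = - y Im \<langle>M v, v\<rangle> \<le> 0\<close>.\<close>

lemma residue_form_nonpos:
  assumes U: "U \<in> unitary_matrices"
  shows "inner (weyl_residue U x *v v) v \<le> 0"
proof -
  let ?R = "weyl_residue U x"
  let ?z = "\<lambda>y::real. of_real x + \<i> * of_real (1 * y)"
  have "((\<lambda>y. \<chi> i. \<Sum>j\<in>UNIV. weyl_function V U (?z y) $ i $ j * (\<i> * of_real (1 * y)) * v $ j) \<longlongrightarrow>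
     (\<chi> i. \<Sum>j\<in>UNIV. ?R $ i $ j * v $ j)) (at_right 0)"
    by (intro vec_tendstoI, unfold vec_lambda_beta)
      (intro tendsto_sum tendsto_mult tendsto_const weyl_function_residue_vertical[OF U], simp)
  then have "((\<lambda>y. inner (\<chi> i. \<Sum>j\<in>UNIV. weyl_function V U (?z y) $ i $ j * (\<i> * of_real (1 * y)) * v $ j) v) \<longlongrightarrow>
     inner (\<chi> i. \<Sum>j\<in>UNIV. ?R $ i $ j * v $ j) v) (at_right 0)"
    by (intro tendsto_inner tendsto_const)
  moreover have "inner (\<chi> i. \<Sum>j\<in>UNIV. weyl_function V U (?z y) $ i $ j * (\<i> * of_real (1 * y)) * v $ j) v \<le> 0" if y: "y > 0" for y
  proof -
    have d: "char_det V U (?z y) \<noteq> 0" using y by (intro char_det_nonreal[OF U]) simp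
    have "(\<chi> i. \<Sum>j\<in>UNIV. weyl_function V U (?z y) $ i $ j * (\<i> * of_real (1 * y)) * v $ j) = (\<i> * of_real y) *s (weyl_function V U (?z y) *v v)"
      by (simp add: vec_eq_iff matrix_vector_mult_def sum_distrib_left mult_ac)
    moreover have "inner ((\<i> * of_real y) *s (weyl_function V U (?z y) *v v)) v = - y * inner (weyl_function V U (?z y) *v v) (\<i> *s v)"
    proof -
      have "cnj (\<i> * of_real y) *s v = (- y) *\<^sub>R (\<i> *s v)" by (simp add: scaleR_eq_smult vec_eq_iff)
      then show ?thesis unfolding inner_smult by simp
    qed
    moreover have "0 \<le> inner (weyl_function V U (?z y) *v v) (\<i> *s v)"
    proof -
      have "0 \<le> exp (- 2 * mass 1) * (1 - exp (- 2 * \<bar>Im (?z y)\<bar>)) * ((norm v)\<^sup>2 + (norm (weyl_function V U (?z y) *v v))\<^sup>2)" by simp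
      also have "\<dots> \<le> 2 * (sgn (Im (?z y)) * inner (weyl_function V U (?z y) *v v) (\<i> *s v))"
        by (rule weyl_function_herglotz[OF U d])
      finally show ?thesis using y by simp
    qed
    ultimately show ?thesis using y by (simp add: mult_nonneg_nonneg)
  qed
  then have "\<forall>\<^sub>F y in at_right 0. inner (\<chi> i. \<Sum>j\<in>UNIV. weyl_function V U (?z y) $ i $ j * (\<i> * of_real (1 * y)) * v $ j) v \<le> 0"
    by (auto simp: eventually_at_filter)
  ultimately have "inner (\<chi> i. \<Sum>j\<in>UNIV. ?R $ i $ j * v $ j) v \<le> 0"
    by (rule tendsto_upperbound) (rule trivial_limit_at_right_real)
  then show ?thesis by (simp add: matrix_vector_mult_def)
qed

text \<open>The diagonal entries of the norming matrix. They are nonnegative and control all other entries.\<close>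

definition residue_weight :: "complex^'n^'n \<Rightarrow> real \<Rightarrow> 'n \<Rightarrow> real" where
  "residue_weight U x i = - Re (weyl_residue U x $ i $ i)"

lemma inner_axis_combination:
  fixes R :: "complex^'n^'n"
  shows "inner (R *v (axis i 1 + c *s axis j 1)) (axis i 1 + c *s axis j 1) =
    Re (R $ i $ i + c * R $ i $ j) + Re ((R $ j $ i + c * R $ j $ j) * cnj c)"
proof -
  have "R *v (axis i 1 + c *s axis j 1) = R *v axis i 1 + c *s (R *v axis j 1)"
    by (simp only: matrix_vector_right_distrib vector_scalar_commute)
  then have "inner (R *v (axis i 1 + c *s axis j 1)) (axis i 1 + c *s axis j 1) =
    inner (R *v axis i 1 + c *s (R *v axis j 1)) (axis i 1) + inner (cnj c *s (R *v axis i 1 + c *s (R *v axis j 1))) (axis j 1)"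
    unfolding inner_smult[of "cnj c"] by (simp add: inner_add_right)
  also have "\<dots> = Re (R $ i $ i + c * R $ i $ j) + Re (cnj c * (R $ j $ i + c * R $ j $ j))"
    unfolding inner_axis_complex vector_add_component vector_smult_component matrix_axis_nth ..
  finally show ?thesis by (simp only: mult.commute[of "cnj c"])
qed

lemma residue_weight_nonneg:
  assumes U: "U \<in> unitary_matrices" shows "0 \<le> residue_weight U x i"
  using residue_form_nonpos[OF U, of x "axis i 1 + 0 *s axis i 1"]
  unfolding inner_axis_combination by (simp add: residue_weight_def)

text \<open>Positivity of the form on \<open>e\<^sub>i + c e\<^sub>j\<close>, where the unimodular \<open>c\<close> aligns the off-diagonal entry.\<close>

lemma residue_entry_le_weight:
  assumes U: "U \<in> unitary_matrices"
  shows "cmod (weyl_residue U x $ i $ j) \<le> residue_weight U x i + residue_weight U x j"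
proof -
  let ?R = "weyl_residue U x"
  show ?thesis
  proof (cases "?R $ i $ j = 0")
    case True
    then show ?thesis using residue_weight_nonneg[OF U] by simp
  next
    case False
    define c where "c = cnj (?R $ i $ j) / of_real (cmod (?R $ i $ j))"
    have n: "cnj (?R $ i $ j) * ?R $ i $ j = of_real (cmod (?R $ i $ j)) * of_real (cmod (?R $ i $ j))"
      using complex_norm_square[of "?R $ i $ j"] by (simp add: power2_eq_square mult.commute)
    have c1: "c * cnj c = 1"
      using False n by (simp add: c_def)
    have cR: "c * ?R $ i $ j = of_real (cmod (?R $ i $ j))"
      using False n by (simp add: c_def)
    have "inner (?R *v (axis i 1 + c *s axis j 1)) (axis i 1 + c *s axis j 1) \<le> 0" by (rule residue_form_nonpos[OF U])
    moreover have "(?R $ j $ i + c * ?R $ j $ j) * cnj c = cnj (c * ?R $ i $ j) + (c * cnj c) * ?R $ j $ j"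
      unfolding residue_hermitian[OF U, of x j i] by (simp add: algebra_simps)
    ultimately have "Re (?R $ i $ i) + cmod (?R $ i $ j) + (cmod (?R $ i $ j) + Re (?R $ j $ j)) \<le> 0"
      unfolding inner_axis_combination cR c1 by simp
    then show ?thesis unfolding residue_weight_def using norm_ge_zero[of "?R $ i $ j"] by linarith
  qed
qed

end

section \<open>Enumerating discrete sets\<close>

text \<open>Iterate the map sending \<open>x\<close> to the next element of \<open>A\<close> after \<open>x\<close>. An element missed by the iteration would
leave infinitely many elements below it.\<close>

lemma enumerate_locally_finite:
  fixes A :: "real set"
  assumes fin: "\<And>b. finite (A \<inter> {..b})" and unb: "\<And>b. \<exists>z\<in>A. b < z"
  obtains p :: "nat \<Rightarrow> real" where "strict_mono p" "range p = A"
proof -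
  define P where "P = (\<lambda>x z. z \<in> A \<and> x < z \<and> (\<forall>w\<in>A. x < w \<longrightarrow> z \<le> w))"
  have "\<exists>z. P x z" for x
  proof -
    obtain b where b: "b \<in> A" "x < b" using unb by blast
    let ?S = "A \<inter> {..b} \<inter> {x<..}"
    have S: "finite ?S" "?S \<noteq> {}" using fin[of b] b by auto
    have "Min ?S \<in> ?S" using S by (rule Min_in)
    moreover have "Min ?S \<le> w" if "w \<in> A" "x < w" for w
    proof (cases "w \<le> b")
      case True
      then show ?thesis using that S by (intro Min_le) auto
    next
      case False
      have "Min ?S \<le> b" using S b by (intro Min_le) auto
      then show ?thesis using False by simp
    qed
    ultimately have "P x (Min ?S)" unfolding P_def by auto
    then show ?thesis by blast
  qed
  then obtain nxt where nxt: "\<And>x. P x (nxt x)" by metis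
  obtain a where a: "\<And>z. z \<in> A \<Longrightarrow> a < z"
  proof -
    obtain b where "b \<in> A" using unb by blast
    have f: "finite (A \<inter> {..b})" by (rule fin)
    have ne: "A \<inter> {..b} \<noteq> {}" using \<open>b \<in> A\<close> by auto
    have "Min (A \<inter> {..b}) - 1 < z" if "z \<in> A" for z
    proof (cases "z \<le> b")
      case True
      then have "Min (A \<inter> {..b}) \<le> z" using that f by (intro Min_le) auto
      then show ?thesis by simp
    next
      case False
      have "Min (A \<inter> {..b}) \<le> b" using \<open>b \<in> A\<close> f by (intro Min_le) auto
      then show ?thesis using False by simp
    qed
    then show thesis using that by blast
  qed
  define p where "p = (\<lambda>n. (nxt ^^ n) (nxt a))"
  have pS: "p (Suc n) = nxt (p n)" for n by (simp add: p_def)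
  have mono: "strict_mono p"
    unfolding strict_mono_Suc_iff pS using nxt by (auto simp: P_def)
  have pA: "p n \<in> A" for n
  proof (cases n)
    case 0 then show ?thesis using nxt[of a] by (simp add: p_def P_def)
  next
    case (Suc m) then show ?thesis using nxt[of "p m"] by (simp add: pS P_def)
  qed
  have "z \<in> range p" if z: "z \<in> A" for z
  proof (rule ccontr)
    assume nr: "z \<notin> range p"
    have lt: "p n < z" for n
    proof (induction n)
      case 0
      have "p 0 \<le> z" using nxt[of a] a[OF z] z by (simp add: p_def P_def)
      then show ?case using nr by (metis order_le_less rangeI)
    next
      case (Suc n)
      then have "p (Suc n) \<le> z" using nxt[of "p n"] z by (simp add: pS P_def)
      then show ?case using nr by (metis order_le_less rangeI)
    qed
    then have "range p \<subseteq> A \<inter> {..z}" using pA by (auto intro: less_imp_le)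
    then have "finite (range p)" using fin finite_subset by blast
    then show False using mono by (metis finite_imageD infinite_UNIV_nat strict_mono_imp_inj_on)
  qed
  then have "range p = A" using pA by auto
  with mono show ?thesis by (rule that)
qed

text \<open>The nonnegative and the negative elements are enumerated separately. Two enumerations agree at \<open>1\<close>, the
index of the least nonnegative element, and agreement passes to the neighbouring indices.\<close>

theorem two_sided_enumeration:
  fixes Z :: "real set"
  assumes fin: "\<And>a b. finite (Z \<inter> {a..b})" and unb: "\<And>b. \<exists>z\<in>Z. b < z" "\<And>b. \<exists>z\<in>Z. z < b"
  shows "\<exists>!\<zeta> :: int \<Rightarrow> real. strict_mono \<zeta> \<and> range \<zeta> = Z \<and> \<zeta> 0 < 0 \<and> 0 \<le> \<zeta> 1"
proof -
  obtain p :: "nat \<Rightarrow> real" where p: "strict_mono p" "range p = Z \<inter> {0..}"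
  proof (rule enumerate_locally_finite[of "Z \<inter> {0..}"])
    show "finite (Z \<inter> {0..} \<inter> {..b})" for b using fin[of 0 b] by (rule finite_subset[rotated]) auto
    show "\<exists>z\<in>Z \<inter> {0..}. b < z" for b using unb(1)[of "max b 0"] by auto
  qed blast
  obtain q :: "nat \<Rightarrow> real" where q: "strict_mono q" "range q = uminus ` (Z \<inter> {..<0})"
  proof (rule enumerate_locally_finite[of "uminus ` (Z \<inter> {..<0})"])
    show "finite (uminus ` (Z \<inter> {..<0}) \<inter> {..b})" for b
      by (rule finite_subset[OF _ finite_imageI[OF fin[of "-b" 0], of uminus]]) auto
    show "\<exists>z\<in>uminus ` (Z \<inter> {..<0}). b < z" for b
    proof -
      obtain z where "z \<in> Z" "z < min (-b) 0" using unb(2) by blast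
      then show ?thesis by (intro bexI[of _ "-z"]) auto
    qed
  qed blast
  define z where "z = (\<lambda>j::int. if j \<ge> 1 then p (nat (j - 1)) else - q (nat (- j)))"
  have p0: "p n \<ge> 0" for n using p(2) rangeI[of p n] by simp
  have q0: "q n > 0" for n
  proof -
    have "q n \<in> uminus ` (Z \<inter> {..<0})" using q(2) rangeI[of q n] by simp
    then show ?thesis by auto
  qed
  have zm: "strict_mono z"
  proof (rule strict_monoI)
    fix i j :: int assume "i < j"
    consider "i \<ge> 1" | "i < 1" "j \<ge> 1" | "j < 1" by linarith
    then show "z i < z j"
    proof cases
      case 1
      then have "nat (i - 1) < nat (j - 1)" using \<open>i < j\<close> by auto
      then show ?thesis using 1 \<open>i < j\<close> strict_monoD[OF p(1)] by (simp add: z_def)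
    next
      case 2
      then show ?thesis using p0[of "nat (j - 1)"] q0[of "nat (- i)"] by (simp add: z_def)
    next
      case 3
      then have "nat (- j) < nat (- i)" using \<open>i < j\<close> by auto
      then show ?thesis using 3 \<open>i < j\<close> strict_monoD[OF q(1)] by (simp add: z_def)
    qed
  qed
  have zr: "range z = Z"
  proof
    show "range z \<subseteq> Z"
    proof clarify
      fix j
      have "p n \<in> Z" for n using p(2) rangeI[of p n] by simp
      moreover have "- q n \<in> Z" for n
      proof -
        have "q n \<in> uminus ` (Z \<inter> {..<0})" using q(2) rangeI[of q n] by simp
        then show ?thesis by auto
      qed
      ultimately show "z j \<in> Z" by (simp add: z_def)
    qed
    show "Z \<subseteq> range z"
    proof
      fix x assume x: "x \<in> Z"
      show "x \<in> range z"
      proof (cases "x \<ge> 0")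
        case True
        then obtain n where "x = p n" using x p(2) by (metis IntI atLeast_iff imageE)
        then have "x = z (int n + 1)" by (simp add: z_def)
        then show ?thesis by blast
      next
        case False
        then have "- x \<in> range q" unfolding q(2) using x by auto
        then obtain n where "- x = q n" by auto
        then have "x = z (- int n)" by (simp add: z_def)
        then show ?thesis by blast
      qed
    qed
  qed
  have z01: "z 0 < 0" "0 \<le> z 1" using p0[of 0] q0[of 0] by (auto simp: z_def)
  have next_le: "\<zeta> (k + 1) \<le> \<eta> (k + 1)"
    if h: "strict_mono \<zeta>" "range \<zeta> = Z" "strict_mono \<eta>" "range \<eta> = Z" "\<zeta> k = \<eta> k" for \<zeta> \<eta> :: "int \<Rightarrow> real" and k
  proof -
    obtain j where j: "\<eta> (k + 1) = \<zeta> j" using h(2,4) by (metis rangeE rangeI)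
    have "\<zeta> k < \<zeta> j" using h(3,5) j by (metis less_add_one strict_mono_less)
    then have "k + 1 \<le> j" using h(1) by (simp add: strict_mono_less)
    then show ?thesis unfolding j using h(1) by (simp add: strict_mono_less_eq)
  qed
  have prev_le: "\<eta> (k - 1) \<le> \<zeta> (k - 1)"
    if h: "strict_mono \<zeta>" "range \<zeta> = Z" "strict_mono \<eta>" "range \<eta> = Z" "\<zeta> k = \<eta> k" for \<zeta> \<eta> :: "int \<Rightarrow> real" and k
  proof -
    obtain j where j: "\<eta> (k - 1) = \<zeta> j" using h(2,4) by (metis rangeE rangeI)
    have "\<zeta> j < \<zeta> k" using h(3,5) j by (metis diff_add_cancel less_add_one strict_mono_less)
    then have "j \<le> k - 1" using h(1) by (simp add: strict_mono_less)
    then show ?thesis unfolding j using h(1) by (simp add: strict_mono_less_eq)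
  qed
  have one_le: "\<zeta> 1 \<le> \<eta> 1"
    if h: "strict_mono \<zeta>" "range \<zeta> = Z" "\<zeta> 0 < 0" "range \<eta> = Z" "0 \<le> \<eta> 1" for \<zeta> \<eta> :: "int \<Rightarrow> real"
  proof -
    obtain j where j: "\<eta> 1 = \<zeta> j" using h(2,4) by (metis rangeE rangeI)
    have "\<zeta> 0 < \<zeta> j" using h(3,5) j by linarith
    then have "1 \<le> j" using h(1) by (simp add: strict_mono_less)
    then show ?thesis unfolding j using h(1) by (simp add: strict_mono_less_eq)
  qed
  have uniq: "\<zeta> = z" if \<zeta>: "strict_mono \<zeta>" "range \<zeta> = Z" "\<zeta> 0 < 0" "0 \<le> \<zeta> 1" for \<zeta> :: "int \<Rightarrow> real"
  proof
    fix k
    show "\<zeta> k = z k"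
    proof (induction k rule: int_induct[where k = 1])
      case base
      show ?case using one_le[OF \<zeta>(1,2,3) zr z01(2)] one_le[OF zm zr z01(1) \<zeta>(2,4)] by simp
    next
      case (step1 i)
      show ?case using next_le[OF \<zeta>(1,2) zm zr step1(2)] next_le[OF zm zr \<zeta>(1,2) step1(2)[symmetric]] by simp
    next
      case (step2 i)
      show ?case using prev_le[OF \<zeta>(1,2) zm zr step2(2)] prev_le[OF zm zr \<zeta>(1,2) step2(2)[symmetric]] by simp
    qed
  qed
  show ?thesis
  proof (rule ex1I[of _ z])
    show "strict_mono z \<and> range z = Z \<and> z 0 < 0 \<and> 0 \<le> z 1" by (intro conjI zm zr z01)
    fix \<zeta> :: "int \<Rightarrow> real" assume "strict_mono \<zeta> \<and> range \<zeta> = Z \<and> \<zeta> 0 < 0 \<and> 0 \<le> \<zeta> 1"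
    then show "\<zeta> = z" by (elim conjE) (rule uniq)
  qed
qed

section \<open>Vertical segments avoiding the zeros of an entire function\<close>

text \<open>If the claim failed, horizontal translates of \<open>D\<close> would have a locally uniform limit with a zero on every
vertical segment over \<open>[0,1]\<close>, so infinitely many zeros in a compact set. The limit would vanish
identically, although the lower bound on the line \<open>Im z = 1\<close> survives.\<close>

lemma good_vertical_segments:
  fixes D :: "complex \<Rightarrow> complex"
  assumes hol: "D holomorphic_on UNIV"
    and up: "\<And>z. \<bar>Im z\<bar> \<le> 2 \<Longrightarrow> cmod (D z) \<le> B"
    and low: "\<And>t. c \<le> cmod (D (Complex t 1))" and "c > 0"
  obtains \<kappa> where "\<kappa> > 0" "\<And>a. \<exists>t\<in>{a..a+1}. \<forall>y\<in>{-1..1}. \<kappa> \<le> cmod (D (Complex t y))"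
proof (rule ccontr)
  assume "\<not> thesis"
  then have no: "\<not> (\<forall>a. \<exists>t\<in>{a..a+1}. \<forall>y\<in>{-1..1}. \<kappa> \<le> cmod (D (Complex t y)))" if "\<kappa> > 0" for \<kappa>
    using that \<open>\<And>\<kappa>. \<lbrakk>0 < \<kappa>; \<And>a. \<exists>t\<in>{a..a+1}. \<forall>y\<in>{-1..1}. \<kappa> \<le> cmod (D (Complex t y))\<rbrakk> \<Longrightarrow> thesis\<close> by blast
  have "\<exists>a. \<forall>t\<in>{a..a+1}. \<exists>y\<in>{-1..1}. cmod (D (Complex t y)) < 1 / real (Suc n)" for n
    using no[of "1 / real (Suc n)"] by (auto simp: not_le)
  then obtain a where a: "\<And>n t. t \<in> {a n..a n+1} \<Longrightarrow> \<exists>y\<in>{-1..1}. cmod (D (Complex t y)) < 1 / real (Suc n)"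
    by metis
  define S where "S = {z. -2 < Im z \<and> Im z < 2}"
  define F where "F = (\<lambda>n z. D (z + of_real (a n)))"
  have S: "open S" "convex S"
  proof -
    have "S = {z. Im z > -2} \<inter> {z. Im z < 2}" by (auto simp: S_def)
    then show "open S" "convex S"
      by (auto intro!: open_Int open_halfspace_Im_gt open_halfspace_Im_lt convex_Int convex_halfspace_Im_gt convex_halfspace_Im_lt)
  qed
  have Fhol: "F n holomorphic_on S" for n
  proof -
    have "(\<lambda>z. z + of_real (a n)) holomorphic_on S" by (intro holomorphic_intros)
    from holomorphic_on_compose_gen[OF this hol] show ?thesis by (simp add: o_def F_def)
  qed
  obtain g r where g: "g holomorphic_on S" "strict_mono r"
    "\<And>x. x \<in> S \<Longrightarrow> (\<lambda>n. F (r n) x) \<longlonglongrightarrow> g x"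
    "\<And>K. compact K \<Longrightarrow> K \<subseteq> S \<Longrightarrow> uniform_limit K (F \<circ> r) g sequentially"
  proof (rule Montel[of S "range F" F])
    show "\<exists>B. \<forall>h\<in>range F. \<forall>z\<in>K. cmod (h z) \<le> B" if "compact K" "K \<subseteq> S" for K
      using that up by (intro exI[of _ B]) (force simp: F_def S_def)
  qed (use S Fhol in auto)
  have gi: "c \<le> cmod (g \<i>)"
  proof (rule tendsto_lowerbound)
    show "((\<lambda>n. cmod (F (r n) \<i>)) \<longlongrightarrow> cmod (g \<i>)) sequentially"
      by (intro tendsto_norm g(3)) (simp add: S_def)
    have "\<i> + of_real t = Complex t 1" for t by (simp add: complex_eq_iff)
    then show "\<forall>\<^sub>F n in sequentially. c \<le> cmod (F (r n) \<i>)" using low by (simp add: F_def)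
  qed auto
  define K where "K = cbox (Complex 0 (-1)) (Complex 1 1)"
  have K: "compact K" "K \<subseteq> S" by (auto simp: K_def S_def in_cbox_complex_iff)
  have fin: "finite {z\<in>K. g z = 0}"
  proof (cases "g constant_on S")
    case True
    then have "g z = g \<i>" if "z \<in> S" for z using that by (auto simp: constant_on_def S_def)
    then have "{z\<in>K. g z = 0} = {}" using gi \<open>c > 0\<close> K(2) by force
    then show ?thesis by (metis finite.emptyI)
  next
    case False
    show ?thesis
      by (rule holomorphic_compact_finite_zeros[OF g(1) S(1) _ K False]) (use S(2) convex_connected in blast)
  qed
  have "{0..1} \<subseteq> Re ` {z\<in>K. g z = 0}"
  proof
    fix t :: real assume t: "t \<in> {0..1}"
    show "t \<in> Re ` {z\<in>K. g z = 0}"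
    proof (rule ccontr)
      assume nt: "t \<notin> Re ` {z\<in>K. g z = 0}"
      let ?T = "(\<lambda>y. Complex t y) ` {-1..1}"
      have TK: "?T \<subseteq> K" using t by (auto simp: K_def in_cbox_complex_iff)
      have "continuous_on {-1..1} (\<lambda>y. Complex t y)"
        by (auto simp: complex_eq intro!: continuous_intros)
      then have "compact ?T" by (intro compact_continuous_image) auto
      have nz: "g z \<noteq> 0" if "z \<in> ?T" for z using nt that TK by force
      have "continuous_on ?T (\<lambda>z. cmod (g z))"
        by (intro continuous_on_norm holomorphic_on_imp_continuous_on holomorphic_on_subset[OF g(1)])
          (use TK K in blast)
      then obtain z0 where z0: "z0 \<in> ?T" "\<And>z. z \<in> ?T \<Longrightarrow> cmod (g z0) \<le> cmod (g z)"
        using continuous_attains_inf[OF \<open>compact ?T\<close>, of "\<lambda>z. cmod (g z)"] by auto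
      define m where "m = cmod (g z0)"
      have "m > 0" using nz[OF z0(1)] by (simp add: m_def)
      have "\<forall>\<^sub>F n in sequentially. \<forall>z\<in>?T. dist ((F \<circ> r) n z) (g z) < m / 2"
        using g(4)[OF \<open>compact ?T\<close>] TK K(2) \<open>m > 0\<close> unfolding uniform_limit_iff by (meson half_gt_zero order_trans)
      moreover have "\<forall>\<^sub>F n in sequentially. 1 / real (Suc n) < m / 2"
        using \<open>m > 0\<close> by (intro order_tendstoD(2)[OF LIMSEQ_Suc[OF lim_1_over_n]]) auto
      ultimately have "\<forall>\<^sub>F n in sequentially. (\<forall>z\<in>?T. dist ((F \<circ> r) n z) (g z) < m / 2) \<and> 1 / real (Suc n) < m / 2"
        by (rule eventually_conj)
      then obtain n where n: "\<And>z. z \<in> ?T \<Longrightarrow> dist (F (r n) z) (g z) < m / 2" "1 / real (Suc n) < m / 2"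
        unfolding eventually_sequentially by auto
      obtain y where y: "y \<in> {-1..1}" "cmod (D (Complex (t + a (r n)) y)) < 1 / real (Suc (r n))"
        using a[of "t + a (r n)" "r n"] t by auto
      have "1 / real (Suc (r n)) \<le> 1 / real (Suc n)"
        using seq_suble[OF g(2), of n] by (intro divide_left_mono) auto
      moreover have "Complex (t + a (r n)) y = Complex t y + of_real (a (r n))" by (simp add: complex_eq_iff)
      ultimately have "cmod (F (r n) (Complex t y)) < m / 2" using y(2) n(2) by (simp add: F_def)
      moreover have "m \<le> cmod (g (Complex t y))" unfolding m_def using y(1) by (intro z0(2)) auto
      moreover have "dist (F (r n) (Complex t y)) (g (Complex t y)) < m / 2" using y(1) by (intro n(1)) auto
      ultimately show False
        using norm_triangle_ineq2[of "g (Complex t y)" "F (r n) (Complex t y)"]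
        by (simp add: dist_norm norm_minus_commute)
    qed
  qed
  then have "finite {0..1::real}" using fin finite_subset by blast
  then show False using infinite_Icc[of "0::real" 1] by simp
qed

section \<open>The Fourier transform of a compactly supported function\<close>

text \<open>The support lies in \<open>[-b,b]\<close> for some \<open>b < 1\<close>, which gives the exponential factor; integrating by parts
twice gives the quadratic decay.\<close>

lemma fourier_extension:
  fixes f :: "real \<Rightarrow> complex^'n"
  assumes f: "f \<in> schwartz" and supp: "closure {t. f t \<noteq> 0} \<subseteq> {-1<..<1}"
  obtains F :: "complex \<Rightarrow> complex^'n" and b C :: real
  where "\<And>j. (\<lambda>z. F z $ j) holomorphic_on UNIV" "\<And>s. F (of_real s) = fourier f s" "b < 1"
    "0 < C" "\<And>z j. cmod (F z $ j) \<le> C * exp (2 * b * \<bar>Im z\<bar>) / (1 + (cmod z)\<^sup>2)"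
proof -
  define D where "D = (\<lambda>g x. vector_derivative g (at x) :: complex^'n)"
  have diff: "((D ^^ m) f) differentiable (at x)" for m x
    using f unfolding schwartz_def D_def by blast
  define f1 where "f1 = D f" 
  define f2 where "f2 = D f1"
  have d1: "(f has_vector_derivative f1 t) (at t)" for t
    using diff[of 0 t] unfolding f1_def D_def by (simp add: vector_derivative_works)
  have d2: "(f1 has_vector_derivative f2 t) (at t)" for t
    using diff[of 1 t] unfolding f2_def f1_def by (simp add: D_def vector_derivative_works)
  have d3: "f2 differentiable (at t)" for t
    using diff[of 2 t] unfolding f2_def f1_def by (simp add: numeral_2_eq_2)
  have c0: "continuous_on A f" and c1: "continuous_on A f1" and c2: "continuous_on A f2" for A
    using d1 d2 d3
    by (auto intro!: continuous_at_imp_continuous_on intro: has_vector_derivative_continuous differentiable_imp_continuous_within)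
  let ?S = "closure {t. f t \<noteq> 0}"
  have "compact ?S"
  proof -
    have "bounded {-1<..<1::real}" by (metis bounded_box box_real(1))
    then show ?thesis using bounded_subset[OF _ supp] by (simp add: compact_eq_bounded_closed)
  qed
  obtain b where b: "0 \<le> b" "b < 1" "\<And>t. f t \<noteq> 0 \<Longrightarrow> \<bar>t\<bar> < b"
  proof (cases "?S = {}")
    case True
    then show thesis using that[of 0] by (auto simp: closure_eq_empty)
  next
    case False
    have "compact (abs ` ?S)" using \<open>compact ?S\<close> by (intro compact_continuous_image continuous_intros) auto
    then obtain s where s: "s \<in> ?S" "\<And>t. t \<in> ?S \<Longrightarrow> \<bar>t\<bar> \<le> \<bar>s\<bar>"
      using compact_attains_sup[of "abs ` ?S"] False by auto
    have "\<bar>s\<bar> < 1" using s(1) supp by (auto simp: abs_less_iff)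
    then obtain b where "\<bar>s\<bar> < b" "b < 1" using dense by blast
    show thesis
    proof (rule that[of b])
      show "0 \<le> b" using \<open>\<bar>s\<bar> < b\<close> by linarith
      fix t assume "f t \<noteq> 0"
      then have "t \<in> ?S" using subsetD[OF closure_subset, of t "{t. f t \<noteq> 0}"] by simp
      then show "\<bar>t\<bar> < b" using s(2)[of t] \<open>\<bar>s\<bar> < b\<close> by linarith
    qed fact
  qed
  have f0: "f t = 0" if "\<bar>t\<bar> \<ge> b" for t using b(3)[of t] that by auto
  have der0: "g' t = 0" if "\<And>t. (g has_vector_derivative g' t) (at t)" "\<And>t. \<bar>t\<bar> > b \<Longrightarrow> g t = 0" "\<bar>t\<bar> > b"
    for g g' :: "real \<Rightarrow> complex^'n" and t
  proof -
    have "(g has_vector_derivative 0) (at t)"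
    proof (rule has_vector_derivative_transform_within_open[where f = "\<lambda>_. 0" and S = "{t. \<bar>t\<bar> > b}"])
      show "open {t::real. \<bar>t\<bar> > b}" by (intro open_Collect_less continuous_intros)
    qed (use that in auto)
    then show ?thesis using that(1) vector_derivative_unique_at by blast
  qed
  have z1: "f1 t = 0" if "\<bar>t\<bar> > b" for t using der0[OF d1 _ that] f0 by simp
  have f1b: "f1 1 = 0" "f1 (-1) = 0" and f0b: "f 1 = 0" "f (-1) = 0" using z1 f0 b by auto
  have z2: "f2 t = 0" if "\<bar>t\<bar> > b" for t using der0[OF d2 _ that] z1 by simp
  define E where "E = (\<lambda>z t. exp (2 * \<i> * z * of_real t))"
  have Ed: "((E z) has_vector_derivative (2 * \<i> * z) * E z t) (at t within A)" for z t A
    unfolding E_def by (rule has_vector_derivative_real_field) (auto intro!: derivative_eq_intros)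
  have Ec: "continuous_on A (E z)" for z A unfolding E_def by (intro continuous_intros)
  define I where "I = (\<lambda>(g::real \<Rightarrow> complex^'n) z j. integral {-1..1} (\<lambda>t. E z t * g t $ j))"
  have cj: "continuous_on A (\<lambda>t. g t $ j)" if "continuous_on A g" for A and g :: "real \<Rightarrow> complex^'n" and j
    using that by (intro continuous_intros)
  have int: "(\<lambda>t. E z t * g t $ j) integrable_on {-1..1}" if "continuous_on {-1..1} g" for g :: "real \<Rightarrow> complex^'n" and z j
    by (intro integrable_continuous_real continuous_on_mult Ec cj that)
  have parts: "2 * \<i> * z * I g z j = - I g' z j"
    if "\<And>t. (g has_vector_derivative g' t) (at t)" "continuous_on {-1..1} g" "continuous_on {-1..1} g'"
      "g 1 = 0" "g (-1) = 0" for g g' z j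
  proof -
    have "((\<lambda>t. E z t * g t $ j) has_vector_derivative (E z t * g' t $ j + ((2 * \<i> * z) * E z t) * g t $ j)) (at t within {-1..1})" for t
      by (intro has_vector_derivative_mult Ed
          bounded_linear.has_vector_derivative[OF bounded_linear_vec_nth has_vector_derivative_at_within[OF that(1)]])
    then have "((\<lambda>t. E z t * g' t $ j + ((2 * \<i> * z) * E z t) * g t $ j) has_integral (E z 1 * g 1 $ j - E z (-1) * g (-1) $ j)) {-1..1}"
      by (intro fundamental_theorem_of_calculus) auto
    then have "((\<lambda>t. E z t * g' t $ j + (2 * \<i> * z) * (E z t * g t $ j)) has_integral 0) {-1..1}"
      using that(4,5) by (simp add: mult.assoc)
    moreover have "((\<lambda>t. E z t * g' t $ j + (2 * \<i> * z) * (E z t * g t $ j)) has_integral (I g' z j + (2 * \<i> * z) * I g z j)) {-1..1}"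
      unfolding I_def by (intro has_integral_add has_integral_mult_right integrable_integral int that)
    ultimately have "I g' z j + (2 * \<i> * z) * I g z j = 0" by (rule has_integral_unique[rotated])
    then show ?thesis by (simp add: add_eq_0_iff)
  qed
  obtain B where B: "B > 0" "\<And>t. t \<in> {-1..1} \<Longrightarrow> norm (f t) \<le> B" "\<And>t. t \<in> {-1..1} \<Longrightarrow> norm (f2 t) \<le> B"
  proof -
    have "bounded (f ` {-1..1})" "bounded (f2 ` {-1..1})"
      by (intro compact_imp_bounded compact_continuous_image c0 c2; simp)+
    then obtain B1 B2 where "B1 > 0" "\<And>t. t \<in> {-1..1} \<Longrightarrow> norm (f t) \<le> B1" "B2 > 0" "\<And>t. t \<in> {-1..1} \<Longrightarrow> norm (f2 t) \<le> B2"
      unfolding bounded_pos by (metis imageI)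
    then show thesis using that[of "max B1 B2"] by (auto simp: le_max_iff_disj)
  qed
  have bound: "cmod (I g z j) \<le> 2 * (B * exp (2 * b * \<bar>Im z\<bar>))"
    if g: "continuous_on {-1..1} g" "\<And>t. t \<in> {-1..1} \<Longrightarrow> norm (g t) \<le> B" "\<And>t. \<bar>t\<bar> > b \<Longrightarrow> g t = 0" for g z j
  proof -
    have "cmod (E z t * g t $ j) \<le> B * exp (2 * b * \<bar>Im z\<bar>)" if t: "t \<in> {-1..1}" for t
    proof (cases "\<bar>t\<bar> > b")
      case True
      then show ?thesis using g(3) B(1) by simp
    next
      case False
      have "- (Im z * t) \<le> \<bar>Im z\<bar> * b"
      proof -
        have "- (Im z * t) \<le> \<bar>Im z * t\<bar>" by simp
        also have "\<dots> \<le> \<bar>Im z\<bar> * b" unfolding abs_mult using False by (intro mult_left_mono) auto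
        finally show ?thesis .
      qed
      then have "cmod (E z t) \<le> exp (2 * b * \<bar>Im z\<bar>)" by (simp add: E_def norm_exp_eq_Re algebra_simps)
      moreover have "cmod (g t $ j) \<le> B" using g(2)[OF t] Finite_Cartesian_Product.norm_nth_le[of "g t" j] by linarith
      ultimately show ?thesis unfolding norm_mult by (subst mult.commute) (intro mult_mono; use B(1) in simp)
    qed
    then have "norm (integral {-1..1} (\<lambda>t. E z t * g t $ j)) \<le> integral {-1..1::real} (\<lambda>_. B * exp (2 * b * \<bar>Im z\<bar>))"
      by (intro Henstock_Kurzweil_Integration.integral_norm_bound_integral int g) auto
    then show ?thesis by (simp add: I_def)
  qed
  define F where "F = (\<lambda>z. \<chi> j. I f z j)"
  have hol: "(\<lambda>z. F z $ j) holomorphic_on UNIV" for j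
  proof -
    have "(\<lambda>z. integral (cbox (-1) 1) (\<lambda>t. E z t * f t $ j)) holomorphic_on UNIV"
    proof (rule leibniz_rule_holomorphic[where fx = "\<lambda>z t. 2 * \<i> * of_real t * E z t * f t $ j"])
      show "((\<lambda>z. E z t * f t $ j) has_field_derivative 2 * \<i> * of_real t * E z t * f t $ j) (at z within UNIV)" for z t
        unfolding E_def by (auto intro!: derivative_eq_intros)
      show "(\<lambda>t. E z t * f t $ j) integrable_on cbox (-1) 1" for z using int[OF c0] by simp
      show "continuous_on (UNIV \<times> cbox (-1) 1) (\<lambda>(z, t). 2 * \<i> * complex_of_real t * E z t * f t $ j)"
        unfolding E_def split_def
        by (intro continuous_intros continuous_on_compose2[OF c0[of UNIV]]) auto
    qed auto
    then show ?thesis by (simp add: F_def I_def)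
  qed
  have four: "F (of_real s) = fourier f s" for s
  proof -
    let ?g = "\<lambda>t. cis (2 * s * t) *s f t"
    have gc: "continuous_on A ?g" for A
    proof -
      have "continuous_on A (\<lambda>t. cis (2 * s * t))" unfolding cis_conv_exp by (intro continuous_intros)
      then show ?thesis unfolding vector_scalar_mult_def
        by (intro continuous_on_vec_lambda continuous_on_mult cj c0)
    qed
    have "(LINT t|lborel. ?g t) = (LINT t:{-1..1}|lborel. ?g t)"
      unfolding set_lebesgue_integral_def using f0 b by (intro Bochner_Integration.integral_cong) (auto simp: indicator_def)
    also have "\<dots> = integral {-1..1} ?g"
    proof (rule set_borel_integral_eq_integral(2))
      show "set_integrable lborel {-1..1} ?g" by (rule borel_integrable_atLeastAtMost') (rule gc)
    qed
    also have "\<dots> = F (of_real s)"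
    proof -
      have "integral {-1..1} ?g $ j = F (of_real s) $ j" for j
      proof -
        have cE: "cis (2 * s * t) = E (of_real s) t" for t
          by (simp add: E_def cis_conv_exp mult_ac)
        have "integral {-1..1} ?g $ j = integral {-1..1} (\<lambda>t. ?g t $ j)"
          using integral_linear[OF integrable_continuous_real[OF gc] bounded_linear_vec_nth, of "-1" 1 j] by (simp add: o_def)
        also have "\<dots> = integral {-1..1} (\<lambda>t. E (of_real s) t * f t $ j)" by (simp add: cE)
        also have "\<dots> = F (of_real s) $ j" by (simp add: F_def I_def)
        finally show ?thesis .
      qed
      then show ?thesis by (simp add: vec_eq_iff)
    qed
    finally show ?thesis by (simp add: fourier_def)
  qed
  have bd: "cmod (F z $ j) \<le> 4 * B * exp (2 * b * \<bar>Im z\<bar>) / (1 + (cmod z)\<^sup>2)" for z j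
  proof -
    have "(2 * \<i> * z) * (2 * \<i> * z) * I f z j = I f2 z j"
      using parts[OF d1 c0 c1 f0b, of z j] parts[OF d2 c1 c2 f1b, of z j]
      by (metis (no_types, opaque_lifting) minus_minus mult.assoc mult_minus_right)
    then have "cmod ((2 * \<i> * z) * (2 * \<i> * z) * I f z j) = cmod (I f2 z j)" by simp
    then have "4 * (cmod z)\<^sup>2 * cmod (I f z j) = cmod (I f2 z j)"
      by (simp add: norm_mult power2_eq_square)
    also have "\<dots> \<le> 2 * (B * exp (2 * b * \<bar>Im z\<bar>))" using B z2 by (intro bound c2) auto
    finally have 2: "4 * (cmod z)\<^sup>2 * cmod (I f z j) \<le> 2 * (B * exp (2 * b * \<bar>Im z\<bar>))" .
    have 1: "cmod (I f z j) \<le> 2 * (B * exp (2 * b * \<bar>Im z\<bar>))" using B f0 by (intro bound c0) auto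
    have "(1 + (cmod z)\<^sup>2) * cmod (I f z j) = cmod (I f z j) + (cmod z)\<^sup>2 * cmod (I f z j)"
      by (simp add: algebra_simps)
    also have "\<dots> \<le> 4 * B * exp (2 * b * \<bar>Im z\<bar>)"
    proof -
      have "(cmod z)\<^sup>2 * cmod (I f z j) \<ge> 0" by simp
      then show ?thesis using 1 2 by linarith
    qed
    finally have "(1 + (cmod z)\<^sup>2) * cmod (I f z j) \<le> 4 * B * exp (2 * b * \<bar>Im z\<bar>)" .
    moreover have "0 < 1 + (cmod z)\<^sup>2" by (simp add: add_pos_nonneg)
    ultimately show ?thesis by (simp add: F_def pos_le_divide_eq mult.commute)
  qed
  show thesis by (rule that[of F b "4 * B", OF hol four b(2) _ bd]) (use B in simp)
qed

section \<open>Contour integrals over rectangles\<close>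

lemma contour_integral_rectpath_bound:
  assumes ab: "Re a \<le> Re b" "Im a \<le> Im b"
    and f: "continuous_on (path_image (rectpath a b)) f"
    and B: "\<And>z. z \<in> path_image (rectpath a b) \<Longrightarrow> cmod (f z) \<le> B"
  shows "cmod (contour_integral (rectpath a b) f) \<le> B * (2 * (Re b - Re a) + 2 * (Im b - Im a))"
proof -
  let ?a2 = "Complex (Re b) (Im a)" and ?a4 = "Complex (Re a) (Im b)"
  have rp: "rectpath a b = linepath a ?a2 +++ linepath ?a2 b +++ linepath b ?a4 +++ linepath ?a4 a"
    by (simp add: rectpath_def Let_def)
  have im: "path_image (rectpath a b) = closed_segment a ?a2 \<union> (closed_segment ?a2 b \<union> (closed_segment b ?a4 \<union> closed_segment ?a4 a))"
    unfolding rp by (simp add: path_image_join)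
  have "a \<in> path_image (rectpath a b)" unfolding im by simp
  then have B0: "0 \<le> B" using B norm_ge_zero order_trans by blast
  have int: "f contour_integrable_on linepath p q" if "closed_segment p q \<subseteq> path_image (rectpath a b)" for p q
    by (intro contour_integrable_continuous_linepath continuous_on_subset[OF f] that)
  have bd: "cmod (contour_integral (linepath p q) f) \<le> B * cmod (q - p)"
    if "closed_segment p q \<subseteq> path_image (rectpath a b)" for p q
    using that by (intro contour_integral_bound_linepath int B0 B) auto
  have sub: "closed_segment a ?a2 \<subseteq> path_image (rectpath a b)" "closed_segment ?a2 b \<subseteq> path_image (rectpath a b)"
    "closed_segment b ?a4 \<subseteq> path_image (rectpath a b)" "closed_segment ?a4 a \<subseteq> path_image (rectpath a b)"
    unfolding im by auto
  have eq: "contour_integral (rectpath a b) f = contour_integral (linepath a ?a2) f + (contour_integral (linepath ?a2 b) f +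
      (contour_integral (linepath b ?a4) f + contour_integral (linepath ?a4 a) f))"
    unfolding rp by (subst contour_integral_join contour_integrable_join; auto intro!: int sub valid_path_join)+
  have l: "cmod (?a2 - a) = Re b - Re a" "cmod (b - ?a2) = Im b - Im a" "cmod (?a4 - b) = Re b - Re a" "cmod (a - ?a4) = Im b - Im a"
    using ab by (simp_all add: cmod_def)
  have "cmod (contour_integral (rectpath a b) f) \<le> B * cmod (?a2 - a) + (B * cmod (b - ?a2) + (B * cmod (?a4 - b) + B * cmod (a - ?a4)))"
    unfolding eq by (intro norm_triangle_le add_mono bd sub)
  then show ?thesis unfolding l by (simp add: algebra_simps)
qed

text \<open>Group the points by the integer part of their absolute value.\<close>

lemma sum_inverse_square_bound:
  assumes fin: "finite X" and w0: "\<And>x. x \<in> X \<Longrightarrow> 0 \<le> w x"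
    and w: "\<And>a. (\<Sum>x\<in>X \<inter> {a..a+1}. w x) \<le> K"
  shows "(\<Sum>x\<in>X. w x / (1 + x\<^sup>2)) \<le> 2 * K * (\<Sum>n. 1 / (1 + (real n)\<^sup>2))"
proof -
  define N where "N = (\<lambda>x::real. nat \<lfloor>\<bar>x\<bar>\<rfloor>)"
  obtain M where M: "\<And>x. x \<in> X \<Longrightarrow> N x < M"
  proof (rule that)
    show "N x < Suc (Max (N ` X))" if "x \<in> X" for x using fin that by (simp add: le_imp_less_Suc)
  qed
  have sm: "summable (\<lambda>n. 1 / (1 + (real n)\<^sup>2))"
  proof (rule summable_comparison_test')
    show "summable (\<lambda>n. inverse ((real n)\<^sup>2))" using inverse_power_summable[of 2, where 'a = real] by simp
    fix n :: nat assume "n \<ge> 1"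
    then show "norm (1 / (1 + (real n)\<^sup>2)) \<le> inverse ((real n)\<^sup>2)"
      by (simp add: field_simps add_pos_nonneg)
  qed
  have K0: "0 \<le> K" using w[of 0] sum_nonneg[of "X \<inter> {0..0+1}" w] w0 by fastforce
  have Nb: "real (N x) \<le> \<bar>x\<bar>" "\<bar>x\<bar> \<le> real (N x) + 1" for x
    unfolding N_def by linarith+
  have "(\<Sum>x\<in>X. w x / (1 + x\<^sup>2)) = (\<Sum>n<M. \<Sum>x\<in>{x\<in>X. N x = n}. w x / (1 + x\<^sup>2))"
    using fin M by (intro sum.group[symmetric]) auto
  also have "\<dots> \<le> (\<Sum>n<M. 2 * K * (1 / (1 + (real n)\<^sup>2)))"
  proof (rule sum_mono)
    fix n
    have "(\<Sum>x\<in>{x\<in>X. N x = n}. w x / (1 + x\<^sup>2)) \<le> (\<Sum>x\<in>{x\<in>X. N x = n}. w x * (1 / (1 + (real n)\<^sup>2)))"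
    proof (rule sum_mono)
      fix x assume x: "x \<in> {x\<in>X. N x = n}"
      then have "(real n)\<^sup>2 \<le> \<bar>x\<bar>\<^sup>2" using Nb(1)[of x] by (intro power_mono) auto
      then have "1 / (1 + x\<^sup>2) \<le> 1 / (1 + (real n)\<^sup>2)"
        by (intro divide_left_mono) (auto simp: add_pos_nonneg)
      then have "w x * (1 / (1 + x\<^sup>2)) \<le> w x * (1 / (1 + (real n)\<^sup>2))" using x w0 by (intro mult_left_mono) auto
      then show "w x / (1 + x\<^sup>2) \<le> w x * (1 / (1 + (real n)\<^sup>2))" by simp
    qed
    also have "\<dots> = (\<Sum>x\<in>{x\<in>X. N x = n}. w x) * (1 / (1 + (real n)\<^sup>2))" by (rule sum_distrib_right[symmetric])
    also have "\<dots> \<le> (2 * K) * (1 / (1 + (real n)\<^sup>2))"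
    proof (rule mult_right_mono)
      have "{x\<in>X. N x = n} \<subseteq> (X \<inter> {real n..real n + 1}) \<union> (X \<inter> {- real n - 1..- real n - 1 + 1})"
      proof
        fix x assume "x \<in> {x\<in>X. N x = n}"
        then have "x \<in> X" "real n \<le> \<bar>x\<bar>" "\<bar>x\<bar> \<le> real n + 1" using Nb[of x] by auto
        then show "x \<in> (X \<inter> {real n..real n + 1}) \<union> (X \<inter> {- real n - 1..- real n - 1 + 1})"
          by (cases "x \<ge> 0") auto
      qed
      then have "(\<Sum>x\<in>{x\<in>X. N x = n}. w x) \<le> (\<Sum>x\<in>(X \<inter> {real n..real n + 1}) \<union> (X \<inter> {- real n - 1..- real n - 1 + 1}). w x)"
        using fin w0 by (intro sum_mono2) auto
      also have "\<dots> \<le> (\<Sum>x\<in>X \<inter> {real n..real n + 1}. w x) + (\<Sum>x\<in>X \<inter> {- real n - 1..- real n - 1 + 1}. w x)"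
        using fin w0 sum_nonneg[of "(X \<inter> {real n..real n + 1}) \<inter> (X \<inter> {- real n - 1..- real n - 1 + 1})" w]
        by (subst sum_Un) auto
      also have "\<dots> \<le> 2 * K" using w[of "real n"] w[of "- real n - 1"] by linarith
      finally show "(\<Sum>x\<in>{x\<in>X. N x = n}. w x) \<le> 2 * K" .
    qed (simp add: add_nonneg_nonneg)
    finally show "(\<Sum>x\<in>{x\<in>X. N x = n}. w x / (1 + x\<^sup>2)) \<le> 2 * K * (1 / (1 + (real n)\<^sup>2))" .
  qed
  also have "\<dots> = 2 * K * (\<Sum>n<M. 1 / (1 + (real n)\<^sup>2))" by (simp add: sum_distrib_left)
  also have "\<dots> \<le> 2 * K * (\<Sum>n. 1 / (1 + (real n)\<^sup>2))"
    using K0 by (intro mult_left_mono sum_le_suminf sm) (auto simp: add_nonneg_nonneg)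
  finally show ?thesis .
qed

context integrable_potential
begin

text \<open>The product of the two characteristic determinants is treated as one function, so that the same line is
good for both boundary conditions.\<close>

lemma weyl_bounded_on_verticals:
  assumes U: "U \<in> unitary_matrices" "U' \<in> unitary_matrices"
  obtains K where "0 < K" "\<And>a. \<exists>t\<in>{a..a+1}. t \<notin> spectrum U \<and> t \<notin> spectrum U' \<and>
    (\<forall>\<zeta> i j. Re \<zeta> = t \<longrightarrow> cmod (weyl_function V U \<zeta> $ i $ j) \<le> K \<and> cmod (weyl_function V U' \<zeta> $ i $ j) \<le> K)"
proof -
  obtain B where B: "0 < B" "\<And>\<zeta>. \<bar>Im \<zeta>\<bar> \<le> 2 \<Longrightarrow> cmod (char_det V U \<zeta>) \<le> B" using char_det_bounded[of U] by blast
  obtain B' where B': "0 < B'" "\<And>\<zeta>. \<bar>Im \<zeta>\<bar> \<le> 2 \<Longrightarrow> cmod (char_det V U' \<zeta>) \<le> B'" using char_det_bounded[of U'] by blast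
  obtain c where c: "0 < c" "\<And>t. c \<le> cmod (char_det V U (Complex t 1))" using char_det_lower_bound[OF U(1)] by blast
  obtain c' where c': "0 < c'" "\<And>t. c' \<le> cmod (char_det V U' (Complex t 1))" using char_det_lower_bound[OF U(2)] by blast
  obtain N where N: "0 < N" "\<And>\<zeta> i j. \<bar>Im \<zeta>\<bar> \<le> 2 \<Longrightarrow> cmod (weyl_numerator U i j \<zeta>) \<le> N" using weyl_numerator_bounded by blast
  obtain N' where N': "0 < N'" "\<And>\<zeta> i j. \<bar>Im \<zeta>\<bar> \<le> 2 \<Longrightarrow> cmod (weyl_numerator U' i j \<zeta>) \<le> N'" using weyl_numerator_bounded by blast
  define D where "D = (\<lambda>z. char_det V U z * char_det V U' z)"
  obtain \<kappa> where \<kappa>: "\<kappa> > 0" "\<And>a. \<exists>t\<in>{a..a+1}. \<forall>y\<in>{-1..1}. \<kappa> \<le> cmod (D (Complex t y))"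
  proof (rule good_vertical_segments[of D "B * B'" "c * c'"])
    show "D holomorphic_on UNIV" unfolding D_def by (intro holomorphic_intros holomorphic_char_det)
    show "cmod (D z) \<le> B * B'" if "\<bar>Im z\<bar> \<le> 2" for z
      unfolding D_def norm_mult using B B' that by (intro mult_mono) auto
    show "c * c' \<le> cmod (D (Complex t 1))" for t
      unfolding D_def norm_mult using c c' by (intro mult_mono) auto
    show "0 < c * c'" using c c' by simp
  qed blast
  define K where "K = max (max (N * B' / \<kappa>) (N' * B / \<kappa>)) (4 * exp (2 * mass 1))"
  show ?thesis
  proof (rule that[of K])
    show "0 < K" by (simp add: K_def less_max_iff_disj)
    fix a
    obtain t where t: "t \<in> {a..a+1}" "\<And>y. y \<in> {-1..1} \<Longrightarrow> \<kappa> \<le> cmod (D (Complex t y))" using \<kappa>(2) by blast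
    have near: "cmod (weyl_function V U \<zeta> $ i $ j) \<le> K \<and> cmod (weyl_function V U' \<zeta> $ i $ j) \<le> K"
      if z: "Re \<zeta> = t" "\<bar>Im \<zeta>\<bar> \<le> 1" for \<zeta> i j
    proof -
      have "Complex t (Im \<zeta>) = \<zeta>" using z(1) by (simp add: complex_eq_iff)
      then have k: "\<kappa> \<le> cmod (char_det V U \<zeta>) * cmod (char_det V U' \<zeta>)"
        using t(2)[of "Im \<zeta>"] z(2) by (simp add: D_def norm_mult abs_le_iff)
      have u: "cmod (char_det V U \<zeta>) \<le> B" "cmod (char_det V U' \<zeta>) \<le> B'" using z(2) by (auto intro: B B')
      have "\<kappa> \<le> cmod (char_det V U \<zeta>) * B'" using k u(2) by (meson mult_left_mono norm_ge_zero order_trans)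
      then have d: "\<kappa> / B' \<le> cmod (char_det V U \<zeta>)" using B'(1) by (simp add: field_simps)
      have "\<kappa> \<le> B * cmod (char_det V U' \<zeta>)" using k u(1) by (meson mult_right_mono norm_ge_zero order_trans)
      then have d': "\<kappa> / B \<le> cmod (char_det V U' \<zeta>)" using B(1) by (simp add: field_simps)
      have nz: "char_det V U \<zeta> \<noteq> 0" "char_det V U' \<zeta> \<noteq> 0" using k \<kappa>(1) by auto
      have "cmod (weyl_function V U \<zeta> $ i $ j) \<le> N / (\<kappa> / B')"
        unfolding weyl_function_eq_quotient[OF nz(1)] norm_divide
        using N d \<kappa>(1) B'(1) z(2) by (intro frac_le) auto
      moreover have "cmod (weyl_function V U' \<zeta> $ i $ j) \<le> N' / (\<kappa> / B)"
        unfolding weyl_function_eq_quotient[OF nz(2)] norm_divide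
        using N' d' \<kappa>(1) B(1) z(2) by (intro frac_le) auto
      ultimately show ?thesis unfolding K_def by (auto simp: le_max_iff_disj)
    qed
    have far: "cmod (weyl_function V W \<zeta> $ i $ j) \<le> K" if "1 \<le> \<bar>Im \<zeta>\<bar>" "W \<in> unitary_matrices" for \<zeta> W i j
      using weyl_function_entry_bound[OF that(2,1), of i j] unfolding K_def by (auto simp: le_max_iff_disj)
    have "\<kappa> \<le> cmod (D (of_real t))" using t(2)[of 0] by (simp add: complex_of_real_def)
    then have "t \<notin> spectrum U" "t \<notin> spectrum U'" using \<kappa>(1) by (auto simp: D_def spectrum_def)
    then show "\<exists>t\<in>{a..a+1}. t \<notin> spectrum U \<and> t \<notin> spectrum U' \<and>
      (\<forall>\<zeta> i j. Re \<zeta> = t \<longrightarrow> cmod (weyl_function V U \<zeta> $ i $ j) \<le> K \<and> cmod (weyl_function V U' \<zeta> $ i $ j) \<le> K)"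
    proof (intro bexI[OF _ t(1)] conjI allI impI)
      fix \<zeta> :: complex and i j assume z: "Re \<zeta> = t"
      show "cmod (weyl_function V U \<zeta> $ i $ j) \<le> K" "cmod (weyl_function V U' \<zeta> $ i $ j) \<le> K"
        using near[OF z, of i j] far[of \<zeta> U i j] far[of \<zeta> U' i j] U by linarith+
    qed
  qed
qed

text \<open>All poles lie on the real axis and are at most simple, so multiplication by \<open>F\<close> just multiplies the residues.\<close>

lemma weyl_function_residue_theorem:
  assumes U: "U \<in> unitary_matrices" and st: "s < t" "s \<notin> spectrum U" "t \<notin> spectrum U" and H: "0 < H"
    and F: "F holomorphic_on UNIV"
  shows "contour_integral (rectpath (Complex s (- H)) (Complex t H)) (\<lambda>\<zeta>. weyl_function V U \<zeta> $ i $ j * F \<zeta>) =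
    2 * pi * \<i> * (\<Sum>x\<in>spectrum U \<inter> {s..t}. weyl_residue U x $ i $ j * F (of_real x))"
    and "path_image (rectpath (Complex s (- H)) (Complex t H)) \<subseteq> - {\<zeta>. char_det V U \<zeta> = 0}"
proof -
  let ?f = "\<lambda>\<zeta>. weyl_function V U \<zeta> $ i $ j * F \<zeta>"
  let ?a = "Complex s (- H)" and ?b = "Complex t H"
  define S where "S = {z. s - 1 < Re z \<and> Re z < t + 1}"
  define P where "P = complex_of_real ` (spectrum U \<inter> {s-1..t+1})"
  have S: "open S" "convex S"
  proof -
    have "S = {z. Re z > s - 1} \<inter> {z. Re z < t + 1}" by (auto simp: S_def)
    then show "open S" "convex S"
      by (auto intro!: open_Int open_halfspace_Re_gt open_halfspace_Re_lt convex_Int convex_halfspace_Re_gt convex_halfspace_Re_lt)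
  qed
  have finP: "finite P" unfolding P_def using spectrum_locally_finite[OF U] by (intro finite_imageI)
  have im: "path_image (rectpath ?a ?b) = {z. Re z \<in> {s, t} \<and> Im z \<in> {- H..H}} \<union> {z. Im z \<in> {- H, H} \<and> Re z \<in> {s..t}}"
    using path_image_rectpath[of ?a ?b] st H by simp
  show pz: "path_image (rectpath ?a ?b) \<subseteq> - {\<zeta>. char_det V U \<zeta> = 0}"
    unfolding im char_det_0_iff_spectrum[OF U] using st H by auto
  have pS: "path_image (rectpath ?a ?b) \<subseteq> S" unfolding im S_def using st by auto
  have Pz: "char_det V U z = 0" if "z \<in> P" for z using that by (auto simp: P_def spectrum_def)
  have holo: "?f holomorphic_on S - P"
  proof (intro holomorphic_on_mult holomorphic_on_subset[OF F] holomorphic_on_subset[OF holomorphic_weyl_function])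
    show "S - P \<subseteq> - {\<zeta>. char_det V U \<zeta> = 0}"
    proof
      fix z assume z: "z \<in> S - P"
      show "z \<in> - {\<zeta>. char_det V U \<zeta> = 0}"
      proof
        assume "z \<in> {\<zeta>. char_det V U \<zeta> = 0}"
        then have *: "Im z = 0" "Re z \<in> spectrum U" using char_det_0_iff_spectrum[OF U] by auto
        then have "z = of_real (Re z)" by (simp add: complex_eq_iff)
        moreover have "Re z \<in> {s-1..t+1}" using z by (auto simp: S_def)
        ultimately have "z \<in> P" unfolding P_def using *(2) by blast
        then show False using z by blast
      qed
    qed
  qed auto
  have "contour_integral (rectpath ?a ?b) ?f = 2 * pi * \<i> * (\<Sum>p\<in>P. winding_number (rectpath ?a ?b) p * residue ?f p)"
  proof (rule Residue_theorem[OF S(1) convex_connected[OF S(2)] finP holo])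
    show "path_image (rectpath ?a ?b) \<subseteq> S - P" using pS pz Pz by blast
    show "\<forall>z. z \<notin> S \<longrightarrow> winding_number (rectpath ?a ?b) z = 0"
    proof (intro allI impI winding_number_rectpath_outside)
      fix z assume "z \<notin> S"
      then show "z \<notin> cbox ?a ?b" by (auto simp: S_def in_cbox_complex_iff)
    qed (use st H in auto)
  qed auto
  also have "(\<Sum>p\<in>P. winding_number (rectpath ?a ?b) p * residue ?f p) =
     (\<Sum>x\<in>spectrum U \<inter> {s-1..t+1}. winding_number (rectpath ?a ?b) (of_real x) * residue ?f (of_real x))"
    unfolding P_def by (subst sum.reindex) (auto intro: inj_onI)
  also have "\<dots> = (\<Sum>x\<in>spectrum U \<inter> {s..t}. weyl_residue U x $ i $ j * F (of_real x))"
  proof (rule sum.mono_neutral_cong_right)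
    show "finite (spectrum U \<inter> {s-1..t+1})" by (rule spectrum_locally_finite[OF U])
    show "\<forall>x\<in>spectrum U \<inter> {s-1..t+1} - spectrum U \<inter> {s..t}. winding_number (rectpath ?a ?b) (of_real x) * residue ?f (of_real x) = 0"
    proof
      fix x assume "x \<in> spectrum U \<inter> {s-1..t+1} - spectrum U \<inter> {s..t}"
      then have "of_real x \<notin> cbox ?a ?b" by (auto simp: in_cbox_complex_iff)
      then have "winding_number (rectpath ?a ?b) (of_real x) = 0"
        using st H by (intro winding_number_rectpath_outside) auto
      then show "winding_number (rectpath ?a ?b) (of_real x) * residue ?f (of_real x) = 0" by simp
    qed
    fix x assume x: "x \<in> spectrum U \<inter> {s..t}"
    then have "s < x" "x < t" using st by (auto simp: order_le_less)
    then have w: "winding_number (rectpath ?a ?b) (of_real x) = 1"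
      using H by (intro winding_number_rectpath) (auto simp: in_box_complex_iff)
    obtain r where r: "r > 0" "\<And>w. w \<in> ball (of_real x) r - {of_real x} \<Longrightarrow> char_det V U w \<noteq> 0"
      using spectrum_isolated[OF U] by metis
    have "residue ?f (of_real x) = weyl_residue U x $ i $ j * F (of_real x)"
    proof (rule residue_simple'[of "ball (of_real x) r"])
      show "?f holomorphic_on ball (of_real x) r - {of_real x}"
        by (intro holomorphic_on_mult holomorphic_on_subset[OF F] holomorphic_on_subset[OF holomorphic_weyl_function])
          (use r in auto)
      have "continuous_on UNIV F" using F by (rule holomorphic_on_imp_continuous_on)
      then have "(F \<longlongrightarrow> F (of_real x)) (at (of_real x))" by (simp add: continuous_on_def)
      from tendsto_mult[OF weyl_function_residue_limit[OF U, of i j x] this]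
      show "((\<lambda>w. ?f w * (w - of_real x)) \<longlongrightarrow> weyl_residue U x $ i $ j * F (of_real x)) (at (of_real x))"
        by (simp add: mult_ac)
    qed (use r in auto)
    then show "winding_number (rectpath ?a ?b) (of_real x) * residue ?f (of_real x) =
       weyl_residue U x $ i $ j * F (of_real x)" using w by simp
  qed auto
  finally show "contour_integral (rectpath ?a ?b) ?f =
    2 * pi * \<i> * (\<Sum>x\<in>spectrum U \<inter> {s..t}. weyl_residue U x $ i $ j * F (of_real x))" .
qed

lemma weyl_function_continuous_on:
  assumes "A \<subseteq> - {\<zeta>. char_det V U \<zeta> = 0}"
  shows "continuous_on A (\<lambda>\<zeta>. weyl_function V U \<zeta> $ i $ j)"
  by (rule holomorphic_on_imp_continuous_on[OF holomorphic_on_subset[OF holomorphic_weyl_function assms]])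

section \<open>Local boundedness of the spectral measure\<close>

text \<open>Integrate a diagonal entry around a box of height \<open>2\<close> whose vertical sides are good lines on both sides
of \<open>[a, a + 1]\<close>. All residues have the same sign, so those in \<open>[a, a + 1]\<close> are bounded by their sum over the
box.\<close>

lemma residue_weight_local_bound:
  assumes U: "U \<in> unitary_matrices"
  obtains K where "\<And>a i. (\<Sum>x\<in>spectrum U \<inter> {a..a+1}. residue_weight U x i) \<le> K"
proof -
  obtain K where K: "0 < K" "\<And>a. \<exists>t\<in>{a..a+1}. t \<notin> spectrum U \<and> t \<notin> spectrum U \<and>
    (\<forall>\<zeta> i j. Re \<zeta> = t \<longrightarrow> cmod (weyl_function V U \<zeta> $ i $ j) \<le> K \<and> cmod (weyl_function V U \<zeta> $ i $ j) \<le> K)"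
    using weyl_bounded_on_verticals[OF U U] by blast
  define B where "B = max K (4 * exp (2 * mass 1))"
  have "(\<Sum>x\<in>spectrum U \<inter> {a..a+1}. residue_weight U x i) \<le> 10 * B" for a i
  proof -
    \<comment> \<open>Good lines to the left and to the right of \<open>[a, a + 1]\<close>. Good lines avoid the eigenvalues, so an interval of length one is searched on either side.\<close>
    obtain s where s: "s \<in> {a - 1..a - 1 + 1}" "s \<notin> spectrum U" "\<And>\<zeta> i j. Re \<zeta> = s \<Longrightarrow> cmod (weyl_function V U \<zeta> $ i $ j) \<le> K"
      using K(2)[of "a - 1"] by blast
    obtain t where t: "t \<in> {a + 1..a + 1 + 1}" "t \<notin> spectrum U" "\<And>\<zeta> i j. Re \<zeta> = t \<Longrightarrow> cmod (weyl_function V U \<zeta> $ i $ j) \<le> K"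
      using K(2)[of "a + 1"] by blast
    have st: "s < t" using s(1) t(1) by auto
    let ?p = "rectpath (Complex s (- 1)) (Complex t 1)"
    note res1 = weyl_function_residue_theorem(1)[OF U st s(2) t(2) zero_less_one holomorphic_on_const, of i i 1, simplified]
    note res2 = weyl_function_residue_theorem(2)[OF U st s(2) t(2) zero_less_one holomorphic_on_const]
    have im: "path_image ?p = {z. Re z \<in> {s, t} \<and> Im z \<in> {- 1..1}} \<union> {z. Im z \<in> {- 1, 1} \<and> Re z \<in> {s..t}}"
      using path_image_rectpath[of "Complex s (- 1)" "Complex t 1"] st by simp
    have "cmod (contour_integral ?p (\<lambda>\<zeta>. weyl_function V U \<zeta> $ i $ i)) \<le> B * (2 * (Re (Complex t 1) - Re (Complex s (- 1))) + 2 * (Im (Complex t 1) - Im (Complex s (- 1))))"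
    proof (rule contour_integral_rectpath_bound)
      show "continuous_on (path_image ?p) (\<lambda>\<zeta>. weyl_function V U \<zeta> $ i $ i)"
        by (rule weyl_function_continuous_on[OF res2])
      fix z assume "z \<in> path_image ?p"
      then consider "Re z = s" | "Re z = t" | "1 \<le> \<bar>Im z\<bar>" unfolding im by force
      then show "cmod (weyl_function V U z $ i $ i) \<le> B"
      proof cases
        case 1 then show ?thesis using s(3)[of z i i] by (simp add: B_def le_max_iff_disj)
      next
        case 2 then show ?thesis using t(3)[of z i i] by (simp add: B_def le_max_iff_disj)
      next
        case 3 then show ?thesis using weyl_function_entry_bound[OF U 3, of i i] by (simp add: B_def le_max_iff_disj)
      qed
    qed (use st in auto)
    also have "\<dots> \<le> B * 10"
      using s(1) t(1) K(1) by (intro mult_left_mono) (auto simp: B_def le_max_iff_disj)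
    finally have "2 * pi * cmod (\<Sum>x\<in>spectrum U \<inter> {s..t}. weyl_residue U x $ i $ i) \<le> B * 10"
      unfolding res1 by (simp add: norm_mult)
    moreover have "1 * cmod (\<Sum>x\<in>spectrum U \<inter> {s..t}. weyl_residue U x $ i $ i) \<le>
        2 * pi * cmod (\<Sum>x\<in>spectrum U \<inter> {s..t}. weyl_residue U x $ i $ i)"
      using pi_gt3 by (intro mult_right_mono) auto
    ultimately have le: "cmod (\<Sum>x\<in>spectrum U \<inter> {s..t}. weyl_residue U x $ i $ i) \<le> 10 * B" by simp
    have "(\<Sum>x\<in>spectrum U \<inter> {a..a+1}. residue_weight U x i) \<le> (\<Sum>x\<in>spectrum U \<inter> {s..t}. residue_weight U x i)"
      using s(1) t(1) by (intro sum_mono2 spectrum_locally_finite[OF U]) (auto intro: residue_weight_nonneg[OF U])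
    also have "\<dots> = - Re (\<Sum>x\<in>spectrum U \<inter> {s..t}. weyl_residue U x $ i $ i)"
      by (simp add: residue_weight_def sum_negf)
    also have "\<dots> \<le> cmod (\<Sum>x\<in>spectrum U \<inter> {s..t}. weyl_residue U x $ i $ i)"
      using abs_Re_le_cmod[of "\<Sum>x\<in>spectrum U \<inter> {s..t}. weyl_residue U x $ i $ i"] by linarith
    also note le
    finally show ?thesis .
  qed
  then show ?thesis by (rule that)
qed

text \<open>The summand \<open>C\<^sub>j F(\<zeta>\<^sub>j)\<close> of the spectral measure at the eigenvalue \<open>x = \<zeta>\<^sub>j\<close>.\<close>

definition spectral_term :: "complex^'n^'n \<Rightarrow> (complex \<Rightarrow> complex^'n) \<Rightarrow> real \<Rightarrow> complex^'n" where
  "spectral_term U F x = (- weyl_residue U x) *v F (of_real x)"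

lemma spectral_term_nth:
  "spectral_term U F x $ i = - (\<Sum>j\<in>UNIV. weyl_residue U x $ i $ j * F (of_real x) $ j)"
  unfolding spectral_term_def uminus_mat_mult by (simp add: matrix_vector_mult_def)

lemma spectral_term_summable:
  fixes F :: "complex \<Rightarrow> complex^'n"
  assumes U: "U \<in> unitary_matrices" and C: "0 \<le> C" "\<And>x j. cmod (F (complex_of_real x) $ j) \<le> C / (1 + x\<^sup>2)"
  shows "spectral_term U F summable_on spectrum U"
proof -
  obtain K where K: "\<And>a i. (\<Sum>x\<in>spectrum U \<inter> {a..a+1}. residue_weight U x i) \<le> K"
    using residue_weight_local_bound[OF U] by blast
  define W where "W = (\<lambda>x. \<Sum>i\<in>UNIV. \<Sum>j\<in>UNIV. (residue_weight U x i + residue_weight U x j) * C)"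
  have W0: "0 \<le> W x" for x
    unfolding W_def using C(1) residue_weight_nonneg[OF U] by (intro sum_nonneg mult_nonneg_nonneg add_nonneg_nonneg) auto
  have Wsum: "(\<Sum>x\<in>X \<inter> {a..a+1}. W x) \<le> real CARD('n) * (real CARD('n) * (2 * K * C))" if X: "X \<subseteq> spectrum U" "finite X" for X a
  proof -
    have le: "(\<Sum>x\<in>X \<inter> {a..a+1}. residue_weight U x i) \<le> K" for i
      using X by (intro order_trans[OF sum_mono2 K[of i a]] spectrum_locally_finite[OF U])
        (auto intro: residue_weight_nonneg[OF U])
    have "(\<Sum>x\<in>X \<inter> {a..a+1}. W x) = (\<Sum>i\<in>UNIV. \<Sum>x\<in>X \<inter> {a..a+1}. \<Sum>j\<in>UNIV. (residue_weight U x i + residue_weight U x j) * C)"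
      unfolding W_def by (rule sum.swap)
    also have "\<dots> = (\<Sum>i\<in>UNIV. \<Sum>j\<in>UNIV. \<Sum>x\<in>X \<inter> {a..a+1}. (residue_weight U x i + residue_weight U x j) * C)"
      by (intro sum.cong refl sum.swap)
    also have "\<dots> = (\<Sum>i\<in>UNIV. \<Sum>j\<in>UNIV. ((\<Sum>x\<in>X \<inter> {a..a+1}. residue_weight U x i) + (\<Sum>x\<in>X \<inter> {a..a+1}. residue_weight U x j)) * C)"
      by (simp only: sum_distrib_right[symmetric] sum.distrib)
    also have "\<dots> \<le> (\<Sum>i\<in>(UNIV::'n set). \<Sum>j\<in>(UNIV::'n set). (K + K) * C)"
      using C(1) by (intro sum_mono mult_right_mono add_mono le)
    also have "\<dots> = real CARD('n) * (real CARD('n) * (2 * K * C))" by simp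
    finally show ?thesis .
  qed
  have nb: "norm (spectral_term U F x) \<le> W x / (1 + x\<^sup>2)" for x
  proof -
    have "norm (spectral_term U F x) \<le> (\<Sum>i\<in>UNIV. cmod (spectral_term U F x $ i))"
      unfolding norm_vec_def by (rule L2_set_le_sum) simp
    also have "\<dots> \<le> (\<Sum>i\<in>UNIV. \<Sum>j\<in>UNIV. (residue_weight U x i + residue_weight U x j) * (C / (1 + x\<^sup>2)))"
      unfolding spectral_term_nth norm_minus_cancel
    proof (intro sum_mono sum_norm_le)
      fix i j
      show "cmod (weyl_residue U x $ i $ j * F (of_real x) $ j) \<le> (residue_weight U x i + residue_weight U x j) * (C / (1 + x\<^sup>2))"
        unfolding norm_mult
        by (intro mult_mono residue_entry_le_weight[OF U] C(2)) (auto intro: add_nonneg_nonneg residue_weight_nonneg[OF U])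
    qed
    also have "\<dots> = W x / (1 + x\<^sup>2)" unfolding W_def by (simp add: sum_divide_distrib)
    finally show ?thesis .
  qed
  have "(\<lambda>x. norm (spectral_term U F x)) summable_on spectrum U"
  proof (rule nonneg_bdd_above_summable_on)
    let ?Q = "2 * (real CARD('n) * (real CARD('n) * (2 * K * C))) * (\<Sum>n. 1 / (1 + (real n)\<^sup>2))"
    show "bdd_above (sum (\<lambda>x. norm (spectral_term U F x)) ` {X. X \<subseteq> spectrum U \<and> finite X})"
    proof (rule bdd_aboveI2)
      fix X assume "X \<in> {X. X \<subseteq> spectrum U \<and> finite X}"
      then have X: "X \<subseteq> spectrum U" "finite X" by auto
      have "(\<Sum>x\<in>X. norm (spectral_term U F x)) \<le> (\<Sum>x\<in>X. W x / (1 + x\<^sup>2))" by (intro sum_mono nb)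
      also have "\<dots> \<le> ?Q" by (rule sum_inverse_square_bound[OF X(2) W0 Wsum[OF X]])
      finally show "(\<Sum>x\<in>X. norm (spectral_term U F x)) \<le> ?Q" .
    qed
  qed auto
  then show ?thesis by (rule abs_summable_summable)
qed

section \<open>Independence of the boundary condition\<close>

text \<open>On the boundary of the rectangle with vertices near \<open>\<plusminus> n \<plusminus> i n\<close> the difference of the Weyl functions is
\<open>O(e\<^bsup>-2\<bar>Im z\<bar>\<^esup>)\<close>, which beats the growth of \<open>F\<close>. What remains is the factor \<open>1 / (1 + n\<^sup>2)\<close>, against a
perimeter of order \<open>n\<close>.\<close>

lemma spectral_terms_window_difference:
  fixes F :: "complex \<Rightarrow> complex^'n"
  assumes U: "U \<in> unitary_matrices" "U' \<in> unitary_matrices"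
    and F: "\<And>j. (\<lambda>z. F z $ j) holomorphic_on UNIV" "b \<le> 1" "0 < C"
      "\<And>z j. cmod (F z $ j) \<le> C * exp (2 * b * \<bar>Im z\<bar>) / (1 + (cmod z)\<^sup>2)"
  obtains s t Q where "\<And>n::nat. s n \<in> {- real n - 1..- real n}" "\<And>n::nat. t n \<in> {real n..real n + 1}"
    "\<And>n i. 1 \<le> n \<Longrightarrow> cmod ((\<Sum>x\<in>spectrum U \<inter> {s n..t n}. spectral_term U F x $ i) -
       (\<Sum>x\<in>spectrum U' \<inter> {s n..t n}. spectral_term U' F x $ i)) \<le> Q / real n"
proof -
  obtain K where K: "0 < K" "\<And>a. \<exists>t\<in>{a..a+1}. t \<notin> spectrum U \<and> t \<notin> spectrum U' \<and>
    (\<forall>\<zeta> i j. Re \<zeta> = t \<longrightarrow> cmod (weyl_function V U \<zeta> $ i $ j) \<le> K \<and> cmod (weyl_function V U' \<zeta> $ i $ j) \<le> K)"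
    using weyl_bounded_on_verticals[OF U] by blast
  obtain K' where K': "0 < K'" "\<And>\<zeta> i j. 1 \<le> \<bar>Im \<zeta>\<bar> \<Longrightarrow>
    cmod (weyl_function V U \<zeta> $ i $ j - weyl_function V U' \<zeta> $ i $ j) * exp (2 * \<bar>Im \<zeta>\<bar>) \<le> K'"
    using weyl_function_difference_bound[OF U] by blast
  define E where "E = max K' (2 * K * exp 2)"
  have E0: "E > 0" using K'(1) by (simp add: E_def less_max_iff_disj)
  have "\<exists>t. t \<in> {a..a+1} \<and> t \<notin> spectrum U \<and> t \<notin> spectrum U' \<and>
    (\<forall>\<zeta> i j. Re \<zeta> = t \<longrightarrow> cmod (weyl_function V U \<zeta> $ i $ j) \<le> K \<and> cmod (weyl_function V U' \<zeta> $ i $ j) \<le> K)" for a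
    using K(2)[of a] by blast
  then obtain \<tau> where \<tau>: "\<And>a. \<tau> a \<in> {a..a+1}" "\<And>a. \<tau> a \<notin> spectrum U" "\<And>a. \<tau> a \<notin> spectrum U'"
    "\<And>a \<zeta> i j. Re \<zeta> = \<tau> a \<Longrightarrow> cmod (weyl_function V U \<zeta> $ i $ j) \<le> K \<and> cmod (weyl_function V U' \<zeta> $ i $ j) \<le> K"
    by metis
  define s where "s = (\<lambda>n::nat. \<tau> (- real n - 1))"
  define t where "t = (\<lambda>n::nat. \<tau> (real n))"
  have sn: "s n \<in> {- real n - 1..- real n}" and tn: "t n \<in> {real n..real n + 1}" for n
    using \<tau>(1)[of "- real n - 1"] \<tau>(1)[of "real n"] by (auto simp: s_def t_def)
  have diff: "cmod (weyl_function V U \<zeta> $ i $ j - weyl_function V U' \<zeta> $ i $ j) * exp (2 * \<bar>Im \<zeta>\<bar>) \<le> E"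
    if "Re \<zeta> = s n \<or> Re \<zeta> = t n \<or> 1 \<le> \<bar>Im \<zeta>\<bar>" for n \<zeta> i j
  proof (cases "1 \<le> \<bar>Im \<zeta>\<bar>")
    case True
    then show ?thesis using K'(2)[of \<zeta> i j] by (simp add: E_def le_max_iff_disj)
  next
    case False
    then have "cmod (weyl_function V U \<zeta> $ i $ j) \<le> K" "cmod (weyl_function V U' \<zeta> $ i $ j) \<le> K"
      using that \<tau>(4)[of \<zeta> _ i j] unfolding s_def t_def by blast+
    then have "cmod (weyl_function V U \<zeta> $ i $ j - weyl_function V U' \<zeta> $ i $ j) \<le> 2 * K"
      using norm_triangle_ineq4[of "weyl_function V U \<zeta> $ i $ j" "weyl_function V U' \<zeta> $ i $ j"] by linarith
    moreover have "exp (2 * \<bar>Im \<zeta>\<bar>) \<le> exp 2" using False by simp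
    ultimately have "cmod (weyl_function V U \<zeta> $ i $ j - weyl_function V U' \<zeta> $ i $ j) * exp (2 * \<bar>Im \<zeta>\<bar>) \<le> 2 * K * exp 2"
      using K(1) by (intro mult_mono) auto
    then show ?thesis by (simp add: E_def le_max_iff_disj)
  qed
  define Q where "Q = real CARD('n) * (E * C * 12)"
  define T where "T = (\<lambda>W n i. \<Sum>x\<in>spectrum W \<inter> {s n..t n}. spectral_term W F x $ i)"
  have main: "cmod (T U n i - T U' n i) \<le> Q / real n" if n: "1 \<le> n" for n i
  proof -
    let ?a = "Complex (s n) (- real n)" and ?b = "Complex (t n) (real n)"
    let ?p = "rectpath ?a ?b"
    have st: "s n < t n" "s n \<notin> spectrum U" "t n \<notin> spectrum U" "s n \<notin> spectrum U'" "t n \<notin> spectrum U'" "0 < real n"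
      using sn[of n] tn[of n] n \<tau>(2,3) by (auto simp: s_def t_def)
    have im: "path_image ?p = {z. Re z \<in> {s n, t n} \<and> Im z \<in> {- real n..real n}} \<union> {z. Im z \<in> {- real n, real n} \<and> Re z \<in> {s n..t n}}"
      using path_image_rectpath[of ?a ?b] st by simp
    define J where "J = (\<lambda>j. contour_integral ?p (\<lambda>\<zeta>. weyl_function V U \<zeta> $ i $ j * F \<zeta> $ j - weyl_function V U' \<zeta> $ i $ j * F \<zeta> $ j))"
    note res = weyl_function_residue_theorem[OF U(1) st(1-3,6) F(1)]
    note res' = weyl_function_residue_theorem[OF U(2) st(1,4-6) F(1)]
    have cF: "continuous_on A (\<lambda>z. F z $ j)" for A j
      using holomorphic_on_imp_continuous_on[OF F(1)] continuous_on_subset by blast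
    have c: "continuous_on (path_image ?p) (\<lambda>\<zeta>. weyl_function V U \<zeta> $ i $ j * F \<zeta> $ j)"
      "continuous_on (path_image ?p) (\<lambda>\<zeta>. weyl_function V U' \<zeta> $ i $ j * F \<zeta> $ j)" for j
      by (intro continuous_on_mult weyl_function_continuous_on[OF res(2)] weyl_function_continuous_on[OF res'(2)] cF)+
    have hol: "(\<lambda>\<zeta>. weyl_function V W \<zeta> $ i $ j * F \<zeta> $ j) holomorphic_on - {\<zeta>. char_det V W \<zeta> = 0}" for W j
      by (intro holomorphic_on_mult holomorphic_weyl_function holomorphic_on_subset[OF F(1)]) auto
    have ci: "(\<lambda>\<zeta>. weyl_function V U \<zeta> $ i $ j * F \<zeta> $ j) contour_integrable_on ?p"
      "(\<lambda>\<zeta>. weyl_function V U' \<zeta> $ i $ j * F \<zeta> $ j) contour_integrable_on ?p" for j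
      by (rule contour_integrable_holomorphic_simple[OF hol open_char_det_nonzero valid_path_rectpath res(2)],
          rule contour_integrable_holomorphic_simple[OF hol open_char_det_nonzero valid_path_rectpath res'(2)])
    have Jeq: "J j = 2 * pi * \<i> * ((\<Sum>x\<in>spectrum U \<inter> {s n..t n}. weyl_residue U x $ i $ j * F (of_real x) $ j) -
        (\<Sum>x\<in>spectrum U' \<inter> {s n..t n}. weyl_residue U' x $ i $ j * F (of_real x) $ j))" for j
      unfolding J_def contour_integral_diff[OF ci] res(1) res'(1) by (simp add: algebra_simps)
    have Jb: "cmod (J j) \<le> E * C * 12 / real n" for j
    proof -
      have "cmod (J j) \<le> (E * C / (1 + (real n)\<^sup>2)) * (2 * (Re ?b - Re ?a) + 2 * (Im ?b - Im ?a))"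
        unfolding J_def
      proof (rule contour_integral_rectpath_bound)
        show "continuous_on (path_image ?p) (\<lambda>\<zeta>. weyl_function V U \<zeta> $ i $ j * F \<zeta> $ j - weyl_function V U' \<zeta> $ i $ j * F \<zeta> $ j)"
          by (intro continuous_on_diff c)
        fix z assume "z \<in> path_image ?p"
        then have z: "Re z = s n \<or> Re z = t n \<or> \<bar>Im z\<bar> = real n" unfolding im by auto
        then have "real n \<le> cmod z"
          using abs_Re_le_cmod[of z] abs_Im_le_cmod[of z] sn[of n] tn[of n] by auto
        then have zn: "(real n)\<^sup>2 \<le> (cmod z)\<^sup>2" by (intro power_mono) auto
        let ?d = "weyl_function V U z $ i $ j - weyl_function V U' z $ i $ j"
        have "cmod ?d * cmod (F z $ j) \<le> cmod ?d * (C * exp (2 * \<bar>Im z\<bar>) / (1 + (real n)\<^sup>2))"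
        proof (rule mult_left_mono)
          have "cmod (F z $ j) \<le> C * exp (2 * b * \<bar>Im z\<bar>) / (1 + (cmod z)\<^sup>2)" by (rule F(4))
          also have "\<dots> \<le> C * exp (2 * \<bar>Im z\<bar>) / (1 + (real n)\<^sup>2)"
          proof (rule frac_le)
            have "2 * b * \<bar>Im z\<bar> \<le> 2 * \<bar>Im z\<bar>" using F(2) by (intro mult_right_mono) auto
            then show "C * exp (2 * b * \<bar>Im z\<bar>) \<le> C * exp (2 * \<bar>Im z\<bar>)" using F(3) by simp
          qed (use zn F(3) in \<open>auto simp: add_pos_nonneg\<close>)
          finally show "cmod (F z $ j) \<le> C * exp (2 * \<bar>Im z\<bar>) / (1 + (real n)\<^sup>2)" .
        qed simp
        also have "\<dots> = (cmod ?d * exp (2 * \<bar>Im z\<bar>)) * (C / (1 + (real n)\<^sup>2))" by simp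
        also have "\<dots> \<le> E * (C / (1 + (real n)\<^sup>2))"
          using z n F(3) by (intro mult_right_mono diff[of z n]) (auto intro!: divide_nonneg_nonneg)
        finally show "cmod (weyl_function V U z $ i $ j * F z $ j - weyl_function V U' z $ i $ j * F z $ j) \<le> E * C / (1 + (real n)\<^sup>2)"
          by (simp add: norm_mult[symmetric] left_diff_distrib)
      qed (use st in auto)
      also have "\<dots> \<le> (E * C / (1 + (real n)\<^sup>2)) * (12 * real n)"
        using sn[of n] tn[of n] n E0 F(3) by (intro mult_left_mono) (auto intro!: divide_nonneg_nonneg)
      also have "\<dots> \<le> E * C * 12 / real n"
      proof -
        have "real n / (1 + (real n)\<^sup>2) \<le> 1 / real n"
          using st(6) by (simp add: divide_simps add_pos_nonneg power2_eq_square)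
        then have "(E * C * 12) * (real n / (1 + (real n)\<^sup>2)) \<le> (E * C * 12) * (1 / real n)"
          using E0 F(3) by (intro mult_left_mono) auto
        then show ?thesis by (simp add: mult_ac)
      qed
      finally show ?thesis .
    qed
    have "2 * pi * \<i> * (T U n i - T U' n i) = - (\<Sum>j\<in>UNIV. J j)"
    proof -
      have sw: "(\<Sum>x\<in>A. spectral_term W F x $ i) = - (\<Sum>j\<in>UNIV. \<Sum>x\<in>A. weyl_residue W x $ i $ j * F (of_real x) $ j)" for W A
        unfolding spectral_term_nth sum_negf by (subst sum.swap) simp
      show ?thesis unfolding T_def sw Jeq by (simp add: sum_subtractf sum_distrib_left[symmetric] algebra_simps)
    qed
    then have "2 * pi * cmod (T U n i - T U' n i) = cmod (\<Sum>j\<in>UNIV. J j)"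
      by (metis (no_types, lifting) norm_minus_cancel norm_mult norm_ii mult.right_neutral norm_of_real abs_of_pos pi_gt_zero norm_numeral of_real_mult of_real_numeral)
    also have "\<dots> \<le> Q / real n"
      using sum_norm_le[of UNIV J "\<lambda>_. E * C * 12 / real n"] Jb by (simp add: Q_def)
    finally have "2 * pi * cmod (T U n i - T U' n i) \<le> Q / real n" .
    moreover have "1 * cmod (T U n i - T U' n i) \<le>
      2 * pi * cmod (T U n i - T U' n i)"
      using pi_gt3 by (intro mult_right_mono) auto
    ultimately show ?thesis by simp
  qed
  show ?thesis by (rule that[of s t Q, OF sn tn main[unfolded T_def]])
qed

lemma window_sums_tendsto:
  assumes U: "U \<in> unitary_matrices" and g: "(g :: real \<Rightarrow> complex^'n) summable_on spectrum U"
    and s: "\<And>n::nat. s n \<le> - real n" and t: "\<And>n::nat. real n \<le> t n"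
  shows "(\<lambda>n. \<Sum>x\<in>spectrum U \<inter> {s n..t n}. g x) \<longlonglongrightarrow> infsum g (spectrum U)"
proof -
  have "(sum g \<longlongrightarrow> infsum g (spectrum U)) (finite_subsets_at_top (spectrum U))"
    using has_sum_infsum[OF g] by (simp add: has_sum_def)
  moreover have "filterlim (\<lambda>n. spectrum U \<inter> {s n..t n}) (finite_subsets_at_top (spectrum U)) sequentially"
    unfolding filterlim_finite_subsets_at_top
  proof (intro allI impI, elim conjE)
    fix X assume X: "finite X" "X \<subseteq> spectrum U"
    obtain N :: nat where N: "\<And>x. x \<in> X \<Longrightarrow> \<bar>x\<bar> \<le> real N"
    proof -
      obtain B where "\<And>x. x \<in> X \<Longrightarrow> \<bar>x\<bar> \<le> B" using finite_imp_bounded[OF X(1)] unfolding bounded_iff by auto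
      then show thesis using that real_arch_simple[of B] order_trans by blast
    qed
    show "\<forall>\<^sub>F n in sequentially. finite (spectrum U \<inter> {s n..t n}) \<and> X \<subseteq> spectrum U \<inter> {s n..t n} \<and> spectrum U \<inter> {s n..t n} \<subseteq> spectrum U"
    proof (rule eventually_sequentiallyI[of N])
      fix n assume "N \<le> n"
      then have "x \<in> {s n..t n}" if "x \<in> X" for x
        using N[OF that] s[of n] t[of n] by (auto simp: abs_le_iff)
      then show "finite (spectrum U \<inter> {s n..t n}) \<and> X \<subseteq> spectrum U \<inter> {s n..t n} \<and> spectrum U \<inter> {s n..t n} \<subseteq> spectrum U"
        using X(2) spectrum_locally_finite[OF U] by auto
    qed
  qed
  ultimately show ?thesis by (rule filterlim_compose)
qed

text \<open>The spectrum is locally finite and unbounded in both directions, so the numbering of the eigenvalues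
exists and is a bijection from the integers; the sum may be taken over the spectrum instead.\<close>

lemma spectral_measure_eq_infsum:
  assumes U: "U \<in> unitary_matrices" and F: "\<And>x. F (complex_of_real x) = g x"
  shows "spectral_measure V U g = infsum (spectral_term U F) (spectrum U)"
proof -
  have ex: "\<exists>!\<zeta> :: int \<Rightarrow> real. strict_mono \<zeta> \<and> range (\<lambda>j. complex_of_real (\<zeta> j)) = eigenvalues V U \<and> \<zeta> 0 < 0 \<and> 0 \<le> \<zeta> 1"
  proof -
    have "range (\<lambda>j. complex_of_real (\<zeta> j)) = eigenvalues V U \<longleftrightarrow> range \<zeta> = spectrum U" for \<zeta> :: "int \<Rightarrow> real"
    proof -
      have "range (\<lambda>j. complex_of_real (\<zeta> j)) = of_real ` range \<zeta>" by auto
      then show ?thesis unfolding eigenvalues_eq_spectrum[OF U] by (simp add: inj_image_eq_iff inj_of_real)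
    qed
    then show ?thesis
      using two_sided_enumeration[of "spectrum U", OF spectrum_locally_finite[OF U] spectrum_unbounded[OF U]] by simp
  qed
  define \<zeta> where "\<zeta> = eigenvalue_seq V U"
  have z: "strict_mono \<zeta>" "range (\<lambda>j. complex_of_real (\<zeta> j)) = eigenvalues V U"
    using theI'[OF ex] unfolding \<zeta>_def eigenvalue_seq_def by auto
  have "range (\<lambda>j. complex_of_real (\<zeta> j)) = of_real ` range \<zeta>" by auto
  then have r: "range \<zeta> = spectrum U"
    using z(2) unfolding eigenvalues_eq_spectrum[OF U] by (simp add: inj_image_eq_iff inj_of_real)
  have "spectral_measure V U g = (\<Sum>\<^sub>\<infinity>j\<in>UNIV. spectral_term U F (\<zeta> j))"
    unfolding spectral_measure_def measure_of_data_def spectral_data_def norming_matrix_def spectral_term_def \<zeta>_def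
    by (simp add: F)
  also have "\<dots> = infsum (spectral_term U F) (range \<zeta>)"
    using infsum_reindex[OF strict_mono_imp_inj_on[OF z(1)], of "spectral_term U F"] by (simp add: o_def)
  finally show ?thesis unfolding r .
qed

theorem spectral_measure_independent_of_boundary_condition:
  assumes U: "U \<in> unitary_matrices" "U' \<in> unitary_matrices"
    and f: "f \<in> schwartz" "closure {t. f t \<noteq> 0} \<subseteq> {-1<..<1}"
  shows "spectral_measure V U (fourier f) = spectral_measure V U' (fourier f)"
proof -
  obtain F :: "complex \<Rightarrow> complex^'n" and b C where F: "\<And>j. (\<lambda>z. F z $ j) holomorphic_on UNIV" "\<And>s. F (of_real s) = fourier f s" "b < 1" "0 < C"
    "\<And>z j. cmod (F z $ j) \<le> C * exp (2 * b * \<bar>Im z\<bar>) / (1 + (cmod z)\<^sup>2)"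
    using fourier_extension[OF f] by blast
  have bd: "cmod (F (of_real x) $ j) \<le> C / (1 + x\<^sup>2)" for x :: real and j
    using F(5)[of "of_real x" j] by simp
  have sm: "spectral_term W F summable_on spectrum W" if "W \<in> unitary_matrices" for W
    by (rule spectral_term_summable[OF that less_imp_le[OF F(4)] bd])
  obtain s t Q where st: "\<And>n::nat. s n \<in> {- real n - 1..- real n}" "\<And>n::nat. t n \<in> {real n..real n + 1}"
    "\<And>n i. 1 \<le> n \<Longrightarrow> cmod ((\<Sum>x\<in>spectrum U \<inter> {s n..t n}. spectral_term U F x $ i) -
       (\<Sum>x\<in>spectrum U' \<inter> {s n..t n}. spectral_term U' F x $ i)) \<le> Q / real n"
    using spectral_terms_window_difference[OF U F(1) less_imp_le[OF F(3)] F(4,5)] by blast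
  have st': "s n \<le> - real n" "real n \<le> t n" for n using st(1,2)[of n] by auto
  have "infsum (spectral_term U F) (spectrum U) $ i = infsum (spectral_term U' F) (spectrum U') $ i" for i
  proof -
    have lim: "(\<lambda>n. \<Sum>x\<in>spectrum W \<inter> {s n..t n}. spectral_term W F x $ i) \<longlonglongrightarrow> infsum (spectral_term W F) (spectrum W) $ i"
      if "W \<in> unitary_matrices" for W
      using tendsto_vec_nth[OF window_sums_tendsto[OF that sm[OF that] st'], of i] by simp
    have "(\<lambda>n. (\<Sum>x\<in>spectrum U \<inter> {s n..t n}. spectral_term U F x $ i) - (\<Sum>x\<in>spectrum U' \<inter> {s n..t n}. spectral_term U' F x $ i)) \<longlonglongrightarrow> 0"
    proof (rule Lim_null_comparison)
      show "\<forall>\<^sub>F n in sequentially. norm ((\<Sum>x\<in>spectrum U \<inter> {s n..t n}. spectral_term U F x $ i) - (\<Sum>x\<in>spectrum U' \<inter> {s n..t n}. spectral_term U' F x $ i)) \<le> Q / real n"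
        using st(3) by (intro eventually_sequentiallyI[of 1]) auto
      show "(\<lambda>n. Q / real n) \<longlonglongrightarrow> 0" by (rule lim_const_over_n)
    qed
    from LIMSEQ_unique[OF this tendsto_diff[OF lim[OF U(1)] lim[OF U(2)]]] show ?thesis by simp
  qed
  then have "infsum (spectral_term U F) (spectrum U) = infsum (spectral_term U' F) (spectrum U')"
    by (simp add: vec_eq_iff)
  then show ?thesis
    using spectral_measure_eq_infsum[where F = F and g = "fourier f", OF U(1) F(2)]
      spectral_measure_eq_infsum[where F = F and g = "fourier f", OF U(2) F(2)] by simp
qed

end

theorem lemma4p1:
  fixes r :: nat and p :: real
    and V :: "real \<Rightarrow> complex^'n^'n" and U :: "complex^'n^'n"
    and \<aa> :: "int \<Rightarrow> real \<times> (complex^'n^'n)"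
    and \<mu> \<nu> :: "(real \<Rightarrow> complex^'n) \<Rightarrow> complex^'n"
    and f :: "real \<Rightarrow> complex^'n"
  assumes "CARD('n) = 2 * r"
    and "1 \<le> p"
    and "V \<in> Lp01 p"
    and "U \<in> unitary_matrices"
    and "\<aa> = spectral_data V U"
    and "\<mu> = measure_of_data \<aa>"
    and "\<nu> = spectral_measure V (mat 1)"
    and "f \<in> schwartz"
    and "closure {t. f t \<noteq> 0} \<subseteq> {-1<..<1}"
  shows "H_dist U \<mu> f = H_dist (mat 1) \<nu> f"
proof -
  interpret V: integrable_potential V
    by unfold_locales (rule Lp01_imp_absolutely_integrable[OF assms(2,3)])
  interpret zero: integrable_potential "\<lambda>_. 0 :: complex^'n^'n"
    by unfold_locales simp
  have "\<mu> = spectral_measure V U" using assms(5,6) by (simp add: spectral_measure_def)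
  then show ?thesis
    unfolding H_dist_def hat_functional_def assms(7)
    using V.spectral_measure_independent_of_boundary_condition[OF assms(4) mat_1_unitary assms(8,9)]
      zero.spectral_measure_independent_of_boundary_condition[OF assms(4) mat_1_unitary assms(8,9)]
    by simp
qed

end
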